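(* Suppose that $0<\alpha<\frac12$ and $k\le c\min\{p^{\gamma},\frac{n}{\log p}\}$ for some constants $c>0$ and $0\le\gamma<\frac12$. Let $k_1\le(1-\zeta_0)k-1$ and $q\le\frac{\zeta_0}{4}k$ for some constant $0<\zeta_0<1$. Then for any $\theta^*=(\beta^*,\mathrm{I},\sigma)\in\Theta(k_1)$ and $\xi\in\Xi(q,\bar c)$, $$\inf_{\mathrm{CI}\in\mathcal{I}_\alpha(\Theta(k),\,\xi^{\intercal}\beta)}\mathbb{E}_{\theta^*}L(\mathrm{CI})\ge c_1\,\|\xi\|_2\Big(k\frac{\log p}{n}+\frac1{\sqrt n}\Big)\sigma$$ for some constant $c_1>0$.
   Context: Model: one observes $Z=(Z_1,\dots,Z_n)$ with $Z_i=(y_i,X_{i\cdot})\in\mathbb{R}^{p+1}$, $y=X\beta+\epsilon$, where $X\in\mathbb{R}^{n\times p}$ has i.i.d. rows $X_{i\cdot}\sim N_p(0,\Sigma)$, independent of $\epsilon\sim N_n(0,\sigma^2\mathrm{I})$; $\Sigma$ and $\sigma$ are unknown. Let $\Omega=\Sigma^{-1}$ and $\theta=(\beta,\Omega,\sigma)$; $\mathbb{P}_\theta,\mathbb{E}_\theta$ are the corresponding probability and expectation. $\mathrm{I}$ is the identity matrix. $\|x\|_0$ is the number of nonzero entries of $x$, $\mathrm{supp}(x)$ the set of their indices, $\|x\|_2$ the Euclidean norm. Parameter space: $\Theta(k)=\{(\beta,\Omega,\sigma):\|\beta\|_0\le k,\ \frac1{M_1}\le\lambda_{\min}(\Omega)\le\lambda_{\max}(\Omega)\le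 M_1,\ 0<\sigma\le M_2\}$, where $M_1>1$ and $M_2>0$ are constants. Loadings: $\Xi(q,\bar c)=\{\xi\in\mathbb{R}^p:\ \|\xi\|_0=q,\ \xi\ne 0,\ \max_{j\in\mathrm{supp}(\xi)}|\xi_j|\,/\min_{j\in\mathrm{supp}(\xi)}|\xi_j|\le\bar c\}$, where $\bar c\ge1$ is a constant. Confidence intervals: for a parameter space $\Theta$ and functional $\mathrm{T}$ of $\beta$, $\mathcal{I}_\alpha(\Theta,\mathrm{T})$ is the set of all intervals $\mathrm{CI}=[l(Z),u(Z)]$ with $\inf_{\theta\in\Theta}\mathbb{P}_\theta(l(Z)\le\mathrm{T}(\beta)\le u(Z))\ge1-\alpha$; the length is $L(\mathrm{CI})=u(Z)-l(Z)$. *)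

theory Defs
  imports "HOL-Probability.Probability" "Jordan_Normal_Form.Spectral_Radius"
    "Jordan_Normal_Form.Gauss_Jordan_Elimination"
begin

text \<open>
  The dimensions \<open>n\<close> and \<open>p\<close> have to vary inside a formula, so vectors and matrices are those of
  Jordan_Normal_Form. Random vectors are functions in \<open>{..<p} \<rightarrow>\<^sub>E UNIV\<close>, the space of a product
  measure, and \<open>Matrix.vec p\<close> converts them. The qualified names are needed because HOL-Analysis
  has its own \<open>vec\<close> and \<open>det\<close>.
\<close>

definition supp :: "real vec \<Rightarrow> nat set" where
  "supp v = {j. j < dim_vec v \<and> vec_index v j \<noteq> 0}"

definition norm0 :: "real vec \<Rightarrow> nat" where
  "norm0 v = card (supp v)"

definition norm2 :: "real vec \<Rightarrow> real" where
  "norm2 v = sqrt (\<Sum>j<dim_vec v. (vec_index v j)\<^sup>2)"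

text \<open>The lemma \<open>mat_inverse\<close> gives \<open>mat_inverse A = Some B\<close>, with \<open>B\<close> the two-sided inverse,
  for every invertible \<open>A\<close>. Only such matrices occur below.\<close>

definition inv_mat :: "real mat \<Rightarrow> real mat" where
  "inv_mat A = the (mat_inverse A)"

definition mvn_density :: "nat \<Rightarrow> real mat \<Rightarrow> (nat \<Rightarrow> real) \<Rightarrow> real" where
  "mvn_density p \<Sigma> x =
     exp (- scalar_prod (Matrix.vec p x) (inv_mat \<Sigma> *\<^sub>v Matrix.vec p x) / 2)
       / sqrt ((2 * pi) ^ p * Determinant.det \<Sigma>)"

definition mvn :: "nat \<Rightarrow> real mat \<Rightarrow> (nat \<Rightarrow> real) measure" where
  "mvn p \<Sigma> = density (PiM {..<p} (\<lambda>_. lborel)) (\<lambda>x. ennreal (mvn_density p \<Sigma> x))"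

type_synonym param = "real vec \<times> real mat \<times> real"
type_synonym data = "nat \<Rightarrow> real \<times> (nat \<Rightarrow> real)"

definition data_space :: "nat \<Rightarrow> nat \<Rightarrow> data measure" where
  "data_space n p = PiM {..<n} (\<lambda>_. borel \<Otimes>\<^sub>M PiM {..<p} (\<lambda>_. borel))"

fun data_law :: "nat \<Rightarrow> nat \<Rightarrow> param \<Rightarrow> data measure" where
  "data_law n p (\<beta>, \<Omega>, \<sigma>) =
     distr (PiM {..<n} (\<lambda>_. mvn p (inv_mat \<Omega>)) \<Otimes>\<^sub>M mvn n (\<sigma>\<^sup>2 \<cdot>\<^sub>m 1\<^sub>m n)) (data_space n p)
       (\<lambda>(X, \<epsilon>). \<lambda>i\<in>{..<n}. (scalar_prod (Matrix.vec p (X i)) \<beta> + \<epsilon> i, X i))"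

definition lambda_min :: "real mat \<Rightarrow> real" where
  "lambda_min A = Min (spectrum A)"

definition lambda_max :: "real mat \<Rightarrow> real" where
  "lambda_max A = Max (spectrum A)"

text \<open>Symmetry of \<open>\<Omega>\<close> is implicit in its being the inverse of a covariance matrix.\<close>

definition Theta :: "real \<Rightarrow> real \<Rightarrow> nat \<Rightarrow> nat \<Rightarrow> param set" where
  "Theta M1 M2 p k = {(\<beta>, \<Omega>, \<sigma>).
     \<beta> \<in> carrier_vec p \<and> norm0 \<beta> \<le> k \<and>
     \<Omega> \<in> carrier_mat p p \<and> transpose_mat \<Omega> = \<Omega> \<and>
     1 / M1 \<le> lambda_min \<Omega> \<and> lambda_min \<Omega> \<le> lambda_max \<Omega> \<and> lambda_max \<Omega> \<le> M1 \<and>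
     0 < \<sigma> \<and> \<sigma> \<le> M2}"

definition Xi :: "nat \<Rightarrow> nat \<Rightarrow> real \<Rightarrow> real vec set" where
  "Xi p q cbar = {\<xi> \<in> carrier_vec p. norm0 \<xi> = q \<and> \<xi> \<noteq> 0\<^sub>v p \<and>
     Max ((\<lambda>j. \<bar>vec_index \<xi> j\<bar>) ` supp \<xi>) / Min ((\<lambda>j. \<bar>vec_index \<xi> j\<bar>) ` supp \<xi>) \<le> cbar}"

definition CIs ::
    "nat \<Rightarrow> nat \<Rightarrow> real \<Rightarrow> param set \<Rightarrow> (real vec \<Rightarrow> real) \<Rightarrow> ((data \<Rightarrow> real) \<times> (data \<Rightarrow> real)) set" where
  "CIs n p \<alpha> \<Theta> T = {(l, u).
     l \<in> borel_measurable (data_space n p) \<and> u \<in> borel_measurable (data_space n p) \<and>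
     (\<forall>z\<in>space (data_space n p). l z \<le> u z) \<and>
     (INF \<theta>\<in>\<Theta>. measure (data_law n p \<theta>)
        {z \<in> space (data_space n p). l z \<le> T (fst \<theta>) \<and> T (fst \<theta>) \<le> u z}) \<ge> 1 - \<alpha>}"

text \<open>Valued in \<open>ennreal\<close>, because a Bochner integral would give length 0 to an interval whose
  length is not integrable.\<close>

fun expected_length ::
    "nat \<Rightarrow> nat \<Rightarrow> param \<Rightarrow> (data \<Rightarrow> real) \<times> (data \<Rightarrow> real) \<Rightarrow> ennreal" where
  "expected_length n p \<theta> (l, u) = (\<integral>\<^sup>+ z. ennreal (u z - l z) \<partial>data_law n p \<theta>)"

end

theory Submission
  imports Defs
begin

text \<open>
  Two facts about the same interval give the bound: if \<open>[l, u]\<close> covers \<open>T0\<close> under a law \<open>P\<close>, and covers \<open>T1\<close>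
  under every member of a finite family of laws whose average is close to \<open>P\<close>, then it contains both
  \<open>T0\<close> and \<open>T1\<close> with probability bounded below under \<open>P\<close>, so its expected length is at least a
  constant times \<open>\<bar>T1 - T0\<bar>\<close> (\<open>expected_length_lower_bound\<close>). Closeness means that the average
  likelihood ratio has second moment at most \<open>1 + r\<^sup>2\<close>. This bound is applied
  with two families, for
  \<open>w = \<xi> / \<parallel>\<xi>\<parallel>\<close>.

  \<^item> Parametric rate (\<open>length_bound_parametric\<close>). Shifting \<open>\<beta>\<close> by \<open>\<sigma> \<tau> w\<close> with
    \<open>\<tau> = t / sqrt n\<close> changes \<open>\<xi> \<bullet> \<beta>\<close> by \<open>\<sigma> \<tau> \<parallel>\<xi>\<parallel>\<close>, and the \<open>n\<close> rows together have a
    bounded second moment.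

  \<^item> Rate \<open>k log p / n\<close> (\<open>length_bound_spike\<close>). Let \<open>e\<close> be the standardised noise under the null
    and let \<open>c\<close> be the indicator of a set \<open>S\<close> of \<open>s\<close> coordinates outside the support of \<open>\<xi>\<close>, with
    \<open>s\<close> of order \<open>k\<close>. The alternative keeps \<open>e\<close> and \<open>w \<bullet> x\<close> independent standard normal and adds
    \<open>A (e + w \<bullet> x)\<close> to every coordinate in \<open>S\<close>. Its likelihood ratio is
    \<open>exp (h (c \<bullet> x) - s h\<^sup>2 / 2)\<close> with \<open>h = A (e + w \<bullet> x)\<close>. Read as a regression of the response on
    \<open>x\<close>, it is a member of the model with a non-identity covariance, and its coefficient vector differs
    from \<open>\<beta>\<close> by a vector with component \<open>- \<sigma> s A\<^sup>2 / (1 + s A\<^sup>2)\<close> along \<open>w\<close>, whatever \<open>S\<close> is. So all these alternatives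
    move \<open>\<xi> \<bullet> \<beta>\<close> by the same amount, of order \<open>\<parallel>\<xi>\<parallel> \<sigma> s A\<^sup>2\<close>, while
    each single coordinate of \<open>x\<close> carries a signal of size \<open>A\<close> only. Taking \<open>A\<^sup>2 = \<eta> log p / n\<close>
    with a small constant \<open>\<eta>\<close> gives the rate.

  The likelihood ratios for \<open>S\<close> and \<open>S'\<close> have inner product \<open>(1 - 4 A\<^sup>2 J) powr (- 1 / 2)\<close> in each
  row, where \<open>J\<close> is the size of \<open>S \<inter> S'\<close> (\<open>spike_lr_correlation\<close>). So \<open>n\<close> rows contribute at most
  \<open>z ^ J\<close> with \<open>z = exp (4 A\<^sup>2 n) = p powr (4 \<eta>)\<close>. Cutting the free coordinates into \<open>s\<close> blocks of
  size \<open>B\<close>, of order \<open>p / s\<close>, and choosing one element of each block independently makes \<open>J\<close>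
  binomial with parameters \<open>s\<close> and \<open>1 / B\<close>. The average of \<open>z ^ J\<close> is then at most
  \<open>exp (s z / B)\<close> (\<open>mixture_second_moment\<close>), which tends to 1: the exponent is at most of order
  \<open>p powr (2 \<gamma> - 1 + 4 \<eta>)\<close>, where \<open>\<gamma> < 1 / 2\<close> and \<open>\<eta>\<close> is small. For bounded \<open>p\<close> the sparsity \<open>k\<close> is bounded as well, and
  the parametric rate dominates.
\<close>

section \<open>Inverse matrices and rank-one determinants\<close>

text \<open>
  In finite dimension a one-sided inverse is two-sided, so a single product identifies \<open>inv_mat\<close>.
\<close>

lemma inv_mat_eqI:
  assumes "A \<in> carrier_mat n n" "B \<in> carrier_mat n n" and AB: "A * B = 1\<^sub>m n"
  shows "inv_mat A = B"
proof -
  have BA: "B * A = 1\<^sub>m n"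
    using mat_mult_left_right_inverse[OF assms] .
  have unit: "A \<in> Units (ring_mat TYPE(real) n ())"
    unfolding Units_def using assms BA by (auto simp: ring_mat_simps)
  have "mat_inverse A \<noteq> None"
    using mat_inverse(1)[OF assms(1), of "()"] unit by blast
  then obtain C where C: "mat_inverse A = Some C"
    by blast
  have CA: "C * A = 1\<^sub>m n" and Cc: "C \<in> carrier_mat n n"
    using mat_inverse(2)[OF assms(1) C] by auto
  have "C = C * (A * B)"
    using Cc AB by simp
  also have "\<dots> = C * A * B"
    by (rule assoc_mult_mat[OF Cc assms(1,2), symmetric])
  also have "\<dots> = B"
    using CA assms(2) by simp
  finally have "C = B" .
  then show ?thesis
    by (simp add: inv_mat_def C)
qed

lemma inv_mat_one: "inv_mat (1\<^sub>m n) = 1\<^sub>m n"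
  by (rule inv_mat_eqI) auto

lemma inv_mat_scaled_one: "a \<noteq> 0 \<Longrightarrow> inv_mat (a \<cdot>\<^sub>m 1\<^sub>m n) = (1 / a) \<cdot>\<^sub>m 1\<^sub>m n"
  by (rule inv_mat_eqI[where n = n])
    (simp_all add: mult_smult_assoc_mat[where nr = n and n = n and nc = n]
      mult_smult_distrib[where nr = n and n = n and nc = n], auto)

lemma quad_form_eq_double_sum:
  assumes "M \<in> carrier_mat p p"
  shows "scalar_prod (Matrix.vec p x) (M *\<^sub>v Matrix.vec p y) =
    (\<Sum>i<p. \<Sum>j<p. x i * M $$ (i, j) * y j)"
  using assms
  by (auto simp: scalar_prod_def lessThan_atLeast0 sum_distrib_left mult.assoc intro!: sum.cong)

text \<open>
  The block matrix with blocks \<open>1\<close>, \<open>u\<close>, \<open>- v\<close>, \<open>1\<close> can be reduced to a block triangular one in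
  two ways, by eliminating either off-diagonal block. One leaves the rank-one perturbation and the
  other the scalar \<open>1 + v \<bullet> u\<close> on the diagonal.
\<close>

lemma det_one_plus_rank_one:
  fixes u v :: "nat \<Rightarrow> real"
  shows "Determinant.det (mat p p (\<lambda>(i, j). of_bool (i = j) + u i * v j)) = 1 + (\<Sum>i<p. v i * u i)"
proof -
  let ?M = "mat p p (\<lambda>(i, j). of_bool (i = j) + u i * v j)"
  let ?U = "mat p 1 (\<lambda>(i, j). u i)" and ?V = "mat 1 p (\<lambda>(i, j). v j)"
  let ?W = "mat 1 p (\<lambda>(i, j). - v j)"
  let ?K = "four_block_mat (1\<^sub>m p) ?U ?W (1\<^sub>m 1)"
  let ?a = "1 + (\<Sum>i<p. v i * u i)"
  have MK: "four_block_mat ?M ?U (0\<^sub>m 1 p) (1\<^sub>m 1) * four_block_mat (1\<^sub>m p) (0\<^sub>m p 1) ?W (1\<^sub>m 1) = ?K"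
    by (subst mult_four_block_mat[where ?nr1.0 = p and ?n1.0 = p and ?n2.0 = 1 and ?nr2.0 = 1
          and ?nc1.0 = p and ?nc2.0 = 1])
      (auto intro!: cong_four_block_mat eq_matI simp: scalar_prod_def)
  have "four_block_mat (1\<^sub>m p) (0\<^sub>m p 1) ?V (1\<^sub>m 1) * ?K =
      four_block_mat (1\<^sub>m p) ?U (0\<^sub>m 1 p) (mat 1 1 (\<lambda>_. ?a))"
    by (subst mult_four_block_mat[where ?nr1.0 = p and ?n1.0 = p and ?n2.0 = 1 and ?nr2.0 = 1
          and ?nc1.0 = p and ?nc2.0 = 1])
      (auto intro!: cong_four_block_mat eq_matI simp: scalar_prod_def lessThan_atLeast0)
  then have VK: "Determinant.det (four_block_mat (1\<^sub>m p) (0\<^sub>m p 1) ?V (1\<^sub>m 1)) * Determinant.det ?K =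
      Determinant.det (four_block_mat (1\<^sub>m p) ?U (0\<^sub>m 1 p) (mat 1 1 (\<lambda>_. ?a)))"
    by (subst det_mult[symmetric, of _ "p + 1"]) auto
  have "Determinant.det ?K = Determinant.det ?M"
    unfolding MK[symmetric]
    by (subst det_mult[of _ "p + 1"])
      (auto simp: det_four_block_mat_lower_left_zero[where n = p and m = 1]
        det_four_block_mat_upper_right_zero[where n = p and m = 1])
  moreover have "Determinant.det ?K = ?a"
    using VK
    by (simp add: det_four_block_mat_lower_left_zero[where n = p and m = 1]
        det_four_block_mat_upper_right_zero[where n = p and m = 1] det_single)
  ultimately show ?thesis by simp
qed

section \<open>The spiked covariance matrix\<close>

text \<open>
  The data of one alternative: \<open>w\<close> will be the direction of the loading, \<open>c\<close> the indicator of
  \<open>s\<close> coordinates outside its support, and \<open>A\<close> the strength of the perturbation.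
\<close>

locale spike =
  fixes p :: nat and w c :: "nat \<Rightarrow> real" and A s :: real
  assumes w_unit: "(\<Sum>j<p. w j * w j) = 1"
    and orth: "(\<Sum>j<p. w j * c j) = 0"
    and c_norm: "(\<Sum>j<p. c j * c j) = s"
begin

lemma s_nonneg: "0 \<le> s"
  unfolding c_norm[symmetric] by (intro sum_nonneg) simp

definition \<kappa> :: real where "\<kappa> = 1 + s * A\<^sup>2"

lemma kappa_ge: "1 \<le> \<kappa>"
  using s_nonneg by (simp add: \<kappa>_def)

text \<open>
  The covariance of a standard normal vector to which \<open>A (y + w \<bullet> x) c\<close> has been added, for an
  independent standard normal \<open>y\<close>.
\<close>

definition cov :: "real mat" where
  "cov = mat p p (\<lambda>(i, j). of_bool (i = j) + w i * (A * c j) + c i * (A * w j + 2 * A\<^sup>2 * c j))"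

definition prec :: "real mat" where
  "prec = mat p p (\<lambda>(i, j). of_bool (i = j)
     + (s * A\<^sup>2 * w i - A * c i) / \<kappa> * w j + (- A * w i - A\<^sup>2 * c i) / \<kappa> * c j)"

lemma carriers [simp]: "cov \<in> carrier_mat p p" "prec \<in> carrier_mat p p"
  by (simp_all add: cov_def prec_def)

lemma orth': "(\<Sum>j<p. c j * w j) = 0"
  using orth by (simp add: mult.commute)

text \<open>
  Every matrix in this section is the identity plus something in the span of \<open>w\<close> and \<open>c\<close>, and this
  is the rule by which they multiply.
\<close>

lemma rank_two_product:
  assumes "i < p" "j < p"
  shows "(\<Sum>k<p. (of_bool (i = k) + a * w k + b * c k) * (of_bool (k = j) + w k * d + c k * e)) =
    of_bool (i = j) + w i * d + c i * e + a * w j + b * c j + a * d + b * e * s"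
proof -
  have "(\<Sum>k<p. (of_bool (i = k) + a * w k + b * c k) * (of_bool (k = j) + w k * d + c k * e)) =
    (\<Sum>k<p. of_bool (i = k) * (of_bool (k = j) + w k * d + c k * e))
    + (\<Sum>k<p. (a * w k + b * c k) * of_bool (k = j))
    + a * d * (\<Sum>k<p. w k * w k) + a * e * (\<Sum>k<p. w k * c k)
    + b * d * (\<Sum>k<p. c k * w k) + b * e * (\<Sum>k<p. c k * c k)"
    unfolding sum_distrib_left sum.distrib[symmetric]
    by (rule sum.cong) (auto simp: algebra_simps)
  also have "(\<Sum>k<p. of_bool (i = k) * (of_bool (k = j) + w k * d + c k * e)) =
      of_bool (i = j) + w i * d + c i * e"
    using assms by (simp add: of_bool_def if_distrib[of "\<lambda>x. x * _"] cong: if_cong)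
  also have "(\<Sum>k<p. (a * w k + b * c k) * of_bool (k = j)) = a * w j + b * c j"
    using assms by (simp add: of_bool_def if_distrib[of "\<lambda>x. _ * x"] cong: if_cong)
  finally show ?thesis
    by (simp add: w_unit orth orth' c_norm)
qed

lemma prec_times_cov: "prec * cov = 1\<^sub>m p"
proof (rule eq_matI)
  fix i j assume ij: "i < dim_row (1\<^sub>m p :: real mat)" "j < dim_col (1\<^sub>m p :: real mat)"
  have "(prec * cov) $$ (i, j) =
    (\<Sum>k<p. (of_bool (i = k) + (s * A\<^sup>2 * w i - A * c i) / \<kappa> * w k + (- A * w i - A\<^sup>2 * c i) / \<kappa> * c k)
       * (of_bool (k = j) + w k * (A * c j) + c k * (A * w j + 2 * A\<^sup>2 * c j)))"
    using ij by (simp add: prec_def cov_def scalar_prod_def lessThan_atLeast0)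
  also have "\<dots> = of_bool (i = j) + (w i * (A * c j) + c i * (A * w j + 2 * A\<^sup>2 * c j))
      + ((s * A\<^sup>2 * w i - A * c i) * (w j + A * c j)
        + (- A * w i - A\<^sup>2 * c i) * (c j + s * (A * w j + 2 * A\<^sup>2 * c j))) / \<kappa>"
    using ij by (subst rank_two_product) (simp_all add: add_divide_distrib diff_divide_distrib algebra_simps power2_eq_square)
  also have "(s * A\<^sup>2 * w i - A * c i) * (w j + A * c j)
        + (- A * w i - A\<^sup>2 * c i) * (c j + s * (A * w j + 2 * A\<^sup>2 * c j)) =
      - (w i * (A * c j) + c i * (A * w j + 2 * A\<^sup>2 * c j)) * \<kappa>"
    by (simp add: \<kappa>_def algebra_simps power2_eq_square)
  also have "of_bool (i = j) + (w i * (A * c j) + c i * (A * w j + 2 * A\<^sup>2 * c j))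
      + - (w i * (A * c j) + c i * (A * w j + 2 * A\<^sup>2 * c j)) * \<kappa> / \<kappa> = of_bool (i = j)"
    using kappa_ge by simp
  finally show "(prec * cov) $$ (i, j) = 1\<^sub>m p $$ (i, j)"
    using ij by simp
qed (simp_all add: prec_def cov_def)

lemma inv_prec: "inv_mat prec = cov"
  by (rule inv_mat_eqI[OF _ _ prec_times_cov]) simp_all

lemma inv_cov: "inv_mat cov = prec"
  by (rule inv_mat_eqI[of _ p]) (simp_all add: mat_mult_left_right_inverse[OF _ _ prec_times_cov])

text \<open>
  The covariance is the product of the rank-one perturbations
  \<open>1 + c (A w + A\<^sup>2 c)'\<close> and \<open>1 + A w c'\<close>, with a prime for
  transposition, and orthogonality makes the second one unipotent.
\<close>

lemma det_cov: "Determinant.det cov = \<kappa>"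
proof -
  let ?L = "mat p p (\<lambda>(i, j). of_bool (i = j) + c i * (A * w j + A\<^sup>2 * c j))"
  let ?R = "mat p p (\<lambda>(i, j). of_bool (i = j) + w i * (A * c j))"
  have "?L * ?R = cov"
  proof (rule eq_matI)
    fix i j assume ij: "i < dim_row cov" "j < dim_col cov"
    then have ij: "i < p" "j < p"
      by (simp_all add: cov_def)
    have "(?L * ?R) $$ (i, j) = (\<Sum>k<p. (of_bool (i = k) + c i * A * w k + c i * A\<^sup>2 * c k)
       * (of_bool (k = j) + w k * (A * c j) + c k * 0))"
      using ij by (simp add: scalar_prod_def lessThan_atLeast0 algebra_simps)
    also have "\<dots> = cov $$ (i, j)"
      using ij
      by (subst rank_two_product) (simp_all add: cov_def algebra_simps power2_eq_square)
    finally show "(?L * ?R) $$ (i, j) = cov $$ (i, j)" .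
  qed (simp_all add: cov_def)
  moreover have "Determinant.det (?L * ?R) = Determinant.det ?L * Determinant.det ?R"
    by (rule det_mult[of _ p]) simp_all
  moreover have "Determinant.det ?R = 1"
    by (subst det_one_plus_rank_one) (simp add: mult.assoc sum_distrib_left[symmetric] orth')
  moreover have "Determinant.det ?L = \<kappa>"
  proof -
    have "(\<Sum>i<p. (A * w i + A\<^sup>2 * c i) * c i) =
        A * (\<Sum>i<p. w i * c i) + A\<^sup>2 * (\<Sum>i<p. c i * c i)"
      by (simp add: distrib_right sum.distrib sum_distrib_left mult.assoc)
    then show ?thesis
      by (subst det_one_plus_rank_one) (simp add: \<kappa>_def orth c_norm)
  qed
  ultimately show ?thesis by simp
qed

lemma prec_mult_vec:
  assumes "v \<in> carrier_vec p" "i < p"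
  shows "vec_index (prec *\<^sub>v v) i = vec_index v i
    + (s * A\<^sup>2 * w i - A * c i) / \<kappa> * (\<Sum>j<p. w j * vec_index v j)
    + (- A * w i - A\<^sup>2 * c i) / \<kappa> * (\<Sum>j<p. c j * vec_index v j)"
proof -
  have "vec_index (prec *\<^sub>v v) i = (\<Sum>j<p. (of_bool (i = j)
     + (s * A\<^sup>2 * w i - A * c i) / \<kappa> * w j + (- A * w i - A\<^sup>2 * c i) / \<kappa> * c j) * vec_index v j)"
    using assms by (simp add: prec_def scalar_prod_def lessThan_atLeast0)
  also have "\<dots> = (\<Sum>j<p. of_bool (i = j) * vec_index v j)
    + (s * A\<^sup>2 * w i - A * c i) / \<kappa> * (\<Sum>j<p. w j * vec_index v j)
    + (- A * w i - A\<^sup>2 * c i) / \<kappa> * (\<Sum>j<p. c j * vec_index v j)"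
    unfolding sum_distrib_left sum.distrib[symmetric]
    by (rule sum.cong) (auto simp: algebra_simps)
  also have "(\<Sum>j<p. of_bool (i = j) * vec_index v j) = vec_index v i"
    using assms by (simp add: of_bool_def if_distrib[of "\<lambda>x. x * _"] cong: if_cong)
  finally show ?thesis .
qed

lemma prec_quad_form:
  "scalar_prod (Matrix.vec p x) (prec *\<^sub>v Matrix.vec p x) = (\<Sum>j<p. (x j)\<^sup>2)
    + (s * A\<^sup>2 * (\<Sum>j<p. w j * x j)\<^sup>2 - 2 * A * (\<Sum>j<p. w j * x j) * (\<Sum>j<p. c j * x j)
      - A\<^sup>2 * (\<Sum>j<p. c j * x j)\<^sup>2) / \<kappa>"
proof -
  define W V where "W = (\<Sum>j<p. w j * x j)" and "V = (\<Sum>j<p. c j * x j)"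
  have "scalar_prod (Matrix.vec p x) (prec *\<^sub>v Matrix.vec p x) =
      (\<Sum>i<p. x i * vec_index (prec *\<^sub>v Matrix.vec p x) i)"
    by (simp add: scalar_prod_def lessThan_atLeast0 prec_def)
  also have "\<dots> = (\<Sum>i<p. x i * (x i
    + (s * A\<^sup>2 * w i - A * c i) / \<kappa> * W + (- A * w i - A\<^sup>2 * c i) / \<kappa> * V))"
    by (intro sum.cong refl) (subst prec_mult_vec, auto simp: W_def V_def)
  also have "\<dots> = (\<Sum>i<p. (x i)\<^sup>2 + (s * A\<^sup>2 * W / \<kappa> - A * V / \<kappa>) * (w i * x i)
      + (- A * W / \<kappa> - A\<^sup>2 * V / \<kappa>) * (c i * x i))"
    by (intro sum.cong refl) (simp add: algebra_simps power2_eq_square diff_divide_distrib add_divide_distrib)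
  also have "\<dots> = (\<Sum>j<p. (x j)\<^sup>2) + (s * A\<^sup>2 * W / \<kappa> - A * V / \<kappa>) * W
      + (- A * W / \<kappa> - A\<^sup>2 * V / \<kappa>) * V"
    by (simp add: sum.distrib sum_distrib_left[symmetric] W_def V_def)
  finally show ?thesis
    by (simp add: W_def[symmetric] V_def[symmetric] algebra_simps power2_eq_square
        diff_divide_distrib add_divide_distrib)
qed

lemma prec_symmetric: "transpose_mat prec = prec"
  by (rule eq_matI) (auto simp: prec_def add_divide_distrib diff_divide_distrib algebra_simps)

text \<open>
  The difference of the two forms involves only \<open>w \<bullet> x\<close> and \<open>c \<bullet> x\<close>, which Cauchy and Schwarz bound by
  \<open>\<parallel>x\<parallel>\<close> and \<open>sqrt s \<parallel>x\<parallel>\<close>.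
\<close>

lemma prec_form_near_identity:
  "\<bar>scalar_prod (Matrix.vec p x) (prec *\<^sub>v Matrix.vec p x) - (\<Sum>j<p. (x j)\<^sup>2)\<bar>
    \<le> (2 * (s * A\<^sup>2) + 2 * \<bar>A\<bar> * sqrt s) * (\<Sum>j<p. (x j)\<^sup>2)"
proof -
  define W V N where "W = (\<Sum>j<p. w j * x j)" and "V = (\<Sum>j<p. c j * x j)" and "N = (\<Sum>j<p. (x j)\<^sup>2)"
  have "W\<^sup>2 \<le> (\<Sum>j<p. (w j)\<^sup>2) * N"
    unfolding W_def N_def by (rule Cauchy_Schwarz_ineq_sum)
  then have W: "W\<^sup>2 \<le> N"
    using w_unit by (simp add: power2_eq_square)
  have "V\<^sup>2 \<le> (\<Sum>j<p. (c j)\<^sup>2) * N"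
    unfolding V_def N_def by (rule Cauchy_Schwarz_ineq_sum)
  then have V: "V\<^sup>2 \<le> s * N"
    using c_norm by (simp add: power2_eq_square)
  have N: "0 \<le> N"
    unfolding N_def by (intro sum_nonneg) simp
  have WV: "\<bar>W * V\<bar> \<le> sqrt s * N"
  proof (rule power2_le_imp_le)
    have "\<bar>W * V\<bar>\<^sup>2 = W\<^sup>2 * V\<^sup>2"
      by (simp add: power_mult_distrib)
    also have "\<dots> \<le> N * (s * N)"
      using W V N by (intro mult_mono) auto
    also have "\<dots> = (sqrt s * N)\<^sup>2"
      using s_nonneg by (simp add: power_mult_distrib power2_eq_square)
    finally show "\<bar>W * V\<bar>\<^sup>2 \<le> (sqrt s * N)\<^sup>2" .
  qed (use s_nonneg N in simp)
  have triangle: "\<bar>a - b - d\<bar> \<le> \<bar>a\<bar> + \<bar>b\<bar> + \<bar>d\<bar>" for a b d :: real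
    by simp
  have "\<bar>(s * A\<^sup>2 * W\<^sup>2 - 2 * A * W * V - A\<^sup>2 * V\<^sup>2) / \<kappa>\<bar> \<le> \<bar>s * A\<^sup>2 * W\<^sup>2 - 2 * A * W * V - A\<^sup>2 * V\<^sup>2\<bar>"
    using kappa_ge by (simp add: divide_le_eq mult_left_le_one_le abs_mult mult_le_cancel_left1)
  also have "\<dots> \<le> \<bar>s * A\<^sup>2 * W\<^sup>2\<bar> + \<bar>2 * A * (W * V)\<bar> + \<bar>A\<^sup>2 * V\<^sup>2\<bar>"
    using triangle[of "s * A\<^sup>2 * W\<^sup>2" "2 * A * (W * V)" "A\<^sup>2 * V\<^sup>2"] by (simp only: mult.assoc)
  also have "\<dots> = s * A\<^sup>2 * W\<^sup>2 + 2 * \<bar>A\<bar> * \<bar>W * V\<bar> + A\<^sup>2 * V\<^sup>2"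
    using s_nonneg by (simp add: abs_mult)
  also have "\<dots> \<le> s * A\<^sup>2 * N + 2 * \<bar>A\<bar> * (sqrt s * N) + A\<^sup>2 * (s * N)"
    using W V WV s_nonneg by (intro add_mono mult_left_mono) auto
  also have "\<dots> = (2 * (s * A\<^sup>2) + 2 * \<bar>A\<bar> * sqrt s) * N"
    by (simp add: algebra_simps)
  finally show ?thesis
    unfolding prec_quad_form W_def[symmetric] V_def[symmetric] N_def[symmetric] by simp
qed

lemma eigenvalue_prec_bounds:
  assumes "eigenvalue prec l"
  shows "\<bar>l - 1\<bar> \<le> 2 * (s * A\<^sup>2) + 2 * \<bar>A\<bar> * sqrt s"
proof -
  obtain v where v: "v \<in> carrier_vec p" "v \<noteq> 0\<^sub>v p" "prec *\<^sub>v v = l \<cdot>\<^sub>v v"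
    using assms by (auto simp: eigenvalue_def eigenvector_def prec_def)
  define N where "N = (\<Sum>j<p. (vec_index v j)\<^sup>2)"
  have vv: "Matrix.vec p (vec_index v) = v"
    using v by auto
  obtain j where "j < p" "vec_index v j \<noteq> 0"
    using v by (metis eq_vecI carrier_vecD index_zero_vec)
  then have N: "0 < N"
    unfolding N_def by (intro sum_pos2[of _ j]) auto
  have "scalar_prod v (prec *\<^sub>v v) = l * N"
    using v by (simp add: scalar_prod_def N_def lessThan_atLeast0 sum_distrib_left power2_eq_square mult_ac)
  then have "\<bar>l * N - N\<bar> \<le> (2 * (s * A\<^sup>2) + 2 * \<bar>A\<bar> * sqrt s) * N"
    using prec_form_near_identity[of "vec_index v"] by (simp add: vv N_def)
  moreover have "\<bar>l * N - N\<bar> = \<bar>l - 1\<bar> * N"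
    using N by (metis abs_mult abs_of_pos left_diff_distrib mult_1)
  ultimately show ?thesis
    using N by simp
qed

text \<open>
  A coordinate outside both supports gives an eigenvector. It is needed because \<open>lambda_min\<close> and
  \<open>lambda_max\<close> say something only if the real spectrum is nonempty.
\<close>

lemma eigenvalue_prec_one:
  assumes "j < p" "w j = 0" "c j = 0"
  shows "eigenvalue prec 1"
  unfolding eigenvalue_def eigenvector_def
proof (intro exI conjI)
  show "prec *\<^sub>v unit_vec p j = 1 \<cdot>\<^sub>v unit_vec p j"
    using assms
    by (intro eq_vecI) (simp_all add: prec_mult_vec if_distrib[of "\<lambda>x. _ * x"] cong: if_cong, simp_all add: prec_def)
qed (use assms in \<open>simp_all add: prec_def unit_vec_nonzero\<close>)

lemma spectrum_prec_bounds:
  assumes "j < p" "w j = 0" "c j = 0"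
    and "1 < M" "2 * (s * A\<^sup>2) + 2 * \<bar>A\<bar> * sqrt s \<le> 1 - 1 / M"
  shows "1 / M \<le> lambda_min prec" "lambda_min prec \<le> lambda_max prec" "lambda_max prec \<le> M"
proof -
  have fin: "finite (spectrum prec)"
    by (rule card_finite_spectrum(1)[of _ p]) simp
  have one: "1 \<in> spectrum prec"
    using eigenvalue_prec_one[OF assms(1-3)] by (simp add: spectrum_def)
  have b: "1 / M \<le> l \<and> l \<le> M" if "l \<in> spectrum prec" for l
  proof -
    have "\<bar>l - 1\<bar> \<le> 1 - 1 / M"
      using eigenvalue_prec_bounds[of l] that assms(5) by (simp add: spectrum_def)
    \<comment> \<open>an interval around 1 of radius \<open>1 - 1 / M\<close> reaches less far up than \<open>[1 / M, M]\<close> does\<close>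
    moreover have "2 - 1 / M \<le> M"
    proof -
      have "0 \<le> (M - 1)\<^sup>2 / M"
        using assms(4) by simp
      also have "\<dots> = M - (2 - 1 / M)"
        using assms(4) by (simp add: field_simps power2_eq_square)
      finally show ?thesis by simp
    qed
    ultimately show ?thesis by linarith
  qed
  have "Min (spectrum prec) \<in> spectrum prec" "Max (spectrum prec) \<in> spectrum prec"
    using fin one by (auto intro!: Min_in Max_in)
  then show "1 / M \<le> lambda_min prec" "lambda_max prec \<le> M"
    using b by (auto simp: lambda_min_def lambda_max_def)
  show "lambda_min prec \<le> lambda_max prec"
    unfolding lambda_min_def lambda_max_def
    using fin one by (blast intro: order_trans[OF Min_le Max_ge])
qed

end

section \<open>Gaussian integrals\<close>

abbreviation std_normal :: "real measure" where
  "std_normal \<equiv> density lborel (\<lambda>x. ennreal (std_normal_density x))"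

lemma prob_space_std_normal: "prob_space std_normal"
  by (rule prob_space_normal_density) simp

lemma sigma_finite_std_normal: "sigma_finite_measure std_normal"
  using prob_space_std_normal by (rule prob_space_imp_sigma_finite)

lemma std_normal_mgf: "(\<integral>\<^sup>+ x. ennreal (exp (r * x)) \<partial>std_normal) = ennreal (exp (r\<^sup>2 / 2))"
proof -
  have eq: "std_normal_density x * exp (r * x) = exp (r\<^sup>2 / 2) * normal_density r 1 x" for x
    by (simp add: normal_density_def mult_exp_exp field_simps power2_eq_square)
  have "(\<integral>\<^sup>+ x. ennreal (exp (r * x)) \<partial>std_normal) =
      (\<integral>\<^sup>+ x. ennreal (exp (r\<^sup>2 / 2)) * ennreal (normal_density r 1 x) \<partial>lborel)"
    by (subst nn_integral_density) (auto simp: ennreal_mult[symmetric] eq)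
  also have "\<dots> = ennreal (exp (r\<^sup>2 / 2)) * emeasure (density lborel (normal_density r 1)) UNIV"
    by (simp add: nn_integral_cmult emeasure_density)
  also have "emeasure (density lborel (normal_density r 1)) UNIV = 1"
    using prob_space.emeasure_space_1[OF prob_space_normal_density[of 1 r]] by simp
  finally show ?thesis by simp
qed

lemma std_normal_exp_square:
  assumes "t < 1 / 2"
  shows "(\<integral>\<^sup>+ x. ennreal (exp (t * x\<^sup>2)) \<partial>std_normal) = ennreal (1 / sqrt (1 - 2 * t))"
proof -
  define \<sigma> where "\<sigma> = 1 / sqrt (1 - 2 * t)"
  have s: "0 < \<sigma>" "\<sigma>\<^sup>2 = 1 / (1 - 2 * t)"
    using assms by (simp_all add: \<sigma>_def power_divide)
  have "std_normal_density x * exp (t * x\<^sup>2) = \<sigma> * normal_density 0 \<sigma> x" for x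
  proof -
    have "- x\<^sup>2 / 2 + t * x\<^sup>2 = - (x - 0)\<^sup>2 / (2 * \<sigma>\<^sup>2)"
      using assms by (simp add: s(2) field_simps)
    then have "exp (- x\<^sup>2 / 2) * exp (t * x\<^sup>2) = exp (- (x - 0)\<^sup>2 / (2 * \<sigma>\<^sup>2))"
      by (simp only: mult_exp_exp)
    moreover have "sqrt (2 * pi * \<sigma>\<^sup>2) = sqrt (2 * pi) * \<sigma>"
      using s(1) by (simp add: real_sqrt_mult)
    ultimately show ?thesis
      using s(1) unfolding normal_density_def by simp
  qed
  then have "(\<integral>\<^sup>+ x. ennreal (exp (t * x\<^sup>2)) \<partial>std_normal) =
      (\<integral>\<^sup>+ x. ennreal \<sigma> * ennreal (normal_density 0 \<sigma> x) \<partial>lborel)"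
    using s(1) by (subst nn_integral_density) (auto simp: ennreal_mult[symmetric])
  also have "\<dots> = ennreal \<sigma> * emeasure (density lborel (normal_density 0 \<sigma>)) UNIV"
    by (simp add: nn_integral_cmult emeasure_density)
  also have "emeasure (density lborel (normal_density 0 \<sigma>)) UNIV = 1"
    using prob_space.emeasure_space_1[OF prob_space_normal_density[of \<sigma> 0]] s by simp
  finally show ?thesis by (simp add: \<sigma>_def)
qed

text \<open>
  A square in the exponent is linearised by one more Gaussian integral, over \<open>z\<close>, of
  \<open>exp (sqrt (2 t) Y z)\<close>. Exchanging the integrals leaves only the moment generating function of \<open>Y\<close>.
\<close>

lemma exp_square_from_mgf:
  assumes "sigma_finite_measure M" and Y [measurable]: "Y \<in> borel_measurable M"
    and mgf: "\<And>r. (\<integral>\<^sup>+ x. ennreal (exp (r * Y x)) \<partial>M) = ennreal (exp (r\<^sup>2 * v / 2))"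
    and t: "0 \<le> t" "2 * t * v < 1"
  shows "(\<integral>\<^sup>+ x. ennreal (exp (t * (Y x)\<^sup>2)) \<partial>M) = ennreal (1 / sqrt (1 - 2 * t * v))"
proof -
  interpret M: sigma_finite_measure M by fact
  interpret N: sigma_finite_measure std_normal by (rule sigma_finite_std_normal)
  interpret MN: pair_sigma_finite M std_normal ..
  have "(\<integral>\<^sup>+ x. ennreal (exp (t * (Y x)\<^sup>2)) \<partial>M) =
      (\<integral>\<^sup>+ x. (\<integral>\<^sup>+ z. ennreal (exp (sqrt (2 * t) * Y x * z)) \<partial>std_normal) \<partial>M)"
    using t by (simp add: std_normal_mgf power_mult_distrib)
  also have "\<dots> = (\<integral>\<^sup>+ z. (\<integral>\<^sup>+ x. ennreal (exp (sqrt (2 * t) * z * Y x)) \<partial>M) \<partial>std_normal)"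
    by (subst MN.Fubini') (simp_all add: mult_ac)
  also have "\<dots> = (\<integral>\<^sup>+ z. ennreal (exp (t * v * z\<^sup>2)) \<partial>std_normal)"
    using t by (simp add: mgf power_mult_distrib) (simp add: mult_ac)
  also have "\<dots> = ennreal (1 / sqrt (1 - 2 * t * v))"
    using t by (subst std_normal_exp_square) (simp_all add: mult_ac)
  finally show ?thesis .
qed

abbreviation std_normals :: "nat set \<Rightarrow> (nat \<Rightarrow> real) measure" where
  "std_normals I \<equiv> PiM I (\<lambda>_. std_normal)"

interpretation std_normals: product_sigma_finite "\<lambda>_::nat. std_normal"
  by (rule product_sigma_finite.intro) (rule sigma_finite_std_normal)

lemma prob_space_std_normals: "prob_space (std_normals I)"
  by (rule prob_space_PiM) (rule prob_space_std_normal)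

lemma measurable_linear_form [measurable]:
  "(\<lambda>x. \<Sum>j\<in>I. a j * x j) \<in> borel_measurable (std_normals I)"
proof (intro borel_measurable_sum borel_measurable_times borel_measurable_const)
  fix j assume "j \<in> I"
  then have "(\<lambda>x. x j) \<in> measurable (std_normals I) std_normal"
    by (rule measurable_component_singleton)
  then show "(\<lambda>x. x j) \<in> borel_measurable (std_normals I)"
    by (subst (asm) measurable_cong_sets[OF refl, of _ borel]) simp_all
qed

lemma std_normals_mgf:
  assumes "finite I"
  shows "(\<integral>\<^sup>+ x. ennreal (exp (\<Sum>j\<in>I. d j * x j)) \<partial>std_normals I) = ennreal (exp ((\<Sum>j\<in>I. (d j)\<^sup>2) / 2))"
proof -
  have "(\<integral>\<^sup>+ x. ennreal (exp (\<Sum>j\<in>I. d j * x j)) \<partial>std_normals I) =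
      (\<integral>\<^sup>+ x. (\<Prod>j\<in>I. ennreal (exp (d j * x j))) \<partial>std_normals I)"
    by (simp add: exp_sum assms prod_ennreal)
  also have "\<dots> = (\<Prod>j\<in>I. ennreal (exp ((d j)\<^sup>2 / 2)))"
    using assms by (subst std_normals.product_nn_integral_prod) (simp_all add: std_normal_mgf)
  also have "\<dots> = ennreal (exp ((\<Sum>j\<in>I. (d j)\<^sup>2) / 2))"
    by (simp add: exp_sum assms prod_ennreal sum_divide_distrib)
  finally show ?thesis .
qed

text \<open>
  Given \<open>w \<bullet> x\<close>, the form \<open>d \<bullet> x\<close> is still centred normal with variance \<open>\<parallel>d\<parallel>\<^sup>2\<close>, because it uses
  other coordinates. This replaces the exponential by its conditional expectation.
\<close>

lemma std_normals_integrate_orthogonal: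
  assumes fin: "finite I" and disj: "\<And>j. j \<in> I \<Longrightarrow> w j = 0 \<or> d j = 0"
    and [measurable]: "F \<in> borel_measurable borel" "H \<in> borel_measurable borel"
  defines "W \<equiv> \<lambda>x. \<Sum>j\<in>I. w j * x j"
  shows "(\<integral>\<^sup>+ x. F (W x) * ennreal (exp (H (W x) * (\<Sum>j\<in>I. d j * x j))) \<partial>std_normals I) =
    (\<integral>\<^sup>+ x. F (W x) * ennreal (exp ((H (W x))\<^sup>2 * (\<Sum>j\<in>I. (d j)\<^sup>2) / 2)) \<partial>std_normals I)"
proof -
  define Q R where "Q = {j \<in> I. w j \<noteq> 0}" and "R = {j \<in> I. w j = 0}"
  have QR: "Q \<inter> R = {}" "finite Q" "finite R" and I: "I = Q \<union> R"
    using fin by (auto simp: Q_def R_def)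
  have d: "d j = 0" if "j \<in> Q" for j
    using disj[of j] that by (auto simp: Q_def)
  have w: "w j = 0" if "j \<in> R" for j
    using that by (auto simp: R_def)
  have meas [measurable]: "W \<in> borel_measurable (std_normals I)"
    unfolding W_def by measurable
  have WQ: "W (merge Q R (x, y)) = (\<Sum>j\<in>Q. w j * x j)" for x y
  proof -
    have "W (merge Q R (x, y)) = (\<Sum>j\<in>Q. w j * merge Q R (x, y) j) + (\<Sum>j\<in>R. w j * merge Q R (x, y) j)"
      unfolding W_def I using QR by (intro sum.union_disjoint) auto
    then show ?thesis using QR(1) by (auto simp: w intro!: sum.cong)
  qed
  have VR: "(\<Sum>j\<in>I. d j * merge Q R (x, y) j) = (\<Sum>j\<in>R. d j * y j)" for x y
  proof -
    have "(\<Sum>j\<in>I. d j * merge Q R (x, y) j) =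
        (\<Sum>j\<in>Q. d j * merge Q R (x, y) j) + (\<Sum>j\<in>R. d j * merge Q R (x, y) j)"
      unfolding I using QR by (intro sum.union_disjoint) auto
    then show ?thesis using QR(1) by (auto simp: d intro!: sum.cong)
  qed
  have dd: "(\<Sum>j\<in>I. (d j)\<^sup>2) = (\<Sum>j\<in>R. (d j)\<^sup>2)"
  proof (rule sum.mono_neutral_right)
    show "\<forall>i\<in>I - R. (d i)\<^sup>2 = 0"
      using d by (auto simp: I)
  qed (use fin I in auto)
  have inner: "(\<integral>\<^sup>+ y. f * ennreal (exp (h * (\<Sum>j\<in>R. d j * y j))) \<partial>std_normals R) =
      (\<integral>\<^sup>+ y. f * ennreal (exp (h\<^sup>2 * (\<Sum>j\<in>I. (d j)\<^sup>2) / 2)) \<partial>std_normals R)" for f h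
  proof -
    have "(\<integral>\<^sup>+ y. f * ennreal (exp (h * (\<Sum>j\<in>R. d j * y j))) \<partial>std_normals R) =
        f * (\<integral>\<^sup>+ y. ennreal (exp (\<Sum>j\<in>R. (h * d j) * y j)) \<partial>std_normals R)"
      by (subst nn_integral_cmult) (simp_all add: sum_distrib_left mult.assoc)
    also have "\<dots> = f * ennreal (exp (h\<^sup>2 * (\<Sum>j\<in>I. (d j)\<^sup>2) / 2))"
      using QR by (subst std_normals_mgf) (simp_all add: power_mult_distrib sum_distrib_left dd)
    also have "\<dots> = (\<integral>\<^sup>+ y. f * ennreal (exp (h\<^sup>2 * (\<Sum>j\<in>I. (d j)\<^sup>2) / 2)) \<partial>std_normals R)"
      using prob_space.emeasure_space_1[OF prob_space_std_normals, of R] by simp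
    finally show ?thesis .
  qed
  have fold: "(\<integral>\<^sup>+ x. g x \<partial>std_normals I) =
      (\<integral>\<^sup>+ x. (\<integral>\<^sup>+ y. g (merge Q R (x, y)) \<partial>std_normals R) \<partial>std_normals Q)"
    if "g \<in> borel_measurable (std_normals I)" for g
    using that QR unfolding I by (intro std_normals.product_nn_integral_fold) auto
  show ?thesis
    by (subst (1 2) fold, measurable) (simp only: WQ VR inner)
qed

section \<open>From likelihood ratios to interval lengths\<close>

text \<open>
  Both measures agree on boxes, where the integral of a product of functions of single coordinates
  factorises.
\<close>

lemma PiM_density:
  fixes L :: "'a \<Rightarrow> ennreal" and I :: "'i set"
  assumes "finite I" "prob_space M" and L [measurable]: "L \<in> borel_measurable M"
    and sf: "sigma_finite_measure (density M L)"
  shows "PiM I (\<lambda>_. density M L) = density (PiM I (\<lambda>_. M)) (\<lambda>z. \<Prod>i\<in>I. L (z i))"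
proof -
  interpret M: product_sigma_finite "\<lambda>_::'i. M"
    by (rule product_sigma_finite.intro) (rule prob_space_imp_sigma_finite, fact)
  interpret D: product_sigma_finite "\<lambda>_::'i. density M L"
    by (rule product_sigma_finite.intro) fact
  have sets: "sets (PiM I (\<lambda>_. density M L)) = sets (PiM I (\<lambda>_. M))"
    by (rule sets_PiM_cong) simp_all
  show ?thesis
  proof (rule D.PiM_eqI[symmetric])
    fix A assume A: "\<And>i. i \<in> I \<Longrightarrow> A i \<in> sets (density M L)"
    then have [measurable]: "\<And>i. i \<in> I \<Longrightarrow> A i \<in> sets M" by simp
    have AI: "Pi\<^sub>E I A \<in> sets (PiM I (\<lambda>_. M))"
      using A \<open>finite I\<close> by (auto intro!: sets_PiM_I_finite)
    have "emeasure (density (PiM I (\<lambda>_. M)) (\<lambda>z. \<Prod>i\<in>I. L (z i))) (Pi\<^sub>E I A) =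
        (\<integral>\<^sup>+ z. (\<Prod>i\<in>I. L (z i)) * indicator (Pi\<^sub>E I A) z \<partial>PiM I (\<lambda>_. M))"
      by (rule emeasure_density[OF _ AI]) measurable
    also have "\<dots> = (\<integral>\<^sup>+ z. (\<Prod>i\<in>I. L (z i) * indicator (A i) (z i)) \<partial>PiM I (\<lambda>_. M))"
      using \<open>finite I\<close>
      by (intro nn_integral_cong) (auto simp: prod.distrib indicator_def PiE_iff space_PiM intro!: prod.neutral)
    also have "\<dots> = (\<Prod>i\<in>I. \<integral>\<^sup>+ x. L x * indicator (A i) x \<partial>M)"
      using \<open>finite I\<close> by (intro M.product_nn_integral_prod) auto
    also have "\<dots> = (\<Prod>i\<in>I. emeasure (density M L) (A i))"
      by (intro prod.cong) (auto simp: emeasure_density)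
    finally show "emeasure (density (PiM I (\<lambda>_. M)) (\<lambda>z. \<Prod>i\<in>I. L (z i))) (Pi\<^sub>E I A) =
        (\<Prod>i\<in>I. emeasure (density M L) (A i))" .
  qed (simp_all add: \<open>finite I\<close> sets)
qed

text \<open>
  With \<open>K\<close> the average likelihood ratio, the claim compares the integrals of \<open>K\<close> and \<open>1\<close> over \<open>E\<close>.
  The pointwise bound \<open>K - 1 \<le> (K - 1)\<^sup>2 / (2 r) + r / 2\<close> turns this into the second moment of
  \<open>K - 1\<close>, which is at most \<open>r\<^sup>2\<close>.
\<close>

lemma (in prob_space) mixture_prob_le:
  fixes L :: "'i \<Rightarrow> 'a \<Rightarrow> real"
  assumes fin: "finite I" "I \<noteq> {}"
    and L [measurable]: "\<And>i. i \<in> I \<Longrightarrow> L i \<in> borel_measurable M"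
    and pos: "\<And>i x. i \<in> I \<Longrightarrow> 0 \<le> L i x"
    and one: "\<And>i. i \<in> I \<Longrightarrow> (\<integral>\<^sup>+ x. ennreal (L i x) \<partial>M) = 1"
    and chi: "(\<Sum>i\<in>I. \<Sum>j\<in>I. \<integral>\<^sup>+ x. ennreal (L i x * L j x) \<partial>M) \<le> ennreal ((1 + r\<^sup>2) * (real (card I))\<^sup>2)"
    and r: "0 < r" and E [measurable]: "E \<in> sets M"
    and cov: "\<And>i. i \<in> I \<Longrightarrow> a \<le> measure (density M (\<lambda>x. ennreal (L i x))) E"
  shows "a - r \<le> prob E"
proof -
  define N where "N = real (card I)"
  have N: "0 < N"
    using fin by (simp add: N_def card_gt_0_iff)
  define K where "K x = (\<Sum>i\<in>I. L i x) / N" for x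
  have K_pos: "0 \<le> K x" for x
    using pos N by (simp add: K_def sum_nonneg)
  have [measurable]: "K \<in> borel_measurable M"
    unfolding K_def by measurable
  have intL: "integrable M (L i)" "integral\<^sup>L M (L i) = 1" if "i \<in> I" for i
    using one[OF that] pos[OF that] that
    by (auto intro!: integrableI_nonneg simp: integral_eq_nn_integral)
  have intK: "integrable M K" "integral\<^sup>L M K = 1"
    using intL N unfolding K_def by (auto simp: N_def)
  have "(\<integral>\<^sup>+ x. ennreal ((K x)\<^sup>2) \<partial>M) \<le> ennreal (1 + r\<^sup>2)"
  proof -
    have "(K x)\<^sup>2 = (\<Sum>i\<in>I. \<Sum>j\<in>I. L i x * L j x) * (1 / N\<^sup>2)" for x
      unfolding K_def power_divide by (simp add: power2_eq_square sum_product)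
    moreover have "(\<Sum>i\<in>I. \<Sum>j\<in>I. ennreal (L i x * L j x)) = ennreal (\<Sum>i\<in>I. \<Sum>j\<in>I. L i x * L j x)" for x
    proof -
      have "(\<Sum>j\<in>I. ennreal (L i x * L j x)) = ennreal (\<Sum>j\<in>I. L i x * L j x)" if "i \<in> I" for i
        using pos that by (intro sum_ennreal) simp
      then show ?thesis
        using pos by (simp add: sum_ennreal sum_nonneg)
    qed
    ultimately have "ennreal ((K x)\<^sup>2) = (\<Sum>i\<in>I. \<Sum>j\<in>I. ennreal (L i x * L j x)) * ennreal (1 / N\<^sup>2)" for x
      using pos by (simp only: ennreal_mult sum_nonneg mult_nonneg_nonneg zero_le_divide_1_iff zero_le_power2)
    then have "(\<integral>\<^sup>+ x. ennreal ((K x)\<^sup>2) \<partial>M) =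
        (\<integral>\<^sup>+ x. (\<Sum>i\<in>I. \<Sum>j\<in>I. ennreal (L i x * L j x)) * ennreal (1 / N\<^sup>2) \<partial>M)"
      by simp
    also have "\<dots> = (\<Sum>i\<in>I. \<Sum>j\<in>I. \<integral>\<^sup>+ x. ennreal (L i x * L j x) \<partial>M) * ennreal (1 / N\<^sup>2)"
      by (simp add: nn_integral_multc nn_integral_sum)
    also have "\<dots> \<le> ennreal ((1 + r\<^sup>2) * N\<^sup>2) * ennreal (1 / N\<^sup>2)"
      using chi unfolding N_def by (intro mult_right_mono) auto
    also have "\<dots> = ennreal (1 + r\<^sup>2)"
      using N by (simp add: ennreal_mult[symmetric])
    finally show ?thesis .
  qed
  then have intK2: "integrable M (\<lambda>x. (K x)\<^sup>2)" and K2: "(\<integral>x. (K x)\<^sup>2 \<partial>M) \<le> 1 + r\<^sup>2"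
    by (auto intro!: integrableI_nonneg simp: top_unique integral_eq_nn_integral enn2real_leI
        elim: le_less_trans)
  have intE: "integrable M (indicat_real E)"
    by (simp add: integrable_indicator_iff emeasure_eq_measure)
  have "a \<le> (\<integral>x. K x * indicator E x \<partial>M)"
  proof -
    have "a \<le> (\<integral>x. L i x * indicator E x \<partial>M)" if "i \<in> I" for i
    proof -
      have "measure (density M (\<lambda>x. ennreal (L i x))) E = enn2real (\<integral>\<^sup>+ x. ennreal (L i x * indicator E x) \<partial>M)"
        using that by (auto simp: measure_def emeasure_density intro!: arg_cong[where f = enn2real]
            nn_integral_cong split: split_indicator)
      also have "\<dots> = (\<integral>x. L i x * indicator E x \<partial>M)"
        using pos[OF that] that by (subst integral_eq_nn_integral) auto
      finally show ?thesis using cov[OF that] by simp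
    qed
    then have "(\<Sum>i\<in>I. a) \<le> (\<Sum>i\<in>I. \<integral>x. L i x * indicator E x \<partial>M)"
      by (intro sum_mono)
    also have "\<dots> = (\<integral>x. (\<Sum>i\<in>I. L i x * indicator E x) \<partial>M)"
      using intL by (subst Bochner_Integration.integral_sum) (auto intro!: integrable_real_mult_indicator)
    also have "\<dots> = N * (\<integral>x. K x * indicator E x \<partial>M)"
      using N by (subst Bochner_Integration.integral_mult_right_zero[symmetric])
        (simp add: K_def sum_distrib_right)
    finally show ?thesis
      using N by (simp add: N_def)
  qed
  also have "\<dots> \<le> (\<integral>x. indicator E x + (((K x)\<^sup>2 - 2 * K x + 1) / (2 * r) + r / 2) \<partial>M)"
  proof (rule integral_mono)
    fix x
    have "0 \<le> (K x - 1 - r)\<^sup>2 / (2 * r)"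
      using r by simp
    also have "\<dots> = ((K x)\<^sup>2 - 2 * K x + 1) / (2 * r) + r / 2 - (K x - 1)"
      using r by (simp add: field_simps power2_eq_square)
    finally have 1: "K x - 1 \<le> ((K x)\<^sup>2 - 2 * K x + 1) / (2 * r) + r / 2" by simp
    have "0 \<le> (K x - 1)\<^sup>2 / (2 * r)"
      using r by simp
    also have "\<dots> = ((K x)\<^sup>2 - 2 * K x + 1) / (2 * r)"
      by (simp add: power2_eq_square algebra_simps)
    finally show "K x * indicator E x \<le> indicator E x + (((K x)\<^sup>2 - 2 * K x + 1) / (2 * r) + r / 2)"
      using 1 r by (simp split: split_indicator)
  qed (use intK intK2 intE in \<open>auto intro!: integrable_real_mult_indicator\<close>)
  also have "\<dots> = prob E + (((\<integral>x. (K x)\<^sup>2 \<partial>M) - 1) / (2 * r) + r / 2)"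
    using intK intK2 intE by (simp add: prob_space)
  also have "\<dots> \<le> prob E + r"
  proof -
    have "((\<integral>x. (K x)\<^sup>2 \<partial>M) - 1) / (2 * r) \<le> r\<^sup>2 / (2 * r)"
      using K2 r by (intro divide_right_mono) auto
    also have "r\<^sup>2 / (2 * r) = r / 2"
      by (simp add: power2_eq_square)
    finally show ?thesis by linarith
  qed
  finally show ?thesis by simp
qed

text \<open>
  Both \<open>T0\<close> and \<open>T1\<close> lie in the interval with probability at least \<open>1 - 2 \<alpha> - r\<close>, by inclusion and
  exclusion, and there the length is at least their distance.
\<close>

lemma (in prob_space) expected_length_lower_bound:
  fixes L :: "'i \<Rightarrow> 'a \<Rightarrow> real"
  assumes fin: "finite I" "I \<noteq> {}"
    and L: "\<And>i. i \<in> I \<Longrightarrow> L i \<in> borel_measurable M"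
    and pos: "\<And>i x. i \<in> I \<Longrightarrow> 0 \<le> L i x"
    and one: "\<And>i. i \<in> I \<Longrightarrow> (\<integral>\<^sup>+ x. ennreal (L i x) \<partial>M) = 1"
    and chi: "(\<Sum>i\<in>I. \<Sum>j\<in>I. \<integral>\<^sup>+ x. ennreal (L i x * L j x) \<partial>M) \<le> ennreal ((1 + r\<^sup>2) * (real (card I))\<^sup>2)"
    and r: "0 < r"
    and l [measurable]: "l \<in> borel_measurable M" and u [measurable]: "u \<in> borel_measurable M"
    and cov0: "1 - \<alpha> \<le> prob {x \<in> space M. l x \<le> T0 \<and> T0 \<le> u x}"
    and cov1: "\<And>i. i \<in> I \<Longrightarrow>
      1 - \<alpha> \<le> measure (density M (\<lambda>x. ennreal (L i x))) {x \<in> space M. l x \<le> T1 \<and> T1 \<le> u x}"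
  shows "ennreal (\<bar>T1 - T0\<bar> * (1 - 2 * \<alpha> - r)) \<le> (\<integral>\<^sup>+ x. ennreal (u x - l x) \<partial>M)"
proof -
  let ?E = "\<lambda>t. {x \<in> space M. l x \<le> t \<and> t \<le> u x}"
  have "1 - \<alpha> - r \<le> prob (?E T1)"
    by (rule mixture_prob_le[OF fin L pos one chi r _ cov1]) measurable
  moreover have "prob (?E T0) + prob (?E T1) \<le> 1 + prob (?E T0 \<inter> ?E T1)"
  proof -
    have "prob (?E T0 \<union> ?E T1) = prob (?E T0) + prob (?E T1) - prob (?E T0 \<inter> ?E T1)"
      by (rule measure_Un3) (simp_all add: fmeasurable_eq_sets)
    then show ?thesis using prob_le_1[of "?E T0 \<union> ?E T1"] by linarith
  qed
  ultimately have "1 - 2 * \<alpha> - r \<le> prob (?E T0 \<inter> ?E T1)"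
    using cov0 by linarith
  then have "ennreal (\<bar>T1 - T0\<bar> * (1 - 2 * \<alpha> - r)) \<le> ennreal (\<bar>T1 - T0\<bar> * prob (?E T0 \<inter> ?E T1))"
    by (intro ennreal_leI mult_left_mono) auto
  also have "\<dots> = (\<integral>\<^sup>+ x. ennreal \<bar>T1 - T0\<bar> * indicator (?E T0 \<inter> ?E T1) x \<partial>M)"
    by (subst nn_integral_cmult_indicator) (simp_all add: ennreal_mult emeasure_eq_measure)
  also have "\<dots> \<le> (\<integral>\<^sup>+ x. ennreal (u x - l x) \<partial>M)"
    by (intro nn_integral_mono) (auto split: split_indicator intro!: ennreal_leI)
  finally show ?thesis .
qed

section \<open>The law of the data as a product of row laws\<close>

text \<open>
  The law of one observation \<open>(y, x)\<close>. Since the rows are independent, all computations with the data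
  reduce to it.
\<close>

definition row_law :: "nat \<Rightarrow> (nat \<Rightarrow> real) \<Rightarrow> real mat \<Rightarrow> real \<Rightarrow> (real \<times> (nat \<Rightarrow> real)) measure" where
  "row_law p b \<Sigma> \<sigma> = distr (mvn p \<Sigma> \<Otimes>\<^sub>M density lborel (normal_density 0 \<sigma>))
     (borel \<Otimes>\<^sub>M PiM {..<p} (\<lambda>_. borel)) (\<lambda>(x, e). ((\<Sum>j<p. x j * b j) + e, x))"

lemma measurable_mvn_density [measurable]:
  assumes "inv_mat \<Sigma> \<in> carrier_mat p p"
  shows "mvn_density p \<Sigma> \<in> borel_measurable (PiM {..<p} (\<lambda>_. borel))"
  unfolding mvn_density_def using assms
  by (subst quad_form_eq_double_sum) measurable

lemma sets_PiM_lborel: "sets (PiM I (\<lambda>_. lborel :: real measure)) = sets (PiM I (\<lambda>_. borel))"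
  by (rule sets_PiM_cong) simp_all

lemma sets_mvn [measurable_cong]: "sets (mvn p \<Sigma>) = sets (PiM {..<p} (\<lambda>_. borel))"
  by (simp add: mvn_def sets_PiM_lborel)

lemma sigma_finite_PiM_lborel: "finite I \<Longrightarrow> sigma_finite_measure (PiM I (\<lambda>_. lborel :: real measure))"
proof -
  assume "finite I"
  interpret product_sigma_finite "\<lambda>_. lborel :: real measure" ..
  show ?thesis by (rule sigma_finite) fact
qed

lemma sigma_finite_mvn:
  assumes "inv_mat \<Sigma> \<in> carrier_mat p p"
  shows "sigma_finite_measure (mvn p \<Sigma>)"
  unfolding mvn_def
  using measurable_mvn_density[OF assms] sigma_finite_PiM_lborel[of "{..<p}"]
  by (subst sigma_finite_measure.sigma_finite_iff_density_finite)
    (simp_all add: measurable_cong_sets[OF sets_PiM_lborel refl])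

lemma sigma_finite_normal: "0 < \<sigma> \<Longrightarrow> sigma_finite_measure (density lborel (normal_density m \<sigma>))"
  by (rule prob_space_imp_sigma_finite) (rule prob_space_normal_density)

text \<open>
  For a multiple of the identity the quadratic form in the exponent is a sum over the coordinates, so
  the density is a product.
\<close>

lemma mvn_identity_scaled:
  assumes "0 < \<sigma>"
  shows "mvn n (\<sigma>\<^sup>2 \<cdot>\<^sub>m 1\<^sub>m n) = PiM {..<n} (\<lambda>_. density lborel (normal_density 0 \<sigma>))"
proof -
  interpret P: product_sigma_finite "\<lambda>_::nat. density lborel (normal_density 0 \<sigma>)"
    by (rule product_sigma_finite.intro) (rule sigma_finite_normal, fact)
  interpret L: product_sigma_finite "\<lambda>_::nat. lborel :: real measure" ..
  have dens: "mvn_density n (\<sigma>\<^sup>2 \<cdot>\<^sub>m 1\<^sub>m n) x = (\<Prod>i<n. normal_density 0 \<sigma> (x i))" for x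
  proof -
    have "scalar_prod (Matrix.vec n x) (inv_mat (\<sigma>\<^sup>2 \<cdot>\<^sub>m 1\<^sub>m n) *\<^sub>v Matrix.vec n x) = (\<Sum>i<n. (x i)\<^sup>2) / \<sigma>\<^sup>2"
      using assms
      by (simp add: inv_mat_scaled_one quad_form_eq_double_sum power2_eq_square sum_divide_distrib
          if_distrib[of "\<lambda>x. _ * x"] if_distrib[of "\<lambda>x. x * _"] cong: if_cong)
    then have "mvn_density n (\<sigma>\<^sup>2 \<cdot>\<^sub>m 1\<^sub>m n) x = exp (\<Sum>i<n. - (x i)\<^sup>2 / (2 * \<sigma>\<^sup>2)) / sqrt ((2 * pi * \<sigma>\<^sup>2) ^ n)"
      by (simp add: mvn_density_def sum_divide_distrib sum_negf power_mult_distrib mult.commute)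
    also have "\<dots> = (\<Prod>i<n. exp (- (x i)\<^sup>2 / (2 * \<sigma>\<^sup>2)) / sqrt (2 * pi * \<sigma>\<^sup>2))"
      by (simp add: exp_sum prod_dividef real_sqrt_power)
    finally show ?thesis
      by (simp add: normal_density_def)
  qed
  have [measurable]: "(\<lambda>x. mvn_density n (\<sigma>\<^sup>2 \<cdot>\<^sub>m 1\<^sub>m n) x) \<in> borel_measurable (PiM {..<n} (\<lambda>_. lborel))"
    unfolding dens by measurable
  show ?thesis
  proof (rule P.PiM_eqI)
    show "sets (mvn n (\<sigma>\<^sup>2 \<cdot>\<^sub>m 1\<^sub>m n)) = sets (PiM {..<n} (\<lambda>_. density lborel (normal_density 0 \<sigma>)))"
      unfolding sets_mvn by (rule sets_PiM_cong) simp_all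
  next
    fix A assume "\<And>i. i \<in> {..<n} \<Longrightarrow> A i \<in> sets (density lborel (normal_density 0 \<sigma>))"
    then have A [measurable]: "\<And>i. i \<in> {..<n} \<Longrightarrow> A i \<in> sets borel" by simp
    have "emeasure (mvn n (\<sigma>\<^sup>2 \<cdot>\<^sub>m 1\<^sub>m n)) (Pi\<^sub>E {..<n} A) =
        (\<integral>\<^sup>+ x. ennreal (\<Prod>i<n. normal_density 0 \<sigma> (x i)) * indicator (Pi\<^sub>E {..<n} A) x \<partial>PiM {..<n} (\<lambda>_. lborel))"
      unfolding mvn_def dens[symmetric]
      by (rule emeasure_density) (auto intro!: sets_PiM_I_finite)
    also have "\<dots> = (\<integral>\<^sup>+ x. (\<Prod>i<n. ennreal (normal_density 0 \<sigma> (x i)) * indicator (A i) (x i)) \<partial>PiM {..<n} (\<lambda>_. lborel))"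
      by (intro nn_integral_cong)
        (auto simp: prod.distrib indicator_def PiE_iff space_PiM prod_ennreal intro!: prod.neutral)
    also have "\<dots> = (\<Prod>i<n. \<integral>\<^sup>+ x. ennreal (normal_density 0 \<sigma> x) * indicator (A i) x \<partial>lborel)"
      by (intro L.product_nn_integral_prod) auto
    also have "\<dots> = (\<Prod>i<n. emeasure (density lborel (normal_density 0 \<sigma>)) (A i))"
      by (intro prod.cong) (auto simp: emeasure_density)
    finally show "emeasure (mvn n (\<sigma>\<^sup>2 \<cdot>\<^sub>m 1\<^sub>m n)) (Pi\<^sub>E {..<n} A) =
        (\<Prod>i<n. emeasure (density lborel (normal_density 0 \<sigma>)) (A i))" .
  qed simp
qed

lemma measurable_row:
  "(\<lambda>(x, e). ((\<Sum>j<p. x j * b j) + e, x)) \<in>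
    measurable (mvn p \<Sigma> \<Otimes>\<^sub>M density lborel (normal_density 0 \<sigma>)) (borel \<Otimes>\<^sub>M PiM {..<p} (\<lambda>_. borel :: real measure))"
proof -
  have m: "(\<lambda>(x, e). ((\<Sum>j<p. x j * b j) + e, x)) \<in>
    measurable (PiM {..<p} (\<lambda>_. borel :: real measure) \<Otimes>\<^sub>M borel) (borel \<Otimes>\<^sub>M PiM {..<p} (\<lambda>_. borel :: real measure))"
    unfolding case_prod_unfold
    by (intro measurable_Pair borel_measurable_add borel_measurable_sum borel_measurable_times
        borel_measurable_const measurable_compose[OF measurable_fst measurable_component_singleton]) auto
  have eq: "sets (mvn p \<Sigma> \<Otimes>\<^sub>M density lborel (normal_density 0 \<sigma>)) =
      sets (PiM {..<p} (\<lambda>_. borel :: real measure) \<Otimes>\<^sub>M borel)"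
    by (rule sets_pair_measure_cong) (simp_all add: sets_mvn)
  show ?thesis
    unfolding measurable_cong_sets[OF eq refl] by (rule m)
qed

lemma sets_row_law [measurable_cong]: "sets (row_law p b \<Sigma> \<sigma>) = sets (borel \<Otimes>\<^sub>M PiM {..<p} (\<lambda>_. borel))"
  by (simp add: row_law_def)

lemma nn_integral_row_law:
  assumes "inv_mat \<Sigma> \<in> carrier_mat p p" "0 < \<sigma>"
    and f [measurable]: "f \<in> borel_measurable (borel \<Otimes>\<^sub>M PiM {..<p} (\<lambda>_. borel))"
  shows "(\<integral>\<^sup>+ z. f z \<partial>row_law p b \<Sigma> \<sigma>) =
    (\<integral>\<^sup>+ x. (\<integral>\<^sup>+ e. f ((\<Sum>j<p. x j * b j) + e, x) \<partial>density lborel (normal_density 0 \<sigma>)) \<partial>mvn p \<Sigma>)"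
proof -
  interpret N: sigma_finite_measure "density lborel (normal_density 0 \<sigma>)"
    by (rule sigma_finite_normal) fact
  have "(\<integral>\<^sup>+ z. f z \<partial>row_law p b \<Sigma> \<sigma>) = (\<integral>\<^sup>+ (x, e). f ((\<Sum>j<p. x j * b j) + e, x)
      \<partial>(mvn p \<Sigma> \<Otimes>\<^sub>M density lborel (normal_density 0 \<sigma>)))"
    unfolding row_law_def
    by (subst nn_integral_distr[OF measurable_row]) (simp_all only: measurable_distr_eq1 f case_prod_unfold)
  also have "\<dots> = (\<integral>\<^sup>+ x. (\<integral>\<^sup>+ e. f ((\<Sum>j<p. x j * b j) + e, x) \<partial>density lborel (normal_density 0 \<sigma>)) \<partial>mvn p \<Sigma>)"
    using measurable_compose[OF measurable_row f]
    by (subst N.nn_integral_fst[symmetric]) (simp_all only: case_prod_unfold prod.sel)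
  finally show ?thesis .
qed

lemma indicator_PiE_restrict:
  assumes "finite I"
  shows "indicator (Pi\<^sub>E I A) (\<lambda>i\<in>I. h i) = (\<Prod>i\<in>I. indicator (A i) (h i) :: ennreal)"
proof (cases "\<forall>i\<in>I. h i \<in> A i")
  case True
  then show ?thesis by (auto simp: indicator_def PiE_iff)
next
  case False
  then obtain i where "i \<in> I" "h i \<notin> A i" by blast
  then have "(\<Prod>i\<in>I. indicator (A i) (h i) :: ennreal) = 0"
    using assms by (intro prod_zero bexI[of _ i]) simp_all
  moreover have "(\<lambda>i\<in>I. h i) \<notin> Pi\<^sub>E I A"
    using \<open>i \<in> I\<close> \<open>h i \<notin> A i\<close> by (auto simp: PiE_iff)
  ultimately show ?thesis by simp
qed

text \<open>
  In \<open>data_law\<close> all designs are drawn before all errors. Integrating a product of indicators over the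
  errors and then over the designs, coordinate by coordinate, regroups them by rows.
\<close>

lemma data_law_eq_PiM_row_law:
  assumes b: "b \<in> carrier_vec p" and car: "inv_mat (inv_mat \<Omega>) \<in> carrier_mat p p" and s: "0 < \<sigma>"
    and sf: "sigma_finite_measure (row_law p (vec_index b) (inv_mat \<Omega>) \<sigma>)"
  shows "data_law n p (b, \<Omega>, \<sigma>) = PiM {..<n} (\<lambda>_. row_law p (vec_index b) (inv_mat \<Omega>) \<sigma>)"
proof -
  let ?\<Sigma> = "inv_mat \<Omega>" and ?N = "density lborel (normal_density 0 \<sigma>)"
  let ?R = "row_law p (vec_index b) ?\<Sigma> \<sigma>" and ?S = "borel \<Otimes>\<^sub>M PiM {..<p} (\<lambda>_. borel :: real measure)"
  let ?g = "\<lambda>(X, \<epsilon>). \<lambda>i\<in>{..<n}. ((\<Sum>j<p. X i j * vec_index b j) + \<epsilon> i, X i)"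
  interpret R: product_sigma_finite "\<lambda>_::nat. ?R"
    by (rule product_sigma_finite.intro) (rule sf)
  interpret X: product_sigma_finite "\<lambda>_::nat. mvn p ?\<Sigma>"
    by (rule product_sigma_finite.intro) (rule sigma_finite_mvn[OF car])
  interpret N: product_sigma_finite "\<lambda>_::nat. ?N"
    by (rule product_sigma_finite.intro) (rule sigma_finite_normal[OF s])
  interpret NN: sigma_finite_measure "PiM {..<n} (\<lambda>_. ?N)"
    by (rule N.sigma_finite) simp
  have g: "?g \<in> measurable (PiM {..<n} (\<lambda>_. mvn p ?\<Sigma>) \<Otimes>\<^sub>M PiM {..<n} (\<lambda>_. ?N)) (data_space n p)"
    unfolding data_space_def case_prod_unfold
  proof (rule measurable_restrict)
    fix i assume i: "i \<in> {..<n}"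
    have "(\<lambda>z. (fst z i, snd z i)) \<in> measurable (PiM {..<n} (\<lambda>_. mvn p ?\<Sigma>) \<Otimes>\<^sub>M PiM {..<n} (\<lambda>_. ?N)) (mvn p ?\<Sigma> \<Otimes>\<^sub>M ?N)"
      using i by (intro measurable_Pair measurable_compose[OF measurable_fst measurable_component_singleton]
          measurable_compose[OF measurable_snd measurable_component_singleton]) auto
    from measurable_compose[OF this measurable_row]
    show "(\<lambda>z. ((\<Sum>j<p. fst z i j * vec_index b j) + snd z i, fst z i)) \<in>
        measurable (PiM {..<n} (\<lambda>_. mvn p ?\<Sigma>) \<Otimes>\<^sub>M PiM {..<n} (\<lambda>_. ?N)) ?S"
      by (simp only: prod.case)
  qed
  have law: "data_law n p (b, \<Omega>, \<sigma>) =
      distr (PiM {..<n} (\<lambda>_. mvn p ?\<Sigma>) \<Otimes>\<^sub>M PiM {..<n} (\<lambda>_. ?N)) (data_space n p) ?g"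
    using b s by (simp add: mvn_identity_scaled scalar_prod_def lessThan_atLeast0)
  show ?thesis
  proof (rule R.PiM_eqI)
    show "sets (data_law n p (b, \<Omega>, \<sigma>)) = sets (PiM {..<n} (\<lambda>_. ?R))"
      unfolding law data_space_def sets_distr by (rule sets_PiM_cong) (simp_all add: sets_row_law)
  next
    fix A assume "\<And>i. i \<in> {..<n} \<Longrightarrow> A i \<in> sets ?R"
    then have A [measurable]: "\<And>i. i \<in> {..<n} \<Longrightarrow> A i \<in> sets ?S"
      by (simp add: sets_row_law)
    then have AS: "Pi\<^sub>E {..<n} A \<in> sets (data_space n p)"
      unfolding data_space_def by (intro sets_PiM_I_finite) auto
    let ?f = "\<lambda>i x e. indicator (A i) ((\<Sum>j<p. x j * vec_index b j) + e, x) :: ennreal"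
    have fm: "(\<lambda>(x, e). ?f i x e) \<in> borel_measurable (mvn p ?\<Sigma> \<Otimes>\<^sub>M ?N)" if "i \<in> {..<n}" for i
      using measurable_compose[OF measurable_row borel_measurable_indicator[OF A[OF that]]]
      by (simp only: case_prod_unfold)
    have fm1: "(\<lambda>x. \<integral>\<^sup>+ e. ?f i x e \<partial>?N) \<in> borel_measurable (mvn p ?\<Sigma>)" if "i \<in> {..<n}" for i
      using sigma_finite_measure.borel_measurable_nn_integral[OF sigma_finite_normal[OF s] fm[OF that]] .
    have fm2: "(\<lambda>e. ?f i x e) \<in> borel_measurable ?N" if "i \<in> {..<n}" "x \<in> space (mvn p ?\<Sigma>)" for i x
      using measurable_compose[OF measurable_Pair1'[OF that(2)] fm[OF that(1)]] by (simp only: prod.case)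
    have "emeasure (data_law n p (b, \<Omega>, \<sigma>)) (Pi\<^sub>E {..<n} A) =
        (\<integral>\<^sup>+ z. indicator (Pi\<^sub>E {..<n} A) z \<partial>data_law n p (b, \<Omega>, \<sigma>))"
      using AS by (simp add: law)
    also have "\<dots> = (\<integral>\<^sup>+ z. indicator (Pi\<^sub>E {..<n} A) (?g z) \<partial>(PiM {..<n} (\<lambda>_. mvn p ?\<Sigma>) \<Otimes>\<^sub>M PiM {..<n} (\<lambda>_. ?N)))"
      unfolding law
      by (rule nn_integral_distr[OF g]) (simp only: measurable_distr_eq1 borel_measurable_indicator AS)
    also have "\<dots> = (\<integral>\<^sup>+ X. (\<integral>\<^sup>+ \<epsilon>. indicator (Pi\<^sub>E {..<n} A) (?g (X, \<epsilon>)) \<partial>PiM {..<n} (\<lambda>_. ?N)) \<partial>PiM {..<n} (\<lambda>_. mvn p ?\<Sigma>))"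
      by (rule NN.nn_integral_fst[symmetric]) (rule measurable_compose[OF g borel_measurable_indicator[OF AS]])
    also have "\<dots> = (\<integral>\<^sup>+ X. (\<integral>\<^sup>+ \<epsilon>. (\<Prod>i<n. ?f i (X i) (\<epsilon> i)) \<partial>PiM {..<n} (\<lambda>_. ?N)) \<partial>PiM {..<n} (\<lambda>_. mvn p ?\<Sigma>))"
      by (simp only: prod.case indicator_PiE_restrict[OF finite_lessThan])
    also have "\<dots> = (\<integral>\<^sup>+ X. (\<Prod>i<n. \<integral>\<^sup>+ e. ?f i (X i) e \<partial>?N) \<partial>PiM {..<n} (\<lambda>_. mvn p ?\<Sigma>))"
    proof (rule nn_integral_cong)
      fix X assume "X \<in> space (PiM {..<n} (\<lambda>_. mvn p ?\<Sigma>))"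
      then have X: "X i \<in> space (mvn p ?\<Sigma>)" if "i \<in> {..<n}" for i
        using that unfolding space_PiM by (rule PiE_mem)
      show "(\<integral>\<^sup>+ \<epsilon>. (\<Prod>i<n. ?f i (X i) (\<epsilon> i)) \<partial>PiM {..<n} (\<lambda>_. ?N)) = (\<Prod>i<n. \<integral>\<^sup>+ e. ?f i (X i) e \<partial>?N)"
        by (rule N.product_nn_integral_prod[OF finite_lessThan]) (rule fm2[OF _ X])
    qed
    also have "\<dots> = (\<Prod>i<n. \<integral>\<^sup>+ x. (\<integral>\<^sup>+ e. ?f i x e \<partial>?N) \<partial>mvn p ?\<Sigma>)"
      by (rule X.product_nn_integral_prod[OF finite_lessThan]) (rule fm1)
    also have "\<dots> = (\<Prod>i<n. emeasure ?R (A i))"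
    proof (intro prod.cong refl)
      fix i assume i: "i \<in> {..<n}"
      have "(\<integral>\<^sup>+ z. indicator (A i) z \<partial>?R) = (\<integral>\<^sup>+ x. (\<integral>\<^sup>+ e. ?f i x e \<partial>?N) \<partial>mvn p ?\<Sigma>)"
        by (rule nn_integral_row_law[OF car s borel_measurable_indicator[OF A[OF i]]])
      then show "(\<integral>\<^sup>+ x. (\<integral>\<^sup>+ e. ?f i x e \<partial>?N) \<partial>mvn p ?\<Sigma>) = emeasure ?R (A i)"
        using A[OF i] by (simp add: sets_row_law)
    qed
    finally show "emeasure (data_law n p (b, \<Omega>, \<sigma>)) (Pi\<^sub>E {..<n} A) = (\<Prod>i<n. emeasure ?R (A i))" .
  qed simp
qed

lemma nn_integral_row_law_density:
  assumes car: "inv_mat \<Sigma> \<in> carrier_mat p p" and s: "0 < \<sigma>"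
    and f [measurable]: "f \<in> borel_measurable (borel \<Otimes>\<^sub>M PiM {..<p} (\<lambda>_. borel))"
  shows "(\<integral>\<^sup>+ z. f z \<partial>row_law p b \<Sigma> \<sigma>) =
    (\<integral>\<^sup>+ x. (\<integral>\<^sup>+ y. ennreal (mvn_density p \<Sigma> x) * ennreal (normal_density (\<Sum>j<p. x j * b j) \<sigma> y) * f (y, x)
      \<partial>lborel) \<partial>PiM {..<p} (\<lambda>_. lborel))"
proof -
  let ?N = "density lborel (normal_density 0 \<sigma>)"
  have d [measurable]: "mvn_density p \<Sigma> \<in> borel_measurable (PiM {..<p} (\<lambda>_. lborel))"
    unfolding measurable_cong_sets[OF sets_PiM_lborel refl] by (rule measurable_mvn_density[OF car])
  have "(\<lambda>(x, e). f ((\<Sum>j<p. x j * b j) + e, x)) \<in> borel_measurable (mvn p \<Sigma> \<Otimes>\<^sub>M ?N)"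
    using measurable_compose[OF measurable_row f] by (simp only: case_prod_unfold)
  from sigma_finite_measure.borel_measurable_nn_integral[OF sigma_finite_normal[OF s] this]
  have m: "(\<lambda>x. \<integral>\<^sup>+ e. f ((\<Sum>j<p. x j * b j) + e, x) \<partial>?N) \<in> borel_measurable (PiM {..<p} (\<lambda>_. lborel))"
    unfolding measurable_cong_sets[OF trans[OF sets_mvn sets_PiM_lborel[symmetric]] refl] .
  have "(\<integral>\<^sup>+ z. f z \<partial>row_law p b \<Sigma> \<sigma>) =
      (\<integral>\<^sup>+ x. ennreal (mvn_density p \<Sigma> x) * (\<integral>\<^sup>+ e. f ((\<Sum>j<p. x j * b j) + e, x) \<partial>?N) \<partial>PiM {..<p} (\<lambda>_. lborel))"
    unfolding nn_integral_row_law[OF car s f] mvn_def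
    by (rule nn_integral_density[OF measurable_compose[OF d measurable_ennreal] m])
  also have "\<dots> = (\<integral>\<^sup>+ x. (\<integral>\<^sup>+ y. ennreal (mvn_density p \<Sigma> x) * ennreal (normal_density (\<Sum>j<p. x j * b j) \<sigma> y) * f (y, x)
      \<partial>lborel) \<partial>PiM {..<p} (\<lambda>_. lborel))"
  proof (rule nn_integral_cong)
    fix x :: "nat \<Rightarrow> real" assume "x \<in> space (PiM {..<p} (\<lambda>_. lborel))"
    then have x: "x \<in> space (PiM {..<p} (\<lambda>_. borel))"
      by (simp add: space_PiM)
    define m where "m = (\<Sum>j<p. x j * b j)"
    have [measurable]: "(\<lambda>y. f (y, x)) \<in> borel_measurable borel"
      by (rule measurable_compose[OF measurable_Pair2'[OF x] f])
    have "(\<integral>\<^sup>+ y. ennreal (normal_density m \<sigma> y) * f (y, x) \<partial>lborel) =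
        (\<integral>\<^sup>+ e. ennreal (normal_density m \<sigma> (m + 1 * e)) * f (m + 1 * e, x) \<partial>lborel)"
      by (subst nn_integral_real_affine[where c = 1 and t = m]) simp_all
    also have "\<dots> = (\<integral>\<^sup>+ e. f (m + e, x) \<partial>?N)"
      by (subst nn_integral_density) (simp_all add: normal_density_def)
    finally show "ennreal (mvn_density p \<Sigma> x) * (\<integral>\<^sup>+ e. f ((\<Sum>j<p. x j * b j) + e, x) \<partial>?N) =
      (\<integral>\<^sup>+ y. ennreal (mvn_density p \<Sigma> x) * ennreal (normal_density (\<Sum>j<p. x j * b j) \<sigma> y) * f (y, x) \<partial>lborel)"
      unfolding m_def[symmetric] mult.assoc by (subst nn_integral_cmult) simp_all
  qed
  finally show ?thesis .
qed

text \<open>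
  A density ratio can be read off from the joint density of \<open>(y, x)\<close>, the product of the density of
  \<open>x\<close> and the conditional normal density of \<open>y\<close>.
\<close>

lemma row_law_eq_density:
  fixes L :: "real \<times> (nat \<Rightarrow> real) \<Rightarrow> real"
  assumes car: "inv_mat \<Sigma> \<in> carrier_mat p p" "inv_mat \<Sigma>' \<in> carrier_mat p p" and s: "0 < \<sigma>" "0 < \<sigma>'"
    and L [measurable]: "L \<in> borel_measurable (borel \<Otimes>\<^sub>M PiM {..<p} (\<lambda>_. borel))" and pos: "\<And>z. 0 \<le> L z"
    and eq: "\<And>x y. mvn_density p \<Sigma>' x * normal_density (\<Sum>j<p. x j * b' j) \<sigma>' y =
      mvn_density p \<Sigma> x * normal_density (\<Sum>j<p. x j * b j) \<sigma> y * L (y, x)"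
    and mpos: "\<And>x. 0 \<le> mvn_density p \<Sigma> x" "\<And>x. 0 \<le> mvn_density p \<Sigma>' x"
  shows "row_law p b' \<Sigma>' \<sigma>' = density (row_law p b \<Sigma> \<sigma>) (\<lambda>z. ennreal (L z))"
proof (rule measure_eqI)
  show "sets (row_law p b' \<Sigma>' \<sigma>') = sets (density (row_law p b \<Sigma> \<sigma>) (\<lambda>z. ennreal (L z)))"
    by (simp add: sets_row_law)
next
  fix A assume "A \<in> sets (row_law p b' \<Sigma>' \<sigma>')"
  then have A [measurable]: "A \<in> sets (borel \<Otimes>\<^sub>M PiM {..<p} (\<lambda>_. borel))"
    by (simp add: sets_row_law)
  have m1: "indicator A \<in> borel_measurable (borel \<Otimes>\<^sub>M PiM {..<p} (\<lambda>_. borel))"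
    by (rule borel_measurable_indicator[OF A])
  have m2: "(\<lambda>z. ennreal (L z) * indicator A z) \<in> borel_measurable (borel \<Otimes>\<^sub>M PiM {..<p} (\<lambda>_. borel))"
    using L m1 by (intro borel_measurable_times_ennreal measurable_compose[OF L measurable_ennreal])
  have eq': "ennreal (mvn_density p \<Sigma>' x) * (ennreal (normal_density (\<Sum>j<p. x j * b' j) \<sigma>' y) * F) =
      ennreal (mvn_density p \<Sigma> x) * (ennreal (normal_density (\<Sum>j<p. x j * b j) \<sigma> y) * (ennreal (L (y, x)) * F))"
    for x y F
    using eq[of x y] pos mpos by (simp add: mult.assoc[symmetric] ennreal_mult[symmetric])
  have "emeasure (row_law p b' \<Sigma>' \<sigma>') A = (\<integral>\<^sup>+ z. indicator A z \<partial>row_law p b' \<Sigma>' \<sigma>')"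
    using A by (simp add: sets_row_law)
  also have "\<dots> = (\<integral>\<^sup>+ z. ennreal (L z) * indicator A z \<partial>row_law p b \<Sigma> \<sigma>)"
    unfolding nn_integral_row_law_density[OF car(2) s(2) m1] nn_integral_row_law_density[OF car(1) s(1) m2]
    by (simp only: eq' mult.assoc)
  also have "\<dots> = emeasure (density (row_law p b \<Sigma> \<sigma>) (\<lambda>z. ennreal (L z))) A"
    using A by (subst emeasure_density) (simp_all add: sets_row_law measurable_cong_sets[OF sets_row_law refl])
  finally show "emeasure (row_law p b' \<Sigma>' \<sigma>') A = emeasure (density (row_law p b \<Sigma> \<sigma>) (\<lambda>z. ennreal (L z))) A" .
qed

lemma mvn_one: "mvn p (1\<^sub>m p) = std_normals {..<p}"
proof -
  have "1\<^sub>m p = 1\<^sup>2 \<cdot>\<^sub>m (1\<^sub>m p :: real mat)"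
    by (rule eq_matI) auto
  then show ?thesis
    using mvn_identity_scaled[of 1 p] by simp
qed

lemma prob_space_null_row_law:
  assumes "0 < \<sigma>"
  shows "prob_space (row_law p b (1\<^sub>m p) \<sigma>)"
proof -
  interpret X: prob_space "std_normals {..<p}" by (rule prob_space_std_normals)
  interpret N: prob_space "density lborel (normal_density 0 \<sigma>)"
    by (rule prob_space_normal_density) fact
  interpret XN: pair_prob_space "std_normals {..<p}" "density lborel (normal_density 0 \<sigma>)" ..
  show ?thesis
    unfolding row_law_def mvn_one
    by (rule XN.prob_space_distr) (rule measurable_row[where p = p and \<Sigma> = "1\<^sub>m p", unfolded mvn_one])
qed

lemma nn_integral_null_row_law:
  assumes s: "0 < \<sigma>" and f [measurable]: "f \<in> borel_measurable (borel \<Otimes>\<^sub>M PiM {..<p} (\<lambda>_. borel))"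
  shows "(\<integral>\<^sup>+ z. f z \<partial>row_law p b (1\<^sub>m p) \<sigma>) =
    (\<integral>\<^sup>+ x. (\<integral>\<^sup>+ e. f ((\<Sum>j<p. x j * b j) + \<sigma> * e, x) \<partial>std_normal) \<partial>std_normals {..<p})"
proof -
  have "(\<integral>\<^sup>+ z. f z \<partial>row_law p b (1\<^sub>m p) \<sigma>) =
    (\<integral>\<^sup>+ x. (\<integral>\<^sup>+ e. f ((\<Sum>j<p. x j * b j) + e, x) \<partial>density lborel (normal_density 0 \<sigma>)) \<partial>std_normals {..<p})"
    unfolding mvn_one[symmetric] by (intro nn_integral_row_law s f) (simp add: inv_mat_one)
  also have "\<dots> = (\<integral>\<^sup>+ x. (\<integral>\<^sup>+ e. f ((\<Sum>j<p. x j * b j) + \<sigma> * e, x) \<partial>std_normal) \<partial>std_normals {..<p})"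
  proof (rule nn_integral_cong)
    fix x assume "x \<in> space (std_normals {..<p})"
    then have x: "x \<in> space (PiM {..<p} (\<lambda>_. borel :: real measure))"
      by (simp add: space_PiM)
    define m where "m = (\<Sum>j<p. x j * b j)"
    have [measurable]: "(\<lambda>y. f (y, x)) \<in> borel_measurable borel"
      by (rule measurable_compose[OF measurable_Pair2'[OF x] f])
    have "(\<integral>\<^sup>+ e. f (m + e, x) \<partial>density lborel (normal_density 0 \<sigma>)) =
        (\<integral>\<^sup>+ e. ennreal (normal_density 0 \<sigma> e) * f (m + e, x) \<partial>lborel)"
      by (subst nn_integral_density) simp_all
    also have "\<dots> = ennreal \<sigma> * (\<integral>\<^sup>+ e. ennreal (normal_density 0 \<sigma> (\<sigma> * e)) * f (m + \<sigma> * e, x) \<partial>lborel)"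
      using s by (subst nn_integral_real_affine[where c = \<sigma> and t = 0]) simp_all
    also have "\<dots> = (\<integral>\<^sup>+ e. ennreal (std_normal_density e) * f (m + \<sigma> * e, x) \<partial>lborel)"
    proof -
      have "\<sigma> * normal_density 0 \<sigma> (\<sigma> * e) = std_normal_density e" for e
        using s by (simp add: normal_density_def real_sqrt_mult power_mult_distrib)
      then have "ennreal \<sigma> * (ennreal (normal_density 0 \<sigma> (\<sigma> * e)) * F) = ennreal (std_normal_density e) * F" for e F
        using s by (simp add: mult.assoc[symmetric] ennreal_mult[symmetric])
      then show ?thesis
        by (subst nn_integral_cmult[symmetric]) simp_all
    qed
    also have "\<dots> = (\<integral>\<^sup>+ e. f (m + \<sigma> * e, x) \<partial>std_normal)"
      by (subst nn_integral_density) simp_all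
    finally show "(\<integral>\<^sup>+ e. f ((\<Sum>j<p. x j * b j) + e, x) \<partial>density lborel (normal_density 0 \<sigma>)) =
        (\<integral>\<^sup>+ e. f ((\<Sum>j<p. x j * b j) + \<sigma> * e, x) \<partial>std_normal)"
      by (simp add: m_def)
  qed
  finally show ?thesis .
qed

section \<open>Moments of the likelihood ratios\<close>

lemma std_normal_pair_swap:
  assumes "(\<lambda>(x, e). f x e) \<in> borel_measurable (std_normals {..<p} \<Otimes>\<^sub>M std_normal)"
  shows "(\<integral>\<^sup>+ x. (\<integral>\<^sup>+ e. f x e \<partial>std_normal) \<partial>std_normals {..<p}) =
    (\<integral>\<^sup>+ e. (\<integral>\<^sup>+ x. f x e \<partial>std_normals {..<p}) \<partial>std_normal)"
proof -
  interpret pair_sigma_finite "std_normals {..<p}" std_normal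
    using prob_space_std_normals[of "{..<p}"] prob_space_std_normal
    by (intro pair_sigma_finite.intro prob_space_imp_sigma_finite)
  show ?thesis
    using Fubini'[of f] assms by simp
qed

lemma measurable_row_form:
  assumes "(\<lambda>(t, x). f t x) \<in> borel_measurable (borel \<Otimes>\<^sub>M std_normals {..<p})"
  shows "(\<lambda>(x, e). f (e + (\<Sum>j<p. w j * x j)) x) \<in> borel_measurable (std_normals {..<p} \<Otimes>\<^sub>M std_normal)"
proof -
  have snd: "snd \<in> borel_measurable (std_normals {..<p} \<Otimes>\<^sub>M std_normal)"
    using measurable_snd[of "std_normals {..<p}" std_normal]
    by (simp only: measurable_cong_sets[OF refl sets_density] measurable_lborel1)
  have "(\<lambda>z. (snd z + (\<Sum>j<p. w j * fst z j), fst z)) \<in>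
      measurable (std_normals {..<p} \<Otimes>\<^sub>M std_normal) (borel \<Otimes>\<^sub>M std_normals {..<p})"
    by (intro measurable_Pair borel_measurable_add snd measurable_fst
        measurable_compose[OF measurable_fst measurable_linear_form])
  from measurable_compose[OF this assms] show ?thesis
    by (simp only: case_prod_unfold prod.sel)
qed

lemma gaussian_row_integrate_orthogonal:
  assumes disj: "\<And>j. j < p \<Longrightarrow> w j = 0 \<or> d j = 0"
    and F [measurable]: "F \<in> borel_measurable borel" and H [measurable]: "H \<in> borel_measurable borel"
  shows "(\<integral>\<^sup>+ x. (\<integral>\<^sup>+ e. F (e + (\<Sum>j<p. w j * x j)) *
      ennreal (exp (H (e + (\<Sum>j<p. w j * x j)) * (\<Sum>j<p. d j * x j))) \<partial>std_normal) \<partial>std_normals {..<p}) =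
    (\<integral>\<^sup>+ x. (\<integral>\<^sup>+ e. F (e + (\<Sum>j<p. w j * x j)) *
      ennreal (exp ((H (e + (\<Sum>j<p. w j * x j)))\<^sup>2 * (\<Sum>j<p. (d j)\<^sup>2) / 2)) \<partial>std_normal) \<partial>std_normals {..<p})"
    (is "?l = ?r")
proof -
  have m1: "(\<lambda>(t, x). F t * ennreal (exp (H t * (\<Sum>j<p. d j * x j)))) \<in> borel_measurable (borel \<Otimes>\<^sub>M std_normals {..<p})"
    by measurable
  have m2: "(\<lambda>(t, x). F t * ennreal (exp ((H t)\<^sup>2 * (\<Sum>j<p. (d j)\<^sup>2) / 2))) \<in> borel_measurable (borel \<Otimes>\<^sub>M std_normals {..<p})"
    by measurable
  have "?l = (\<integral>\<^sup>+ e. (\<integral>\<^sup>+ x. F (e + (\<Sum>j<p. w j * x j)) *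
      ennreal (exp (H (e + (\<Sum>j<p. w j * x j)) * (\<Sum>j<p. d j * x j))) \<partial>std_normals {..<p}) \<partial>std_normal)"
    by (rule std_normal_pair_swap) (rule measurable_row_form[OF m1])
  also have "\<dots> = (\<integral>\<^sup>+ e. (\<integral>\<^sup>+ x. F (e + (\<Sum>j<p. w j * x j)) *
      ennreal (exp ((H (e + (\<Sum>j<p. w j * x j)))\<^sup>2 * (\<Sum>j<p. (d j)\<^sup>2) / 2)) \<partial>std_normals {..<p}) \<partial>std_normal)"
  proof (rule nn_integral_cong)
    fix e :: real
    have "(\<lambda>t. F (e + t)) \<in> borel_measurable borel" "(\<lambda>t. H (e + t)) \<in> borel_measurable borel"
      by measurable
    from std_normals_integrate_orthogonal[OF finite_lessThan _ this, of p w d] disj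
    show "(\<integral>\<^sup>+ x. F (e + (\<Sum>j<p. w j * x j)) *
        ennreal (exp (H (e + (\<Sum>j<p. w j * x j)) * (\<Sum>j<p. d j * x j))) \<partial>std_normals {..<p}) =
      (\<integral>\<^sup>+ x. F (e + (\<Sum>j<p. w j * x j)) *
        ennreal (exp ((H (e + (\<Sum>j<p. w j * x j)))\<^sup>2 * (\<Sum>j<p. (d j)\<^sup>2) / 2)) \<partial>std_normals {..<p})"
      by blast
  qed
  also have "\<dots> = ?r"
    by (rule std_normal_pair_swap[symmetric]) (rule measurable_row_form[OF m2])
  finally show ?thesis .
qed

text \<open>
  The variable \<open>e + w \<bullet> x\<close> is normal with variance 2.
\<close>

lemma gaussian_row_exp_square:
  assumes w: "(\<Sum>j<p. w j * w j) = 1" and t: "0 \<le> t" "4 * t < 1"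
  shows "(\<integral>\<^sup>+ x. (\<integral>\<^sup>+ e. ennreal (exp (t * (e + (\<Sum>j<p. w j * x j))\<^sup>2)) \<partial>std_normal) \<partial>std_normals {..<p}) =
    ennreal (1 / sqrt (1 - 4 * t))"
proof -
  interpret X: prob_space "std_normals {..<p}" by (rule prob_space_std_normals)
  interpret N: prob_space std_normal by (rule prob_space_std_normal)
  interpret XN: pair_prob_space "std_normals {..<p}" std_normal ..
  let ?Y = "\<lambda>(x, e). e + (\<Sum>j<p. w j * x j)"
  have Y: "?Y \<in> borel_measurable (std_normals {..<p} \<Otimes>\<^sub>M std_normal)"
    by (rule measurable_row_form[of "\<lambda>t _. t"]) (simp add: measurable_fst case_prod_unfold)
  have fst: "(\<integral>\<^sup>+ z. ennreal (exp (g (?Y z))) \<partial>(std_normals {..<p} \<Otimes>\<^sub>M std_normal)) =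
      (\<integral>\<^sup>+ x. (\<integral>\<^sup>+ e. ennreal (exp (g (e + (\<Sum>j<p. w j * x j)))) \<partial>std_normal) \<partial>std_normals {..<p})"
    if [measurable]: "g \<in> borel_measurable borel" for g :: "real \<Rightarrow> real"
  proof -
    have "(\<lambda>y. ennreal (exp (g y))) \<in> borel_measurable borel" by measurable
    from sigma_finite_measure.nn_integral_fst[OF sigma_finite_std_normal measurable_compose[OF Y this]] show ?thesis
      by (simp only: prod.case)
  qed
  have mgf: "(\<integral>\<^sup>+ z. ennreal (exp (r * ?Y z)) \<partial>(std_normals {..<p} \<Otimes>\<^sub>M std_normal)) = ennreal (exp (r\<^sup>2 * 2 / 2))" for r
  proof -
    have "(\<integral>\<^sup>+ e. ennreal (exp (r * (e + W))) \<partial>std_normal) = ennreal (exp (r\<^sup>2 / 2)) * ennreal (exp (r * W))" for W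
    proof -
      have "(\<integral>\<^sup>+ e. ennreal (exp (r * (e + W))) \<partial>std_normal) =
          (\<integral>\<^sup>+ e. ennreal (exp (r * e)) * ennreal (exp (r * W)) \<partial>std_normal)"
        by (simp add: ennreal_mult[symmetric] distrib_left exp_add)
      then show ?thesis
        by (simp add: nn_integral_multc std_normal_mgf)
    qed
    moreover have "(\<integral>\<^sup>+ x. ennreal (exp (r * (\<Sum>j<p. w j * x j))) \<partial>std_normals {..<p}) = ennreal (exp (r\<^sup>2 / 2))"
      using std_normals_mgf[of "{..<p}" "\<lambda>j. r * w j"] w
      by (simp add: sum_distrib_left[symmetric] mult.assoc power_mult_distrib power2_eq_square[of "w _"])
    moreover have "(\<integral>\<^sup>+ x. ennreal (exp (r\<^sup>2 / 2)) * ennreal (exp (r * (\<Sum>j<p. w j * x j))) \<partial>std_normals {..<p}) =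
        ennreal (exp (r\<^sup>2 / 2)) * (\<integral>\<^sup>+ x. ennreal (exp (r * (\<Sum>j<p. w j * x j))) \<partial>std_normals {..<p})"
      by (rule nn_integral_cmult)
        (intro measurable_compose[OF measurable_linear_form, of "\<lambda>y. ennreal (exp (r * y))"], measurable)
    moreover have "ennreal (exp (r\<^sup>2 / 2)) * ennreal (exp (r\<^sup>2 / 2)) = ennreal (exp (r\<^sup>2 * 2 / 2))"
      by (simp add: ennreal_mult[symmetric] mult_exp_exp)
    ultimately show ?thesis
      using fst[of "\<lambda>y. r * y"] by (simp only:) simp
  qed
  have "(\<integral>\<^sup>+ z. ennreal (exp (t * (?Y z)\<^sup>2)) \<partial>(std_normals {..<p} \<Otimes>\<^sub>M std_normal)) = ennreal (1 / sqrt (1 - 2 * t * 2))"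
    using XN.sigma_finite_measure_axioms t by (intro exp_square_from_mgf Y mgf) simp_all
  then show ?thesis
    using fst[of "\<lambda>y. t * y\<^sup>2"] by simp
qed

text \<open>
  The likelihood ratio of adding \<open>h = A (e + w \<bullet> x)\<close> to each coordinate in the set with indicator
  \<open>c\<close>: conditionally on \<open>h\<close>, it is that of a shift of a standard normal vector by \<open>h c\<close>, and
  \<open>s = \<parallel>c\<parallel>\<^sup>2\<close>.
\<close>

definition spike_lr :: "nat \<Rightarrow> (nat \<Rightarrow> real) \<Rightarrow> (nat \<Rightarrow> real) \<Rightarrow> real \<Rightarrow> real \<Rightarrow> real \<Rightarrow> (nat \<Rightarrow> real) \<Rightarrow> real" where
  "spike_lr p w c A s e x = exp (A * (e + (\<Sum>j<p. w j * x j)) * (\<Sum>j<p. c j * x j)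
     - s * (A * (e + (\<Sum>j<p. w j * x j)))\<^sup>2 / 2)"

lemma spike_lr_mean:
  assumes "\<And>j. j < p \<Longrightarrow> w j = 0 \<or> c j = 0" and c: "(\<Sum>j<p. c j * c j) = s"
  shows "(\<integral>\<^sup>+ x. (\<integral>\<^sup>+ e. ennreal (spike_lr p w c A s e x) \<partial>std_normal) \<partial>std_normals {..<p}) = 1"
proof -
  have "ennreal (spike_lr p w c A s e x) =
      ennreal (exp (- s * (A * (e + (\<Sum>j<p. w j * x j)))\<^sup>2 / 2)) *
      ennreal (exp (A * (e + (\<Sum>j<p. w j * x j)) * (\<Sum>j<p. c j * x j)))" for e x
    unfolding spike_lr_def by (subst ennreal_mult[symmetric]) (simp_all add: mult_exp_exp)
  then have "(\<integral>\<^sup>+ x. (\<integral>\<^sup>+ e. ennreal (spike_lr p w c A s e x) \<partial>std_normal) \<partial>std_normals {..<p}) =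
    (\<integral>\<^sup>+ x. (\<integral>\<^sup>+ e. ennreal (exp (- s * (A * (e + (\<Sum>j<p. w j * x j)))\<^sup>2 / 2)) *
      ennreal (exp ((A * (e + (\<Sum>j<p. w j * x j)))\<^sup>2 * (\<Sum>j<p. (c j)\<^sup>2) / 2)) \<partial>std_normal) \<partial>std_normals {..<p})"
    using gaussian_row_integrate_orthogonal[of p w c "\<lambda>t. ennreal (exp (- s * (A * t)\<^sup>2 / 2))" "\<lambda>t. A * t"] assms(1)
    by simp
  also have "\<dots> = (\<integral>\<^sup>+ x. (\<integral>\<^sup>+ e. 1 \<partial>std_normal) \<partial>std_normals {..<p})"
    using c by (simp add: ennreal_mult[symmetric] mult_exp_exp power2_eq_square[of "c _"] mult.commute[of s])
  also have "\<dots> = 1"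
    using prob_space.emeasure_space_1[OF prob_space_std_normal]
      prob_space.emeasure_space_1[OF prob_space_std_normals] by simp
  finally show ?thesis .
qed

text \<open>
  Integrating out the coordinates in the two sets gives \<open>exp (h\<^sup>2 \<parallel>c + c'\<parallel>\<^sup>2 / 2)\<close>, and
  \<open>\<parallel>c + c'\<parallel>\<^sup>2 = 2 s + 2 J\<close>. The terms with \<open>s\<close> cancel and only \<open>exp (J h\<^sup>2)\<close> remains, so two
  disjoint sets give uncorrelated ratios.
\<close>

lemma spike_lr_correlation:
  assumes disj: "\<And>j. j < p \<Longrightarrow> w j = 0 \<or> c j = 0" "\<And>j. j < p \<Longrightarrow> w j = 0 \<or> c' j = 0"
    and c: "(\<Sum>j<p. c j * c j) = s" "(\<Sum>j<p. c' j * c' j) = s" and w: "(\<Sum>j<p. w j * w j) = 1"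
    and J: "(\<Sum>j<p. c j * c' j) = J" "0 \<le> J" "4 * (A\<^sup>2 * J) < 1"
  shows "(\<integral>\<^sup>+ x. (\<integral>\<^sup>+ e. ennreal (spike_lr p w c A s e x * spike_lr p w c' A s e x) \<partial>std_normal) \<partial>std_normals {..<p}) =
    ennreal (1 / sqrt (1 - 4 * (A\<^sup>2 * J)))"
proof -
  let ?T = "\<lambda>e x. e + (\<Sum>j<p. w j * x j)"
  have "ennreal (spike_lr p w c A s e x * spike_lr p w c' A s e x) =
      ennreal (exp (- s * (A * ?T e x)\<^sup>2)) * ennreal (exp (A * ?T e x * (\<Sum>j<p. (c j + c' j) * x j)))" for e x
    unfolding spike_lr_def
    by (subst ennreal_mult[symmetric])
      (simp_all add: mult_exp_exp sum.distrib distrib_right distrib_left[of "A * _"])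
  then have "(\<integral>\<^sup>+ x. (\<integral>\<^sup>+ e. ennreal (spike_lr p w c A s e x * spike_lr p w c' A s e x) \<partial>std_normal) \<partial>std_normals {..<p}) =
    (\<integral>\<^sup>+ x. (\<integral>\<^sup>+ e. ennreal (exp (- s * (A * ?T e x)\<^sup>2)) *
      ennreal (exp ((A * ?T e x)\<^sup>2 * (\<Sum>j<p. (c j + c' j)\<^sup>2) / 2)) \<partial>std_normal) \<partial>std_normals {..<p})"
    using gaussian_row_integrate_orthogonal[of p w "\<lambda>j. c j + c' j" "\<lambda>t. ennreal (exp (- s * (A * t)\<^sup>2))" "\<lambda>t. A * t"] disj
    by fastforce
  also have "(\<Sum>j<p. (c j + c' j)\<^sup>2) = 2 * s + 2 * J"
  proof -
    have "(\<Sum>j<p. (c j + c' j)\<^sup>2) = (\<Sum>j<p. c j * c j) + (\<Sum>j<p. c' j * c' j) + 2 * (\<Sum>j<p. c j * c' j)"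
      unfolding sum_distrib_left sum.distrib[symmetric]
      by (intro sum.cong) (simp_all add: power2_eq_square algebra_simps)
    then show ?thesis using c J by simp
  qed
  also have "(\<integral>\<^sup>+ x. (\<integral>\<^sup>+ e. ennreal (exp (- s * (A * ?T e x)\<^sup>2)) *
      ennreal (exp ((A * ?T e x)\<^sup>2 * (2 * s + 2 * J) / 2)) \<partial>std_normal) \<partial>std_normals {..<p}) =
    (\<integral>\<^sup>+ x. (\<integral>\<^sup>+ e. ennreal (exp ((A\<^sup>2 * J) * (?T e x)\<^sup>2)) \<partial>std_normal) \<partial>std_normals {..<p})"
  proof -
    have "ennreal (exp (- s * (A * t)\<^sup>2)) * ennreal (exp ((A * t)\<^sup>2 * (2 * s + 2 * J) / 2)) =
        ennreal (exp (A\<^sup>2 * J * t\<^sup>2))" for t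
      by (simp add: ennreal_mult[symmetric] mult_exp_exp power_mult_distrib distrib_left add_divide_distrib mult_ac)
    then show ?thesis by simp
  qed
  also have "\<dots> = ennreal (1 / sqrt (1 - 4 * (A\<^sup>2 * J)))"
    using J by (intro gaussian_row_exp_square w) simp_all
  finally show ?thesis .
qed

text \<open>
  The likelihood ratio of shifting the coefficient vector by \<open>\<tau> w\<close> in units of the noise level.
\<close>

definition shift_lr :: "nat \<Rightarrow> (nat \<Rightarrow> real) \<Rightarrow> real \<Rightarrow> real \<Rightarrow> (nat \<Rightarrow> real) \<Rightarrow> real" where
  "shift_lr p w \<tau> e x = exp (\<tau> * (\<Sum>j<p. w j * x j) * e - (\<tau> * (\<Sum>j<p. w j * x j))\<^sup>2 / 2)"

lemma shift_lr_mean: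
  "(\<integral>\<^sup>+ x. (\<integral>\<^sup>+ e. ennreal (shift_lr p w \<tau> e x) \<partial>std_normal) \<partial>std_normals {..<p}) = 1"
proof -
  have "(\<integral>\<^sup>+ e. ennreal (shift_lr p w \<tau> e x) \<partial>std_normal) = 1" for x
  proof -
    define a where "a = \<tau> * (\<Sum>j<p. w j * x j)"
    have "(\<integral>\<^sup>+ e. ennreal (shift_lr p w \<tau> e x) \<partial>std_normal) =
        (\<integral>\<^sup>+ e. ennreal (exp (- a\<^sup>2 / 2)) * ennreal (exp (a * e)) \<partial>std_normal)"
      by (simp add: shift_lr_def a_def[symmetric] ennreal_mult[symmetric] mult_exp_exp)
    also have "\<dots> = ennreal (exp (- a\<^sup>2 / 2)) * ennreal (exp (a\<^sup>2 / 2))"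
      by (subst nn_integral_cmult) (simp_all add: std_normal_mgf)
    also have "\<dots> = 1"
      by (simp add: ennreal_mult[symmetric] mult_exp_exp)
    finally show ?thesis .
  qed
  then show ?thesis
    using prob_space.emeasure_space_1[OF prob_space_std_normals] by simp
qed

lemma shift_lr_second_moment:
  assumes w: "(\<Sum>j<p. w j * w j) = 1" and t: "2 * \<tau>\<^sup>2 < 1"
  shows "(\<integral>\<^sup>+ x. (\<integral>\<^sup>+ e. ennreal (shift_lr p w \<tau> e x * shift_lr p w \<tau> e x) \<partial>std_normal) \<partial>std_normals {..<p}) =
    ennreal (1 / sqrt (1 - 2 * \<tau>\<^sup>2))"
proof -
  have "(\<integral>\<^sup>+ e. ennreal (shift_lr p w \<tau> e x * shift_lr p w \<tau> e x) \<partial>std_normal) =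
      ennreal (exp (\<tau>\<^sup>2 * (\<Sum>j<p. w j * x j)\<^sup>2))" for x
  proof -
    define a where "a = \<tau> * (\<Sum>j<p. w j * x j)"
    have "(\<integral>\<^sup>+ e. ennreal (shift_lr p w \<tau> e x * shift_lr p w \<tau> e x) \<partial>std_normal) =
        (\<integral>\<^sup>+ e. ennreal (exp (- a\<^sup>2)) * ennreal (exp (2 * a * e)) \<partial>std_normal)"
      by (simp add: shift_lr_def a_def[symmetric] ennreal_mult[symmetric] mult_exp_exp algebra_simps)
    also have "\<dots> = ennreal (exp (- a\<^sup>2)) * ennreal (exp ((2 * a)\<^sup>2 / 2))"
      by (subst nn_integral_cmult) (simp_all only: std_normal_mgf, simp)
    also have "\<dots> = ennreal (exp (a\<^sup>2))"
      by (simp add: ennreal_mult[symmetric] mult_exp_exp power_mult_distrib)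
    finally show ?thesis by (simp add: a_def power_mult_distrib)
  qed
  moreover have "(\<integral>\<^sup>+ x. ennreal (exp (\<tau>\<^sup>2 * (\<Sum>j<p. w j * x j)\<^sup>2)) \<partial>std_normals {..<p}) =
      ennreal (1 / sqrt (1 - 2 * \<tau>\<^sup>2 * 1))"
  proof (rule exp_square_from_mgf)
    fix r
    show "(\<integral>\<^sup>+ x. ennreal (exp (r * (\<Sum>j<p. w j * x j))) \<partial>std_normals {..<p}) = ennreal (exp (r\<^sup>2 * 1 / 2))"
      using std_normals_mgf[of "{..<p}" "\<lambda>j. r * w j"] w
      by (simp add: sum_distrib_left[symmetric] mult.assoc power_mult_distrib power2_eq_square[of "w _"])
  qed (use t prob_space_imp_sigma_finite[OF prob_space_std_normals] in \<open>simp_all add: measurable_linear_form\<close>)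
  ultimately show ?thesis by simp
qed

section \<open>Likelihood ratios of the two alternatives\<close>

lemma mvn_density_one: "mvn_density p (1\<^sub>m p) x = exp (- (\<Sum>j<p. (x j)\<^sup>2) / 2) / sqrt ((2 * pi) ^ p)"
proof -
  have "scalar_prod (Matrix.vec p x) (1\<^sub>m p *\<^sub>v Matrix.vec p x) = (\<Sum>j<p. (x j)\<^sup>2)"
    by (simp add: scalar_prod_def lessThan_atLeast0 power2_eq_square)
  then show ?thesis
    by (simp add: mvn_density_def inv_mat_one)
qed

lemma normal_density_standardise:
  assumes "0 < \<sigma>"
  shows "normal_density m \<sigma> y = exp (- ((y - m) / \<sigma>)\<^sup>2 / 2) / (\<sigma> * sqrt (2 * pi))"
  using assms by (simp add: normal_density_def real_sqrt_mult power_divide mult.commute)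

lemma shift_density_ratio:
  fixes w b :: "nat \<Rightarrow> real" and \<tau> :: real
  assumes s: "0 < \<sigma>"
  defines "b' \<equiv> \<lambda>j. b j + \<sigma> * \<tau> * w j"
  shows "normal_density (\<Sum>j<p. x j * b' j) \<sigma> y =
    normal_density (\<Sum>j<p. x j * b j) \<sigma> y * shift_lr p w \<tau> ((y - (\<Sum>j<p. x j * b j)) / \<sigma>) x"
proof -
  define e W where "e = (y - (\<Sum>j<p. x j * b j)) / \<sigma>" and "W = (\<Sum>j<p. w j * x j)"
  have "(\<Sum>j<p. x j * b' j) = (\<Sum>j<p. x j * b j) + \<sigma> * \<tau> * W"
    by (simp add: b'_def W_def distrib_left sum.distrib sum_distrib_left mult_ac)
  then have e': "(y - (\<Sum>j<p. x j * b' j)) / \<sigma> = e - \<tau> * W"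
    using s by (simp add: e_def field_simps)
  have "exp (- (e - \<tau> * W)\<^sup>2 / 2) = exp (- e\<^sup>2 / 2) * exp (\<tau> * W * e - (\<tau> * W)\<^sup>2 / 2)"
    unfolding mult_exp_exp by (intro arg_cong[where f = exp]) (simp add: power2_eq_square algebra_simps diff_divide_distrib add_divide_distrib)
  then show ?thesis
    using s unfolding normal_density_standardise[OF s] e' shift_lr_def e_def[symmetric] W_def[symmetric]
    by simp
qed

context spike
begin

text \<open>
  The alternative, which was described through the conditional law of \<open>x\<close> given \<open>e\<close>, is the linear
  model with design covariance \<open>cov\<close>, coefficients \<open>b'\<close> and noise level \<open>\<sigma> / sqrt \<kappa>\<close>:
  completing the square in \<open>e\<close> matches the exponents, and the factor \<open>sqrt \<kappa>\<close> lost in the determinant of the covariance is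
  regained in the noise level. The noise level only decreases, so it stays admissible.
\<close>

lemma spike_density_ratio:
  fixes b :: "nat \<Rightarrow> real"
  assumes s: "0 < \<sigma>"
  defines "b' \<equiv> \<lambda>j. b j + \<sigma> * (A * c j - s * A\<^sup>2 * w j) / \<kappa>"
  shows "mvn_density p cov x * normal_density (\<Sum>j<p. x j * b' j) (\<sigma> / sqrt \<kappa>) y =
    mvn_density p (1\<^sub>m p) x * normal_density (\<Sum>j<p. x j * b j) \<sigma> y *
      spike_lr p w c A s ((y - (\<Sum>j<p. x j * b j)) / \<sigma>) x"
proof -
  define e W V N where "e = (y - (\<Sum>j<p. x j * b j)) / \<sigma>" and "W = (\<Sum>j<p. w j * x j)"
    and "V = (\<Sum>j<p. c j * x j)" and "N = (\<Sum>j<p. (x j)\<^sup>2)"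
  \<comment> \<open>given \<open>x\<close>, the mean response exceeds that of the null by \<open>\<sigma> g / \<kappa>\<close>\<close>
  define g where "g = A * V - s * A\<^sup>2 * W"
  have k: "0 < \<kappa>" using kappa_ge by simp
  have s': "0 < \<sigma> / sqrt \<kappa>" using s k by simp
  have "(\<Sum>j<p. x j * b' j) = (\<Sum>j<p. x j * b j + (\<sigma> * A / \<kappa>) * (c j * x j) - (\<sigma> * s * A\<^sup>2 / \<kappa>) * (w j * x j))"
    by (intro sum.cong refl) (simp add: b'_def algebra_simps diff_divide_distrib add_divide_distrib)
  also have "\<dots> = (\<Sum>j<p. x j * b j) + \<sigma> * g / \<kappa>"
    unfolding sum.distrib sum_subtractf sum_distrib_left[symmetric] V_def[symmetric] W_def[symmetric]
    by (simp add: g_def algebra_simps diff_divide_distrib)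
  finally have "((y - (\<Sum>j<p. x j * b' j)) / (\<sigma> / sqrt \<kappa>))\<^sup>2 = \<kappa> * (e - g / \<kappa>)\<^sup>2"
  proof -
    assume eq: "(\<Sum>j<p. x j * b' j) = (\<Sum>j<p. x j * b j) + \<sigma> * g / \<kappa>"
    have "(y - (\<Sum>j<p. x j * b' j)) / (\<sigma> / sqrt \<kappa>) = sqrt \<kappa> * (e - g / \<kappa>)"
      using s k unfolding eq e_def by (simp add: field_simps)
    then show ?thesis using k by (simp add: power_mult_distrib)
  qed
  moreover have "(N + (s * A\<^sup>2 * W\<^sup>2 - 2 * A * W * V - A\<^sup>2 * V\<^sup>2) / \<kappa>) + \<kappa> * (e - g / \<kappa>)\<^sup>2 =
      N + e\<^sup>2 - 2 * (A * (e + W) * V - s * (A * (e + W))\<^sup>2 / 2)"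
  proof -
    have "\<kappa> * (e - g / \<kappa>)\<^sup>2 = \<kappa> * e\<^sup>2 - 2 * e * g + g\<^sup>2 / \<kappa>"
      using k by (simp add: power2_eq_square field_simps)
    moreover have "s * A\<^sup>2 * W\<^sup>2 - 2 * A * W * V - A\<^sup>2 * V\<^sup>2 + g\<^sup>2 = (s * A\<^sup>2 * W\<^sup>2 - 2 * A * W * V) * \<kappa>"
      by (simp add: g_def \<kappa>_def power2_eq_square algebra_simps)
    then have "(s * A\<^sup>2 * W\<^sup>2 - 2 * A * W * V - A\<^sup>2 * V\<^sup>2) / \<kappa> + g\<^sup>2 / \<kappa> = s * A\<^sup>2 * W\<^sup>2 - 2 * A * W * V"
      using k by (simp add: add_divide_distrib[symmetric])
    ultimately have "(N + (s * A\<^sup>2 * W\<^sup>2 - 2 * A * W * V - A\<^sup>2 * V\<^sup>2) / \<kappa>) + \<kappa> * (e - g / \<kappa>)\<^sup>2 =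
        N + (s * A\<^sup>2 * W\<^sup>2 - 2 * A * W * V) + \<kappa> * e\<^sup>2 - 2 * e * g"
      by linarith
    also have "\<dots> = N + e\<^sup>2 - 2 * (A * (e + W) * V - s * (A * (e + W))\<^sup>2 / 2)"
      by (simp add: g_def \<kappa>_def power2_eq_square algebra_simps)
    finally show ?thesis .
  qed
  moreover have halve: "- P / 2 + - K / 2 = - N / 2 + - E / 2 + R" if "P + K = N + E - 2 * R" for P K E R
    using that by (simp add: field_simps)
  ultimately have "exp (- (N + (s * A\<^sup>2 * W\<^sup>2 - 2 * A * W * V - A\<^sup>2 * V\<^sup>2) / \<kappa>) / 2)
        * exp (- ((y - (\<Sum>j<p. x j * b' j)) / (\<sigma> / sqrt \<kappa>))\<^sup>2 / 2) =
      exp (- N / 2) * exp (- e\<^sup>2 / 2) * exp (A * (e + W) * V - s * (A * (e + W))\<^sup>2 / 2)"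
    unfolding mult_exp_exp by (intro arg_cong[where f = exp] halve) (simp only:)
  moreover have "mvn_density p cov x =
      exp (- (N + (s * A\<^sup>2 * W\<^sup>2 - 2 * A * W * V - A\<^sup>2 * V\<^sup>2) / \<kappa>) / 2) / (sqrt ((2 * pi) ^ p) * sqrt \<kappa>)"
    unfolding mvn_density_def inv_cov det_cov prec_quad_form N_def W_def V_def by (simp only: real_sqrt_mult)
  moreover have "mvn_density p (1\<^sub>m p) x = exp (- N / 2) / sqrt ((2 * pi) ^ p)"
    unfolding mvn_density_one N_def ..
  moreover have cancel: "E1 / (S * sqrt \<kappa>) * (E2 / (\<sigma> / sqrt \<kappa> * q)) = E3 / S * (E4 / (\<sigma> * q)) * R"
    if "E1 * E2 = E3 * E4 * R" for E1 E2 E3 E4 R S q :: real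
  proof -
    have "E1 / (S * sqrt \<kappa>) * (E2 / (\<sigma> / sqrt \<kappa> * q)) = (E1 * E2) / (S * (\<sigma> * q))"
      using k by simp
    then show ?thesis by (simp add: that)
  qed
  ultimately show ?thesis
    unfolding normal_density_standardise[OF s'] normal_density_standardise[OF s]
      spike_lr_def e_def[symmetric] W_def[symmetric] V_def[symmetric]
    by (simp only: cancel)
qed

end

lemma measurable_residual_ratio:
  fixes g :: "real \<Rightarrow> (nat \<Rightarrow> real) \<Rightarrow> real"
  assumes "(\<lambda>(e, x). g e x) \<in> borel_measurable (borel \<Otimes>\<^sub>M PiM {..<p} (\<lambda>_. borel))"
  shows "(\<lambda>(y, x). g ((y - (\<Sum>j<p. x j * b j)) / \<sigma>) x) \<in> borel_measurable (borel \<Otimes>\<^sub>M PiM {..<p} (\<lambda>_. borel))"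
proof -
  have "(\<lambda>x. x j * b j) \<in> borel_measurable (PiM {..<p} (\<lambda>_. borel :: real measure))" if "j \<in> {..<p}" for j
    by (intro borel_measurable_times measurable_component_singleton[OF that] borel_measurable_const)
  then have "(\<lambda>z. ((fst z - (\<Sum>j<p. snd z j * b j)) / \<sigma>, snd z)) \<in>
      measurable (borel \<Otimes>\<^sub>M PiM {..<p} (\<lambda>_. borel)) (borel \<Otimes>\<^sub>M PiM {..<p} (\<lambda>_. borel))"
    by (intro measurable_Pair borel_measurable_divide borel_measurable_diff measurable_fst measurable_snd
        borel_measurable_sum borel_measurable_const measurable_compose[OF measurable_snd])
  from measurable_compose[OF this assms] show ?thesis
    by (simp only: case_prod_unfold prod.sel)
qed

lemma measurable_linear_form_borel:
  "(\<lambda>x. \<Sum>j\<in>I. a j * x j) \<in> borel_measurable (PiM I (\<lambda>_. borel :: real measure))"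
  by (intro borel_measurable_sum borel_measurable_times borel_measurable_const measurable_component_singleton)

lemma measurable_spike_lr:
  "(\<lambda>(e, x). spike_lr p w c A s e x) \<in> borel_measurable (borel \<Otimes>\<^sub>M PiM {..<p} (\<lambda>_. borel))"
proof -
  note [measurable] = measurable_linear_form_borel
  show ?thesis unfolding spike_lr_def by measurable
qed

lemma measurable_shift_lr:
  "(\<lambda>(e, x). shift_lr p w \<tau> e x) \<in> borel_measurable (borel \<Otimes>\<^sub>M PiM {..<p} (\<lambda>_. borel))"
proof -
  note [measurable] = measurable_linear_form_borel
  show ?thesis unfolding shift_lr_def by measurable
qed

text \<open>
  The general lower bound for this model. The functions \<open>g i\<close> are likelihood ratios of a single row,
  in terms of the standardised null residual and the design row, and \<open>m i j\<close> are their inner products;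
  independence of the rows raises these to the power \<open>n\<close>.
\<close>

lemma expected_length_ge_separation:
  fixes g :: "'i \<Rightarrow> real \<Rightarrow> (nat \<Rightarrow> real) \<Rightarrow> real"
  assumes \<theta>0: "(\<beta>, 1\<^sub>m p, \<sigma>) \<in> \<Theta>" "\<beta> \<in> carrier_vec p" "0 < \<sigma>"
    and fin: "finite I" "I \<noteq> {}"
    and \<theta>: "\<And>i. i \<in> I \<Longrightarrow> (b i, Q i, sg i) \<in> \<Theta>" "\<And>i. i \<in> I \<Longrightarrow> b i \<in> carrier_vec p"
      "\<And>i. i \<in> I \<Longrightarrow> inv_mat (inv_mat (Q i)) \<in> carrier_mat p p" "\<And>i. i \<in> I \<Longrightarrow> 0 < sg i"
    and g: "\<And>i. i \<in> I \<Longrightarrow> (\<lambda>(e, x). g i e x) \<in> borel_measurable (borel \<Otimes>\<^sub>M PiM {..<p} (\<lambda>_. borel))"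
    and pos: "\<And>i e x. i \<in> I \<Longrightarrow> 0 \<le> g i e x"
    and ratio: "\<And>i x y. i \<in> I \<Longrightarrow>
      mvn_density p (inv_mat (Q i)) x * normal_density (\<Sum>j<p. x j * vec_index (b i) j) (sg i) y =
      mvn_density p (1\<^sub>m p) x * normal_density (\<Sum>j<p. x j * vec_index \<beta> j) \<sigma> y *
        g i ((y - (\<Sum>j<p. x j * vec_index \<beta> j)) / \<sigma>) x"
    and mpos: "\<And>i x. i \<in> I \<Longrightarrow> 0 \<le> mvn_density p (inv_mat (Q i)) x"
    and mean: "\<And>i. i \<in> I \<Longrightarrow> (\<integral>\<^sup>+ x. (\<integral>\<^sup>+ e. ennreal (g i e x) \<partial>std_normal) \<partial>std_normals {..<p}) = 1"
    and corr: "\<And>i j. i \<in> I \<Longrightarrow> j \<in> I \<Longrightarrow>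
      (\<integral>\<^sup>+ x. (\<integral>\<^sup>+ e. ennreal (g i e x * g j e x) \<partial>std_normal) \<partial>std_normals {..<p}) = ennreal (m i j)"
    and m: "\<And>i j. i \<in> I \<Longrightarrow> j \<in> I \<Longrightarrow> 0 \<le> m i j"
      "(\<Sum>i\<in>I. \<Sum>j\<in>I. m i j ^ n) \<le> (1 + r\<^sup>2) * (real (card I))\<^sup>2"
    and r: "0 < r" and T1: "\<And>i. i \<in> I \<Longrightarrow> T (b i) = T1"
    and CI: "CI \<in> CIs n p \<alpha> \<Theta> T"
  shows "ennreal (\<bar>T1 - T \<beta>\<bar> * (1 - 2 * \<alpha> - r)) \<le> expected_length n p (\<beta>, 1\<^sub>m p, \<sigma>) CI"
proof -
  let ?S = "borel \<Otimes>\<^sub>M PiM {..<p} (\<lambda>_. borel :: real measure)"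
  define R0 where "R0 = row_law p (vec_index \<beta>) (1\<^sub>m p) \<sigma>"
  define h where "h i = (\<lambda>(y, x). g i ((y - (\<Sum>j<p. x j * vec_index \<beta> j)) / \<sigma>) x)" for i
  define M where "M = PiM {..<n} (\<lambda>_. R0)"
  define L where "L i z = (\<Prod>k<n. h i (z k))" for i and z :: data
  obtain l u where lu: "CI = (l, u)" by (cases CI)
  have h: "h i \<in> borel_measurable ?S" if "i \<in> I" for i
    unfolding h_def by (rule measurable_residual_ratio[OF g[OF that]])
  have hpos: "0 \<le> h i z" if "i \<in> I" for i z
    using pos[OF that] by (simp add: h_def case_prod_unfold)
  have setsR: "sets R0 = sets ?S"
    by (simp add: R0_def sets_row_law)
  have hR: "h i \<in> borel_measurable R0" if "i \<in> I" for i
    unfolding measurable_cong_sets[OF setsR refl] by (rule h[OF that])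
  interpret R0: prob_space R0
    unfolding R0_def by (rule prob_space_null_row_law) fact
  interpret PR: product_sigma_finite "\<lambda>_::nat. R0"
    by (rule product_sigma_finite.intro) (rule R0.sigma_finite_measure_axioms)
  interpret M: prob_space M
    unfolding M_def by (rule prob_space_PiM) (rule R0.prob_space_axioms)
  have row: "row_law p (vec_index (b i)) (inv_mat (Q i)) (sg i) = density R0 (\<lambda>z. ennreal (h i z))" if "i \<in> I" for i
    unfolding R0_def
  proof (rule row_law_eq_density)
    show "inv_mat (1\<^sub>m p) \<in> carrier_mat p p" by (simp add: inv_mat_one)
    show "0 \<le> mvn_density p (1\<^sub>m p) x" for x
      by (simp add: mvn_density_one)
    show "mvn_density p (inv_mat (Q i)) x * normal_density (\<Sum>j<p. x j * vec_index (b i) j) (sg i) y =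
        mvn_density p (1\<^sub>m p) x * normal_density (\<Sum>j<p. x j * vec_index \<beta> j) \<sigma> y * h i (y, x)" for x y
      using ratio[OF that] by (simp add: h_def)
  qed (use that \<theta> \<theta>0 h hpos mpos in auto)
  have int_row: "(\<integral>\<^sup>+ z. ennreal (F z) \<partial>R0) = (\<integral>\<^sup>+ x. (\<integral>\<^sup>+ e. ennreal (G e x) \<partial>std_normal) \<partial>std_normals {..<p})"
    if "F \<in> borel_measurable ?S" and "F = (\<lambda>(y, x). G ((y - (\<Sum>j<p. x j * vec_index \<beta> j)) / \<sigma>) x)" for F G
  proof -
    have "(\<integral>\<^sup>+ z. ennreal (F z) \<partial>R0) =
        (\<integral>\<^sup>+ x. (\<integral>\<^sup>+ e. ennreal (F ((\<Sum>j<p. x j * vec_index \<beta> j) + \<sigma> * e, x)) \<partial>std_normal) \<partial>std_normals {..<p})"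
      unfolding R0_def by (rule nn_integral_null_row_law[OF \<theta>0(3) measurable_compose[OF that(1) measurable_ennreal]])
    then show ?thesis using \<theta>0(3) by (simp add: that(2))
  qed
  have mean_row: "(\<integral>\<^sup>+ z. ennreal (h i z) \<partial>R0) = 1" if "i \<in> I" for i
    using int_row[OF h[OF that], of "g i"] mean[OF that] by (simp add: h_def)
  have corr_row: "(\<integral>\<^sup>+ z. ennreal (h i z * h j z) \<partial>R0) = ennreal (m i j)" if "i \<in> I" "j \<in> I" for i j
  proof -
    have "(\<lambda>z. h i z * h j z) \<in> borel_measurable ?S"
      by (intro borel_measurable_times h that)
    from int_row[OF this, of "\<lambda>e x. g i e x * g j e x"] corr[OF that] show ?thesis
      by (simp add: h_def case_prod_unfold)
  qed
  have law0: "data_law n p (\<beta>, 1\<^sub>m p, \<sigma>) = M"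
    unfolding M_def R0_def
    using data_law_eq_PiM_row_law[of \<beta> p "1\<^sub>m p" \<sigma> n] \<theta>0 R0.sigma_finite_measure_axioms
    by (simp add: inv_mat_one R0_def)
  have law1: "data_law n p (b i, Q i, sg i) = density M (\<lambda>z. ennreal (L i z))" if "i \<in> I" for i
  proof -
    interpret D: prob_space "density R0 (\<lambda>z. ennreal (h i z))"
      using mean_row[OF that] measurable_compose[OF hR[OF that] measurable_ennreal]
      by (intro prob_spaceI) (simp add: emeasure_density cong: nn_integral_cong)
    have "data_law n p (b i, Q i, sg i) = PiM {..<n} (\<lambda>_. density R0 (\<lambda>z. ennreal (h i z)))"
      using data_law_eq_PiM_row_law[OF \<theta>(2,3,4)[OF that], of n] D.sigma_finite_measure_axioms
      by (simp only: row[OF that])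
    also have "\<dots> = density M (\<lambda>z. \<Prod>k<n. ennreal (h i (z k)))"
      unfolding M_def using hR[OF that] D.sigma_finite_measure_axioms
      by (intro PiM_density measurable_compose[OF _ measurable_ennreal]) (simp_all add: R0.prob_space_axioms)
    also have "(\<lambda>z. \<Prod>k<n. ennreal (h i (z k))) = (\<lambda>z. ennreal (L i z))"
      using hpos[OF that] by (simp add: L_def prod_ennreal)
    finally show ?thesis .
  qed
  have setsM: "sets M = sets (data_space n p)"
    unfolding M_def data_space_def by (rule sets_PiM_cong) (simp_all add: setsR)
  have spaceM: "space M = space (data_space n p)"
    by (rule sets_eq_imp_space_eq[OF setsM])
  have luM: "l \<in> borel_measurable M" "u \<in> borel_measurable M"
    using CI unfolding measurable_cong_sets[OF setsM refl] by (simp_all add: lu CIs_def)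
  have cover: "1 - \<alpha> \<le> measure (data_law n p \<theta>) {z \<in> space M. l z \<le> T (fst \<theta>) \<and> T (fst \<theta>) \<le> u z}"
    if "\<theta> \<in> \<Theta>" for \<theta>
  proof -
    let ?P = "\<lambda>\<theta>. measure (data_law n p \<theta>) {z \<in> space (data_space n p). l z \<le> T (fst \<theta>) \<and> T (fst \<theta>) \<le> u z}"
    have "1 - \<alpha> \<le> (INF \<theta>\<in>\<Theta>. ?P \<theta>)"
      using CI by (simp add: lu CIs_def)
    also have "\<dots> \<le> ?P \<theta>"
      using that by (intro cINF_lower bdd_belowI[of _ 0]) auto
    finally show ?thesis by (simp add: spaceM)
  qed
  have "ennreal (\<bar>T1 - T \<beta>\<bar> * (1 - 2 * \<alpha> - r)) \<le> (\<integral>\<^sup>+ z. ennreal (u z - l z) \<partial>M)"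
  proof (rule M.expected_length_lower_bound[OF fin])
    show "L i \<in> borel_measurable M" if "i \<in> I" for i
      unfolding L_def M_def
    proof (rule borel_measurable_prod)
      fix k assume "k \<in> {..<n}"
      then have "(\<lambda>z. z k) \<in> measurable (PiM {..<n} (\<lambda>_. R0)) R0"
        by (rule measurable_component_singleton)
      from measurable_compose[OF this hR[OF that]]
      show "(\<lambda>z. h i (z k)) \<in> borel_measurable (PiM {..<n} (\<lambda>_. R0))" .
    qed
    show "0 \<le> L i x" if "i \<in> I" for i x
      using hpos[OF that] by (simp add: L_def prod_nonneg)
    show "(\<integral>\<^sup>+ z. ennreal (L i z) \<partial>M) = 1" if "i \<in> I" for i
    proof -
      have "(\<integral>\<^sup>+ z. ennreal (L i z) \<partial>M) = (\<integral>\<^sup>+ z. (\<Prod>k<n. ennreal (h i (z k))) \<partial>PiM {..<n} (\<lambda>_. R0))"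
        using hpos[OF that] by (simp add: L_def M_def prod_ennreal)
      also have "\<dots> = (\<Prod>k<n. \<integral>\<^sup>+ z. ennreal (h i z) \<partial>R0)"
        by (rule PR.product_nn_integral_prod[OF finite_lessThan]) (rule measurable_compose[OF hR[OF that] measurable_ennreal])
      finally show ?thesis by (simp add: mean_row[OF that])
    qed
    show "(\<Sum>i\<in>I. \<Sum>j\<in>I. \<integral>\<^sup>+ z. ennreal (L i z * L j z) \<partial>M) \<le> ennreal ((1 + r\<^sup>2) * (real (card I))\<^sup>2)"
    proof -
      have "(\<integral>\<^sup>+ z. ennreal (L i z * L j z) \<partial>M) = ennreal (m i j ^ n)" if "i \<in> I" "j \<in> I" for i j
      proof -
        have "(\<integral>\<^sup>+ z. ennreal (L i z * L j z) \<partial>M) =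
            (\<integral>\<^sup>+ z. (\<Prod>k<n. ennreal (h i (z k) * h j (z k))) \<partial>PiM {..<n} (\<lambda>_. R0))"
        proof -
          have "ennreal (L i z * L j z) = (\<Prod>k<n. ennreal (h i (z k) * h j (z k)))" for z
            unfolding L_def prod.distrib[symmetric]
            by (rule prod_ennreal[symmetric]) (simp add: hpos that)
          then show ?thesis by (simp only: M_def)
        qed
        also have "\<dots> = (\<Prod>k<n. \<integral>\<^sup>+ z. ennreal (h i z * h j z) \<partial>R0)"
          by (rule PR.product_nn_integral_prod[OF finite_lessThan])
            (rule measurable_compose[OF borel_measurable_times[OF hR[OF that(1)] hR[OF that(2)]] measurable_ennreal])
        finally show ?thesis
          using m(1)[OF that] by (simp add: corr_row[OF that] prod_ennreal ennreal_power)
      qed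
      then have "(\<Sum>i\<in>I. \<Sum>j\<in>I. \<integral>\<^sup>+ z. ennreal (L i z * L j z) \<partial>M) = (\<Sum>i\<in>I. \<Sum>j\<in>I. ennreal (m i j ^ n))"
        by (intro sum.cong refl) simp
      also have "\<dots> = (\<Sum>i\<in>I. ennreal (\<Sum>j\<in>I. m i j ^ n))"
        using m(1) by (intro sum.cong refl sum_ennreal) simp
      also have "\<dots> = ennreal (\<Sum>i\<in>I. \<Sum>j\<in>I. m i j ^ n)"
        using m(1) by (intro sum_ennreal sum_nonneg) simp
      finally show ?thesis using m(2) by (simp add: ennreal_leI)
    qed
    show "1 - \<alpha> \<le> M.prob {z \<in> space M. l z \<le> T \<beta> \<and> T \<beta> \<le> u z}"
      using cover[OF \<theta>0(1)] law0 by simp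
    show "1 - \<alpha> \<le> measure (density M (\<lambda>x. ennreal (L i x))) {z \<in> space M. l z \<le> T1 \<and> T1 \<le> u z}" if "i \<in> I" for i
      using cover[OF \<theta>(1)[OF that]] by (simp only: law1[OF that] fst_conv T1[OF that])
  qed (use r luM in auto)
  then show ?thesis
    by (simp only: lu expected_length.simps law0)
qed

section \<open>The parametric alternative\<close>

lemma Xi_direction:
  assumes "\<xi> \<in> Xi p q cbar"
  defines "w \<equiv> \<lambda>j. vec_index \<xi> j / norm2 \<xi>"
  shows "0 < norm2 \<xi>" "(\<Sum>j<p. w j * w j) = 1" "(\<Sum>j<p. vec_index \<xi> j * w j) = norm2 \<xi>" "1 \<le> q"
    "supp \<xi> \<subseteq> {..<p}" "card (supp \<xi>) = q" "\<And>j. j < p \<Longrightarrow> j \<notin> supp \<xi> \<Longrightarrow> w j = 0"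
proof -
  have x: "\<xi> \<in> carrier_vec p" "norm0 \<xi> = q" "\<xi> \<noteq> 0\<^sub>v p"
    using assms(1) by (auto simp: Xi_def)
  have fin: "finite (supp \<xi>)"
    by (simp add: supp_def)
  obtain j where j: "j < p" "vec_index \<xi> j \<noteq> 0"
    using x(1,3) by (metis eq_vecI carrier_vecD index_zero_vec)
  then have "j \<in> supp \<xi>"
    using x(1) by (simp add: supp_def)
  then show "1 \<le> q"
    using x(2) fin by (auto simp: norm0_def Suc_le_eq card_gt_0_iff)
  have sq: "norm2 \<xi> * norm2 \<xi> = (\<Sum>j<p. (vec_index \<xi> j)\<^sup>2)"
    using x(1) by (simp add: norm2_def sum_nonneg flip: power2_eq_square)
  have "0 < (\<Sum>j<p. (vec_index \<xi> j)\<^sup>2)"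
    using j by (intro sum_pos2[of _ j]) auto
  then show pos: "0 < norm2 \<xi>"
    using x(1) by (simp add: norm2_def)
  show "(\<Sum>j<p. w j * w j) = 1"
  proof -
    have "(\<Sum>j<p. w j * w j) = (\<Sum>j<p. (vec_index \<xi> j)\<^sup>2) / (norm2 \<xi> * norm2 \<xi>)"
      unfolding sum_divide_distrib by (simp add: w_def power2_eq_square)
    then show ?thesis using pos by (simp add: sq[symmetric])
  qed
  show "(\<Sum>j<p. vec_index \<xi> j * w j) = norm2 \<xi>"
    using sq pos by (simp add: w_def power2_eq_square flip: sum_divide_distrib)
      (metis less_irrefl nonzero_mult_div_cancel_right)
  show "supp \<xi> \<subseteq> {..<p}" "card (supp \<xi>) = q" "\<And>j. j < p \<Longrightarrow> j \<notin> supp \<xi> \<Longrightarrow> w j = 0"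
    using x by (auto simp: supp_def norm0_def w_def)
qed

lemma norm0_vec_le:
  assumes "\<And>j. j < p \<Longrightarrow> f j \<noteq> 0 \<Longrightarrow> j \<in> U" "finite U"
  shows "norm0 (Matrix.vec p f) \<le> card U"
  unfolding norm0_def using assms by (intro card_mono) (auto simp: supp_def)

text \<open>
  Squared, this is \<open>1 \<le> (1 - x) exp (2 x)\<close>, which follows from \<open>exp (2 x) \<ge> 1 + 2 x\<close> for
  \<open>x \<le> 1 / 2\<close>. It turns the product over the rows into an exponential in \<open>n\<close>.
\<close>

lemma inv_sqrt_le_exp:
  fixes x :: real
  assumes "0 \<le> x" "x \<le> 1 / 2"
  shows "1 / sqrt (1 - x) \<le> exp x"
proof -
  have "2 * x * x \<le> 1 * x"
    using assms by (intro mult_right_mono) auto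
  then have "1 \<le> (1 - x) * (1 + 2 * x)"
    by (simp add: algebra_simps)
  also have "\<dots> \<le> (1 - x) * exp (2 * x)"
    using assms exp_ge_add_one_self[of "2 * x"] by (intro mult_left_mono) auto
  also have "\<dots> = (sqrt (1 - x) * exp x)\<^sup>2"
    using assms by (simp add: power_mult_distrib exp_double)
  finally have "1 \<le> sqrt (1 - x) * exp x"
    using assms by (intro power2_le_imp_le[of 1]) auto
  then show ?thesis
    using assms by (simp add: divide_le_eq mult.commute)
qed

text \<open>
  A single alternative suffices, and it keeps the identity covariance. The second moment for \<open>n\<close> rows
  is \<open>(1 - 2 \<tau>\<^sup>2) powr (- n / 2)\<close>, at most \<open>exp (2 t\<^sup>2)\<close>, and the smallness of \<open>t\<close> brings it below
  \<open>1 + r\<^sup>2\<close>.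
\<close>

lemma length_bound_parametric:
  assumes n: "1 \<le> n" and null: "(\<beta>, 1\<^sub>m p, \<sigma>) \<in> Theta M1 M2 p k1" and \<xi>: "\<xi> \<in> Xi p q cbar"
    and k: "k1 + q \<le> k" and r: "0 < r" and t: "0 \<le> t" "t \<le> 1 / 2" "t \<le> r / 2"
    and CI: "CI \<in> CIs n p \<alpha> (Theta M1 M2 p k) (\<lambda>b. scalar_prod \<xi> b)"
  shows "ennreal (norm2 \<xi> * \<sigma> * (t / sqrt (real n)) * (1 - 2 * \<alpha> - r)) \<le> expected_length n p (\<beta>, 1\<^sub>m p, \<sigma>) CI"
proof -
  define w where "w j = vec_index \<xi> j / norm2 \<xi>" for j
  note w = Xi_direction[OF \<xi>, folded w_def]
  define \<tau> where "\<tau> = t / sqrt (real n)"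
  define b where "b = Matrix.vec p (\<lambda>j. vec_index \<beta> j + \<sigma> * \<tau> * w j)"
  have \<beta>: "\<beta> \<in> carrier_vec p" "norm0 \<beta> \<le> k1" "0 < \<sigma>"
    using null by (auto simp: Theta_def)
  have tau: "\<tau>\<^sup>2 * real n = t\<^sup>2" "0 \<le> \<tau>"
    using n t by (simp_all add: \<tau>_def power_divide)
  have t2: "2 * t\<^sup>2 \<le> 1 / 2"
    using power_mono[OF t(2,1), of 2] by (simp add: power2_eq_square)
  have "\<tau>\<^sup>2 * 1 \<le> \<tau>\<^sup>2 * real n"
    using n by (intro mult_left_mono) auto
  then have tau2: "2 * \<tau>\<^sup>2 \<le> 1 / 2"
    using tau t2 by simp
  have supp\<beta>: "finite (supp \<beta>)" "finite (supp \<xi>)"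
    by (simp_all add: supp_def)
  have "norm0 b \<le> card (supp \<beta> \<union> supp \<xi>)"
    unfolding b_def
  proof (rule norm0_vec_le)
    fix j assume j: "j < p" "vec_index \<beta> j + \<sigma> * \<tau> * w j \<noteq> 0"
    show "j \<in> supp \<beta> \<union> supp \<xi>"
    proof (rule ccontr)
      assume "j \<notin> supp \<beta> \<union> supp \<xi>"
      then have "w j = 0" "vec_index \<beta> j = 0"
        using w(7)[OF j(1)] \<beta>(1) j(1) by (auto simp: supp_def)
      then show False using j(2) by simp
    qed
  qed (use supp\<beta> in simp)
  also have "\<dots> \<le> k"
    using card_Un_le[of "supp \<beta>" "supp \<xi>"] \<beta>(2) w(6) k by (simp add: norm0_def)
  finally have bk: "norm0 b \<le> k" .
  have null_k: "(\<beta>, 1\<^sub>m p, \<sigma>) \<in> Theta M1 M2 p k" and alt: "(b, 1\<^sub>m p, \<sigma>) \<in> Theta M1 M2 p k"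
    using null k bk by (auto simp: Theta_def b_def)
  have T: "scalar_prod \<xi> b = scalar_prod \<xi> \<beta> + norm2 \<xi> * \<sigma> * \<tau>"
  proof -
    have "scalar_prod \<xi> b = (\<Sum>j<p. vec_index \<xi> j * vec_index \<beta> j + \<sigma> * \<tau> * (vec_index \<xi> j * w j))"
      by (simp add: scalar_prod_def b_def lessThan_atLeast0 algebra_simps)
    also have "\<dots> = scalar_prod \<xi> \<beta> + \<sigma> * \<tau> * norm2 \<xi>"
      using \<beta>(1) by (simp add: sum.distrib sum_distrib_left[symmetric] w(3)[unfolded lessThan_atLeast0] scalar_prod_def lessThan_atLeast0)
    finally show ?thesis by simp
  qed
  let ?I = "{()}" and ?m = "\<lambda>_ _. 1 / sqrt (1 - 2 * \<tau>\<^sup>2)"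
  have "ennreal (\<bar>scalar_prod \<xi> b - scalar_prod \<xi> \<beta>\<bar> * (1 - 2 * \<alpha> - r)) \<le> expected_length n p (\<beta>, 1\<^sub>m p, \<sigma>) CI"
  proof (rule expected_length_ge_separation[OF null_k \<beta>(1,3), where I = ?I and b = "\<lambda>_. b"
        and Q = "\<lambda>_. 1\<^sub>m p" and sg = "\<lambda>_. \<sigma>" and g = "\<lambda>_. shift_lr p w \<tau>" and m = ?m])
    show "mvn_density p (inv_mat (1\<^sub>m p)) x * normal_density (\<Sum>j<p. x j * vec_index b j) \<sigma> y =
        mvn_density p (1\<^sub>m p) x * normal_density (\<Sum>j<p. x j * vec_index \<beta> j) \<sigma> y *
        shift_lr p w \<tau> ((y - (\<Sum>j<p. x j * vec_index \<beta> j)) / \<sigma>) x" for x y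
    proof -
      have "(\<Sum>j<p. x j * vec_index b j) = (\<Sum>j<p. x j * (vec_index \<beta> j + \<sigma> * \<tau> * w j))"
        by (simp add: b_def)
      then show ?thesis
        using shift_density_ratio[OF \<beta>(3), where b = "vec_index \<beta>" and w = w and \<tau> = \<tau> and p = p and x = x and y = y]
        by (simp add: inv_mat_one)
    qed
    show "(\<integral>\<^sup>+ x. (\<integral>\<^sup>+ e. ennreal (shift_lr p w \<tau> e x * shift_lr p w \<tau> e x) \<partial>std_normal) \<partial>std_normals {..<p}) =
        ennreal (?m i j)" for i j :: unit
      using tau2 by (intro shift_lr_second_moment w(2)) simp
    show "0 \<le> ?m i j" for i j :: unit
      using tau2 by simp
    show "(\<Sum>i\<in>?I. \<Sum>j\<in>?I. ?m i j ^ n) \<le> (1 + r\<^sup>2) * (real (card ?I))\<^sup>2"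
    proof -
      have "(1 / sqrt (1 - 2 * \<tau>\<^sup>2)) ^ n \<le> exp (2 * \<tau>\<^sup>2) ^ n"
        using tau2 by (intro power_mono inv_sqrt_le_exp) simp_all
      also have "\<dots> = exp (2 * t\<^sup>2)"
        by (simp add: exp_of_nat_mult[symmetric] tau(1)[symmetric] mult_ac)
      also have "\<dots> \<le> 1 + 2 * t\<^sup>2 + (2 * t\<^sup>2)\<^sup>2"
        using t2 by (intro exp_bound) auto
      also have "(2 * t\<^sup>2)\<^sup>2 \<le> 1 * (2 * t\<^sup>2)"
        using t2 unfolding power2_eq_square[of "2 * t\<^sup>2"] by (intro mult_right_mono) auto
      also have "1 + 2 * t\<^sup>2 + 1 * (2 * t\<^sup>2) \<le> 1 + r\<^sup>2"
        using power_mono[OF t(3,1), of 2] by (simp add: power_divide)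
      finally show ?thesis by simp
    qed
    show "mvn_density p (inv_mat (1\<^sub>m p)) x \<ge> 0" for x
      by (simp add: inv_mat_one mvn_density_one)
    show "0 \<le> shift_lr p w \<tau> e x" for e x
      by (simp add: shift_lr_def)
  qed (use r alt \<beta> CI in \<open>auto simp: b_def inv_mat_one measurable_shift_lr shift_lr_mean\<close>)
  then show ?thesis
    using w(1) \<beta>(3) tau(2) by (simp add: T \<tau>_def[symmetric] abs_mult mult.assoc)
qed

section \<open>The sparse prior\<close>

text \<open>
  For fixed \<open>f\<close> the sum factorises over the \<open>s\<close> blocks, and in each block one of the \<open>B\<close> choices
  coincides with that of \<open>f\<close>.
\<close>

lemma sum_coincidence_weights:
  fixes z :: real
  assumes "f \<in> {..<s} \<rightarrow>\<^sub>E {..<B::nat}"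
  shows "(\<Sum>g\<in>{..<s} \<rightarrow>\<^sub>E {..<B}. \<Prod>i<s. if f i = g i then z else 1) = (real B - 1 + z) ^ s"
proof -
  have "(\<Sum>g\<in>{..<s} \<rightarrow>\<^sub>E {..<B}. \<Prod>i<s. if f i = g i then z else 1) = (\<Prod>i<s. \<Sum>a<B. if f i = a then z else 1)"
    by (rule prod_sum_PiE[symmetric]) auto
  also have "\<dots> = (\<Prod>i<s. real B - 1 + z)"
  proof (rule prod.cong[OF refl])
    fix i assume "i \<in> {..<s}"
    then have fi: "f i < B" using assms by auto
    have "(\<Sum>a<B. if f i = a then z else 1) = z + (\<Sum>a\<in>{..<B} - {f i}. if f i = a then z else 1)"
      using fi by (subst sum.remove[of _ "f i"]) auto
    also have "(\<Sum>a\<in>{..<B} - {f i}. if f i = a then z else 1) = (\<Sum>a\<in>{..<B} - {f i}. 1)"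
      by (intro sum.cong) auto
    finally show "(\<Sum>a<B. if f i = a then z else 1) = real B - 1 + z"
      using fi by (simp add: of_nat_diff)
  qed
  finally show ?thesis by simp
qed

text \<open>
  The indicator of \<open>{idx (0, f 0), \<dots>, idx (s - 1, f (s - 1))}\<close> when \<open>idx\<close> enumerates \<open>s\<close> disjoint
  blocks. It is written as a sum so that inner products expand bilinearly.
\<close>

definition block_choice :: "(nat \<times> nat \<Rightarrow> nat) \<Rightarrow> nat \<Rightarrow> (nat \<Rightarrow> nat) \<Rightarrow> nat \<Rightarrow> real" where
  "block_choice idx s f j = (\<Sum>i<s. of_bool (j = idx (i, f i)))"

lemma block_choice_inner:
  assumes inj: "inj_on idx ({..<s} \<times> {..<B})" and ran: "idx ` ({..<s} \<times> {..<B}) \<subseteq> {..<p}"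
    and f: "f \<in> {..<s} \<rightarrow>\<^sub>E {..<B}" and g: "g \<in> {..<s} \<rightarrow>\<^sub>E {..<B}"
  shows "(\<Sum>j<p. block_choice idx s f j * block_choice idx s g j) = (\<Sum>i<s. of_bool (f i = g i))"
proof -
  have fB: "f i < B" "g i < B" "idx (i, f i) < p" if "i < s" for i
    using f g ran that by (auto simp: PiE_iff image_subset_iff)
  have "(\<Sum>j<p. block_choice idx s f j * block_choice idx s g j) =
      (\<Sum>j<p. \<Sum>i<s. \<Sum>i'<s. of_bool (j = idx (i, f i)) * of_bool (j = idx (i', g i')))"
    by (simp only: block_choice_def sum_product)
  also have "\<dots> = (\<Sum>i<s. \<Sum>i'<s. \<Sum>j<p. of_bool (j = idx (i, f i)) * of_bool (j = idx (i', g i')))"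
    by (subst sum.swap) (intro sum.cong refl sum.swap)
  also have "\<dots> = (\<Sum>i<s. \<Sum>i'<s. of_bool (i = i') * of_bool (f i = g i'))"
  proof (intro sum.cong refl)
    fix i i' assume i: "i \<in> {..<s}" "i' \<in> {..<s}"
    have "(\<Sum>j<p. of_bool (j = idx (i, f i)) * of_bool (j = idx (i', g i'))) =
        (\<Sum>j<p. if j = idx (i, f i) then of_bool (idx (i, f i) = idx (i', g i')) else 0 :: real)"
      by (intro sum.cong) auto
    also have "\<dots> = of_bool (idx (i, f i) = idx (i', g i'))"
      using fB(3) i by simp
    also have "idx (i, f i) = idx (i', g i') \<longleftrightarrow> i = i' \<and> f i = g i'"
      using inj_on_eq_iff[OF inj, of "(i, f i)" "(i', g i')"] fB i by auto
    finally show "(\<Sum>j<p. of_bool (j = idx (i, f i)) * of_bool (j = idx (i', g i'))) =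
        (of_bool (i = i') * of_bool (f i = g i') :: real)"
      by (simp only: of_bool_conj)
  qed
  also have "\<dots> = (\<Sum>i<s. of_bool (f i = g i))"
  proof (rule sum.cong[OF refl])
    fix i assume "i \<in> {..<s}"
    moreover have "(\<Sum>i'<s. of_bool (i = i') * of_bool (f i = g i')) = (\<Sum>i'<s. if i = i' then of_bool (f i = g i') else 0 :: real)"
      by (intro sum.cong) auto
    ultimately show "(\<Sum>i'<s. of_bool (i = i') * of_bool (f i = g i')) = (of_bool (f i = g i) :: real)"
      by simp
  qed
  finally show ?thesis .
qed

text \<open>
  Since \<open>f\<close> and \<open>g\<close> are independent and uniform, each block contributes the factor
  \<open>1 + (z - 1) / B\<close> to the mean of \<open>z\<close> to the number of coincidences, and \<open>1 + x \<le> exp x\<close>.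
\<close>

lemma mixture_second_moment:
  fixes z :: real
  assumes "1 \<le> B" "1 \<le> z" and r: "exp (real s * z / real B) \<le> 1 + r\<^sup>2"
    and m: "\<And>f g. f \<in> {..<s} \<rightarrow>\<^sub>E {..<B} \<Longrightarrow> g \<in> {..<s} \<rightarrow>\<^sub>E {..<B} \<Longrightarrow> m f g \<le> (\<Prod>i<s. if f i = g i then z else 1)"
  shows "(\<Sum>f\<in>{..<s} \<rightarrow>\<^sub>E {..<B}. \<Sum>g\<in>{..<s} \<rightarrow>\<^sub>E {..<B}. m f g) \<le>
    (1 + r\<^sup>2) * (real (card ({..<s} \<rightarrow>\<^sub>E {..<B})))\<^sup>2"
proof -
  let ?F = "{..<s} \<rightarrow>\<^sub>E {..<B}"
  have card: "real (card ?F) = real B ^ s"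
    by (simp add: card_PiE)
  have "(\<Sum>f\<in>?F. \<Sum>g\<in>?F. m f g) \<le> (\<Sum>f\<in>?F. \<Sum>g\<in>?F. \<Prod>i<s. if f i = g i then z else 1)"
    by (intro sum_mono m)
  also have "\<dots> = real B ^ s * (real B - 1 + z) ^ s"
    using card by (simp add: sum_coincidence_weights)
  also have "real B - 1 + z \<le> real B * exp (z / real B)"
  proof -
    have "real B - 1 + z \<le> real B * (1 + z / real B)"
      using assms(1) by (simp add: field_simps)
    also have "\<dots> \<le> real B * exp (z / real B)"
      by (intro mult_left_mono exp_ge_add_one_self) simp
    finally show ?thesis .
  qed
  then have "real B ^ s * (real B - 1 + z) ^ s \<le> real B ^ s * (real B * exp (z / real B)) ^ s"
    using assms(1,2) by (intro mult_left_mono power_mono) auto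
  also have "\<dots> = exp (real s * z / real B) * (real B ^ s)\<^sup>2"
    by (simp add: power_mult_distrib exp_of_nat_mult[symmetric] power2_eq_square)
  also have "\<dots> \<le> (1 + r\<^sup>2) * (real B ^ s)\<^sup>2"
    using r by (intro mult_right_mono) auto
  finally show ?thesis by (simp only: card)
qed

text \<open>
  The prior is uniform on the sets that contain one coordinate from each of \<open>s\<close> blocks of size \<open>B\<close>.
  The bound \<open>s A\<^sup>2 \<le> 1 / 8\<close> keeps the inner products of the ratios finite, the next condition
  keeps the eigenvalues of the precision matrices in \<open>[1 / M1, M1]\<close>, and the last one on \<open>r\<close> bounds
  the second moment of the mixture.
\<close>

lemma length_bound_spike:
  assumes null: "(\<beta>, 1\<^sub>m p, \<sigma>) \<in> Theta M1 M2 p k1" and \<xi>: "\<xi> \<in> Xi p q cbar"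
    and k: "k1 + q + s \<le> k" and B: "q + s * B \<le> p" "2 \<le> B" and s: "1 \<le> s"
    and A: "0 \<le> A" "real s * A\<^sup>2 \<le> 1 / 8" and M1: "1 < M1"
      "2 * (real s * A\<^sup>2) + 2 * A * sqrt (real s) \<le> 1 - 1 / M1"
    and r: "0 < r" "exp (real s * exp (4 * A\<^sup>2 * real n) / real B) \<le> 1 + r\<^sup>2"
    and CI: "CI \<in> CIs n p \<alpha> (Theta M1 M2 p k) (\<lambda>b. scalar_prod \<xi> b)"
  shows "ennreal (norm2 \<xi> * \<sigma> * (real s * A\<^sup>2 / (1 + real s * A\<^sup>2)) * (1 - 2 * \<alpha> - r))
    \<le> expected_length n p (\<beta>, 1\<^sub>m p, \<sigma>) CI"
proof -
  define w where "w j = vec_index \<xi> j / norm2 \<xi>" for j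
  note w = Xi_direction[OF \<xi>, folded w_def]
  have \<beta>: "\<beta> \<in> carrier_vec p" "norm0 \<beta> \<le> k1" "0 < \<sigma>" "\<sigma> \<le> M2"
    using null by (auto simp: Theta_def)
  have finsupp: "finite (supp \<beta>)" "finite (supp \<xi>)"
    by (simp_all add: supp_def)
  have "card ({..<s} \<times> {..<B}) \<le> card ({..<p} - supp \<xi>)"
    using B(1) w(5,6) finsupp by (simp add: card_Diff_subset)
  then obtain idx where idx: "inj_on idx ({..<s} \<times> {..<B})" "idx ` ({..<s} \<times> {..<B}) \<subseteq> {..<p} - supp \<xi>"
    using inj_on_iff_card_le[of "{..<s} \<times> {..<B}" "{..<p} - supp \<xi>"] by auto
  then have idxp: "idx ` ({..<s} \<times> {..<B}) \<subseteq> {..<p}"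
    by auto
  let ?F = "{..<s} \<rightarrow>\<^sub>E {..<B}"
  define c where "c f = block_choice idx s f" for f
  define \<kappa> where "\<kappa> = 1 + real s * A\<^sup>2"
  have kappa: "1 \<le> \<kappa>" by (simp add: \<kappa>_def)
  have c_zero: "c f j = 0" if "j \<notin> (\<lambda>i. idx (i, f i)) ` {..<s}" for f j
    using that unfolding c_def block_choice_def by (intro sum.neutral) auto
  have disj: "w j = 0 \<or> c f j = 0" if "j < p" "f \<in> ?F" for f j
  proof (cases "j \<in> supp \<xi>")
    case True
    have "idx (i, f i) \<notin> supp \<xi>" if "i < s" for i
      using idx(2) that \<open>f \<in> ?F\<close> by (auto simp: PiE_iff image_subset_iff)
    then have "j \<notin> (\<lambda>i. idx (i, f i)) ` {..<s}"
      using True by auto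
    then show ?thesis using c_zero by blast
  qed (use w(7) that in blast)
  have inner: "(\<Sum>j<p. c f j * c g j) = (\<Sum>i<s. of_bool (f i = g i))" if "f \<in> ?F" "g \<in> ?F" for f g
    unfolding c_def by (rule block_choice_inner[OF idx(1) idxp that])
  have spike: "spike p w (c f) (real s)" if "f \<in> ?F" for f
  proof
    show "(\<Sum>j<p. w j * w j) = 1" by (rule w(2))
    show "(\<Sum>j<p. w j * c f j) = 0"
      using disj that by (intro sum.neutral) auto
    show "(\<Sum>j<p. c f j * c f j) = real s"
      using inner[OF that that] by simp
  qed
  have k_eq: "spike.\<kappa> A (real s) = \<kappa>" if "f \<in> ?F" for f
    using spike.\<kappa>_def[OF spike[OF that]] by (simp add: \<kappa>_def)
  define b where "b f = Matrix.vec p (\<lambda>j. vec_index \<beta> j + \<sigma> * (A * c f j - real s * A\<^sup>2 * w j) / \<kappa>)" for f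
  define Q where "Q f = spike.prec p w (c f) A (real s)" for f
  have invQ: "inv_mat (Q f) = spike.cov p w (c f) A" "inv_mat (inv_mat (Q f)) = Q f" "Q f \<in> carrier_mat p p"
    if "f \<in> ?F" for f
    unfolding Q_def using spike.inv_prec[OF spike[OF that]] spike.inv_cov[OF spike[OF that]]
      spike.carriers[OF spike[OF that]] by simp_all
  have alt: "(b f, Q f, \<sigma> / sqrt \<kappa>) \<in> Theta M1 M2 p k" if f: "f \<in> ?F" for f
  proof -
    let ?S = "(\<lambda>i. idx (i, f i)) ` {..<s}"
    have "norm0 (b f) \<le> card (supp \<beta> \<union> supp \<xi> \<union> ?S)"
      unfolding b_def
    proof (rule norm0_vec_le)
      fix j assume j: "j < p" "vec_index \<beta> j + \<sigma> * (A * c f j - real s * A\<^sup>2 * w j) / \<kappa> \<noteq> 0"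
      show "j \<in> supp \<beta> \<union> supp \<xi> \<union> ?S"
      proof (rule ccontr)
        assume "j \<notin> supp \<beta> \<union> supp \<xi> \<union> ?S"
        then have "w j = 0" "vec_index \<beta> j = 0" "c f j = 0"
          using w(7)[OF j(1)] \<beta>(1) j(1) c_zero[of j f] by (auto simp: supp_def)
        then show False using j(2) by simp
      qed
    qed (use finsupp in simp)
    also have "\<dots> \<le> card (supp \<beta> \<union> supp \<xi>) + card ?S"
      by (rule card_Un_le)
    also have "\<dots> \<le> card (supp \<beta>) + card (supp \<xi>) + s"
      using card_image_le[of "{..<s}" "\<lambda>i. idx (i, f i)"] by (intro add_mono card_Un_le) simp
    also have "\<dots> \<le> k"
      using \<beta>(2) w(6) k by (simp add: norm0_def)
    finally have nb: "norm0 (b f) \<le> k" .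
    \<comment> \<open>a coordinate that belongs to the first block, hence not to the support of \<open>\<xi>\<close>, but is not chosen by \<open>f\<close>\<close>
    define i0 where "i0 = idx (0, if f 0 = 0 then 1 else 0)"
    have mem: "(0, if f 0 = 0 then 1 else 0) \<in> {..<s} \<times> {..<B}"
      using s B(2) by auto
    have i0: "i0 < p" "i0 \<notin> supp \<xi>"
      using idx(2) mem unfolding i0_def by blast+
    have "i0 \<notin> ?S"
    proof
      assume "i0 \<in> ?S"
      then obtain i where i: "i < s" "i0 = idx (i, f i)" by auto
      moreover have "(i, f i) \<in> {..<s} \<times> {..<B}" using i(1) f by auto
      ultimately have "(0, if f 0 = 0 then 1 else 0) = (i, f i)"
        using inj_onD[OF idx(1) _ mem, of "(i, f i)"] by (simp add: i0_def)
      then show False by (auto split: if_splits)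
    qed
    then have "w i0 = 0" "c f i0 = 0"
      using w(7)[OF i0] c_zero by auto
    from spike.spectrum_prec_bounds[OF spike[OF f] i0(1) this M1(1), of A] M1(2) A(1)
    have "1 / M1 \<le> lambda_min (Q f)" "lambda_min (Q f) \<le> lambda_max (Q f)" "lambda_max (Q f) \<le> M1"
      by (simp_all add: Q_def)
    moreover have "transpose_mat (Q f) = Q f"
      unfolding Q_def by (rule spike.prec_symmetric[OF spike[OF f]])
    moreover have "0 < \<sigma> / sqrt \<kappa>" "\<sigma> / sqrt \<kappa> \<le> M2"
      using \<beta>(3,4) kappa by (auto simp: divide_le_eq intro: order_trans[OF _ mult_left_mono[of 1 "sqrt \<kappa>" M2, simplified]])
    ultimately show ?thesis
      using nb invQ(3)[OF f] by (simp add: Theta_def b_def)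
  qed
  have T: "scalar_prod \<xi> (b f) = scalar_prod \<xi> \<beta> - norm2 \<xi> * \<sigma> * (real s * A\<^sup>2 / \<kappa>)" if f: "f \<in> ?F" for f
  proof -
    have xc: "vec_index \<xi> j * c f j = 0" if "j < p" for j
      using disj[OF that f] w(1) by (auto simp: w_def)
    have "scalar_prod \<xi> (b f) = (\<Sum>j<p. vec_index \<xi> j * vec_index \<beta> j
        + \<sigma> * A / \<kappa> * (vec_index \<xi> j * c f j) - \<sigma> * (real s * A\<^sup>2 / \<kappa>) * (vec_index \<xi> j * w j))"
      by (simp add: scalar_prod_def b_def lessThan_atLeast0 algebra_simps diff_divide_distrib add_divide_distrib)
    also have "\<dots> = (\<Sum>j<p. vec_index \<xi> j * vec_index \<beta> j - \<sigma> * (real s * A\<^sup>2 / \<kappa>) * (vec_index \<xi> j * w j))"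
      by (intro sum.cong) (simp_all add: xc)
    also have "\<dots> = scalar_prod \<xi> \<beta> - \<sigma> * (real s * A\<^sup>2 / \<kappa>) * norm2 \<xi>"
      unfolding sum_subtractf sum_distrib_left[symmetric] w(3)
      using \<beta>(1) by (simp add: scalar_prod_def lessThan_atLeast0)
    finally show ?thesis by simp
  qed
  define J :: "(nat \<Rightarrow> nat) \<Rightarrow> (nat \<Rightarrow> nat) \<Rightarrow> real" where "J f g = (\<Sum>i<s. of_bool (f i = g i))" for f g
  have J: "0 \<le> J f g" "J f g \<le> real s" for f g
    unfolding J_def using sum_mono[of "{..<s}" "\<lambda>i. of_bool (f i = g i) :: real" "\<lambda>_. 1"] by (auto intro: sum_nonneg)
  have AJ: "4 * (A\<^sup>2 * J f g) \<le> 1 / 2" for f g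
    using mult_left_mono[OF J(2)[of f g], of "A\<^sup>2"] A(2) by (simp add: mult.commute)
  define z where "z = exp (4 * A\<^sup>2 * real n)"
  have null_k: "(\<beta>, 1\<^sub>m p, \<sigma>) \<in> Theta M1 M2 p k"
    using null k by (auto simp: Theta_def)
  let ?m = "\<lambda>f g. 1 / sqrt (1 - 4 * (A\<^sup>2 * J f g))"
  have "ennreal (\<bar>(scalar_prod \<xi> \<beta> - norm2 \<xi> * \<sigma> * (real s * A\<^sup>2 / \<kappa>)) - scalar_prod \<xi> \<beta>\<bar> * (1 - 2 * \<alpha> - r))
      \<le> expected_length n p (\<beta>, 1\<^sub>m p, \<sigma>) CI"
  proof (rule expected_length_ge_separation[OF null_k \<beta>(1,3), where I = ?F and b = b
        and Q = Q and sg = "\<lambda>_. \<sigma> / sqrt \<kappa>" and g = "\<lambda>f. spike_lr p w (c f) A (real s)" and m = ?m])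
    show "finite ?F" by (intro finite_PiE) auto
    show "?F \<noteq> {}" using B(2) by (auto simp: PiE_eq_empty_iff lessThan_empty_iff)
    show "mvn_density p (inv_mat (Q f)) x * normal_density (\<Sum>j<p. x j * vec_index (b f) j) (\<sigma> / sqrt \<kappa>) y =
        mvn_density p (1\<^sub>m p) x * normal_density (\<Sum>j<p. x j * vec_index \<beta> j) \<sigma> y *
        spike_lr p w (c f) A (real s) ((y - (\<Sum>j<p. x j * vec_index \<beta> j)) / \<sigma>) x" if "f \<in> ?F" for f x y
    proof -
      have "(\<Sum>j<p. x j * vec_index (b f) j) =
          (\<Sum>j<p. x j * (vec_index \<beta> j + \<sigma> * (A * c f j - real s * A\<^sup>2 * w j) / \<kappa>))"
        by (simp add: b_def)
      then show ?thesis
        using spike.spike_density_ratio[OF spike[OF that] \<beta>(3), of A x "vec_index \<beta>" y]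
        by (simp only: invQ(1)[OF that] k_eq[OF that])
    qed
    show "0 \<le> mvn_density p (inv_mat (Q f)) x" if "f \<in> ?F" for f x
      unfolding mvn_density_def invQ(1)[OF that] spike.det_cov[OF spike[OF that]] k_eq[OF that]
      using kappa by (intro divide_nonneg_nonneg) auto
    show "(\<integral>\<^sup>+ x. (\<integral>\<^sup>+ e. ennreal (spike_lr p w (c f) A (real s) e x) \<partial>std_normal) \<partial>std_normals {..<p}) = 1"
      if "f \<in> ?F" for f
      using disj that inner[OF that that] by (intro spike_lr_mean) auto
    show "(\<integral>\<^sup>+ x. (\<integral>\<^sup>+ e. ennreal (spike_lr p w (c f) A (real s) e x * spike_lr p w (c g) A (real s) e x)
        \<partial>std_normal) \<partial>std_normals {..<p}) = ennreal (?m f g)" if "f \<in> ?F" "g \<in> ?F" for f g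
    proof (rule spike_lr_correlation)
      show "4 * (A\<^sup>2 * J f g) < 1" using AJ[of f g] by linarith
    qed (use disj that inner w(2) J in \<open>auto simp: J_def\<close>)
    show "0 \<le> ?m f g" for f g
      using AJ[of f g] by simp
    show "(\<Sum>f\<in>?F. \<Sum>g\<in>?F. ?m f g ^ n) \<le> (1 + r\<^sup>2) * (real (card ?F))\<^sup>2"
    proof (rule mixture_second_moment[where z = z])
      show "1 \<le> z" by (simp add: z_def)
      show "exp (real s * z / real B) \<le> 1 + r\<^sup>2" using r(2) by (simp add: z_def)
      fix f g
      have "?m f g ^ n \<le> exp (4 * (A\<^sup>2 * J f g)) ^ n"
        using AJ[of f g] J(1)[of f g] by (intro power_mono inv_sqrt_le_exp) simp_all
      also have "\<dots> = exp (J f g * (4 * A\<^sup>2 * real n))"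
        by (simp add: exp_of_nat_mult[symmetric] mult_ac)
      also have "\<dots> = exp (\<Sum>i<s. of_bool (f i = g i) * (4 * A\<^sup>2 * real n))"
        by (simp only: J_def sum_distrib_right)
      also have "\<dots> = (\<Prod>i<s. if f i = g i then z else 1)"
        unfolding exp_sum[OF finite_lessThan] by (intro prod.cong) (auto simp: z_def)
      finally show "?m f g ^ n \<le> (\<Prod>i<s. if f i = g i then z else 1)" .
    qed (use B(2) in simp)
    show "0 \<le> spike_lr p w (c f) A (real s) e x" for f e x
      by (simp add: spike_lr_def)
    show "inv_mat (inv_mat (Q f)) \<in> carrier_mat p p" if "f \<in> ?F" for f
      using invQ[OF that] by simp
    show "scalar_prod \<xi> (b f) = scalar_prod \<xi> \<beta> - norm2 \<xi> * \<sigma> * (real s * A\<^sup>2 / \<kappa>)" if "f \<in> ?F" for f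
      by (rule T[OF that])
    show "0 < \<sigma> / sqrt \<kappa>"
      using \<beta>(3) kappa by simp
  qed (use r(1) alt CI in \<open>auto simp: b_def measurable_spike_lr\<close>)
  moreover have "\<bar>(scalar_prod \<xi> \<beta> - norm2 \<xi> * \<sigma> * (real s * A\<^sup>2 / \<kappa>)) - scalar_prod \<xi> \<beta>\<bar> =
      norm2 \<xi> * \<sigma> * (real s * A\<^sup>2 / \<kappa>)"
    using w(1) \<beta>(3) kappa by simp
  ultimately show ?thesis
    by (simp only: \<kappa>_def)
qed

section \<open>The lower bound\<close>

text \<open>
  In terms of \<open>p\<close> alone, the two conclusions ask that \<open>p powr (\<gamma> - 1)\<close> and
  \<open>p powr (- (1 - 2 \<gamma>) / 2)\<close> be small.
\<close>

lemma prior_parameters: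
  fixes c \<gamma> \<epsilon> :: real
  assumes "0 < c" "\<gamma> < 1 / 2" "0 < \<epsilon>"
  shows "\<exists>P0. \<forall>p k. P0 \<le> p \<longrightarrow> 1 \<le> p \<longrightarrow> real k \<le> c * real p powr \<gamma> \<longrightarrow>
    8 * real k \<le> real p \<and> 4 * (real k)\<^sup>2 * real p powr ((1 - 2 * \<gamma>) / 2) \<le> \<epsilon> * real p"
proof -
  have lim: "((\<lambda>p. real p powr e) \<longlongrightarrow> 0) sequentially" if "e < 0" for e
    by (rule tendsto_neg_powr[OF that filterlim_real_sequentially])
  have "\<forall>\<^sub>F p in sequentially. real p powr (\<gamma> - 1) < 1 / (8 * c)"
    using assms by (intro order_tendstoD(2)[OF lim]) auto
  moreover have "\<forall>\<^sub>F p in sequentially. real p powr (- ((1 - 2 * \<gamma>) / 2)) < \<epsilon> / (4 * c\<^sup>2)"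
    using assms by (intro order_tendstoD(2)[OF lim]) auto
  ultimately have "\<forall>\<^sub>F p in sequentially. real p powr (\<gamma> - 1) < 1 / (8 * c) \<and>
      real p powr (- ((1 - 2 * \<gamma>) / 2)) < \<epsilon> / (4 * c\<^sup>2)"
    by (rule eventually_conj)
  then obtain P0 where P0: "\<And>p. P0 \<le> p \<Longrightarrow> real p powr (\<gamma> - 1) < 1 / (8 * c)"
      "\<And>p. P0 \<le> p \<Longrightarrow> real p powr (- ((1 - 2 * \<gamma>) / 2)) < \<epsilon> / (4 * c\<^sup>2)"
    by (auto simp: eventually_sequentially)
  have "8 * real k \<le> real p \<and> 4 * (real k)\<^sup>2 * real p powr ((1 - 2 * \<gamma>) / 2) \<le> \<epsilon> * real p"
    if p: "P0 \<le> p" "1 \<le> p" and k: "real k \<le> c * real p powr \<gamma>" for p k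
  proof
    have pp: "0 < real p" using p by simp
    have "8 * real k \<le> 8 * c * (real p powr (\<gamma> - 1) * real p)"
      using k pp by (simp add: powr_diff)
    also have "\<dots> \<le> 8 * c * (1 / (8 * c) * real p)"
      using P0(1)[OF p(1)] assms pp by (intro mult_left_mono mult_right_mono) auto
    finally show "8 * real k \<le> real p"
      using assms by simp
    define \<nu> where "\<nu> = (1 - 2 * \<gamma>) / 2"
    have "(real k)\<^sup>2 \<le> (c * real p powr \<gamma>)\<^sup>2"
      using k by (intro power_mono) auto
    then have "4 * (real k)\<^sup>2 * real p powr \<nu> \<le> 4 * (c * real p powr \<gamma>)\<^sup>2 * real p powr \<nu>"
      by (intro mult_right_mono) auto
    also have "\<dots> = 4 * c\<^sup>2 * (real p powr (- \<nu>) * real p)"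
    proof -
      have "(real p powr \<gamma>)\<^sup>2 * real p powr \<nu> = real p powr (\<gamma> + \<gamma> + \<nu>)"
        by (simp only: power2_eq_square powr_add)
      also have "\<gamma> + \<gamma> + \<nu> = - \<nu> + 1"
        by (simp add: \<nu>_def field_simps)
      also have "real p powr (- \<nu> + 1) = real p powr (- \<nu>) * real p"
        using pp by (simp only: powr_add) simp
      finally show ?thesis by (simp add: power_mult_distrib mult.assoc)
    qed
    also have "\<dots> \<le> 4 * c\<^sup>2 * (\<epsilon> / (4 * c\<^sup>2) * real p)"
      using P0(2)[OF p(1)] pp by (intro mult_left_mono mult_right_mono) (auto simp: \<nu>_def)
    finally show "4 * (real k)\<^sup>2 * real p powr \<nu> \<le> \<epsilon> * real p"
      using assms by simp
  qed
  then show ?thesis by blast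
qed

text \<open>
  Here \<open>s\<close> is about \<open>\<zeta> k / 2\<close>, which leaves room for the supports of \<open>\<beta>\<close> and \<open>\<xi>\<close> within the
  sparsity \<open>k\<close>, and \<open>A\<^sup>2 = \<eta> ln p / n\<close>. The condition on \<open>\<eta> c\<close> makes \<open>s A\<^sup>2\<close> small, and the one
  on \<open>4 \<eta>\<close> makes \<open>exp (4 A\<^sup>2 n) = p powr (4 \<eta>)\<close> small against \<open>p / s\<^sup>2\<close>.
\<close>

lemma length_bound_high_dimension:
  fixes c \<gamma> \<zeta> \<eta> r M1 :: real
  assumes cs: "0 < c" "0 < \<zeta>" "\<zeta> < 1" "1 < M1" "0 < \<eta>" "0 < r"
    and eta: "4 * \<eta> \<le> (1 - 2 * \<gamma>) / 2" "\<eta> * c \<le> ((1 - 1 / M1) / 4)\<^sup>2"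
    and n: "1 \<le> n" and p: "1 \<le> p"
    and kn: "real k * ln (real p) \<le> c * real n" and k1: "real k1 \<le> (1 - \<zeta>) * real k - 1"
    and q: "real q \<le> \<zeta> / 4 * real k"
    and large: "8 * real k \<le> real p" "4 * (real k)\<^sup>2 * real p powr ((1 - 2 * \<gamma>) / 2) \<le> ln (1 + r\<^sup>2) * real p"
    and \<alpha>: "0 \<le> 1 - 2 * \<alpha> - r"
    and null: "(\<beta>, 1\<^sub>m p, \<sigma>) \<in> Theta M1 M2 p k1" and \<xi>: "\<xi> \<in> Xi p q cbar"
    and CI: "CI \<in> CIs n p \<alpha> (Theta M1 M2 p k) (\<lambda>b. scalar_prod \<xi> b)"
  shows "ennreal (norm2 \<xi> * \<sigma> * (\<zeta> * \<eta> / 4 * (real k * (ln (real p) / real n))) * (1 - 2 * \<alpha> - r))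
    \<le> expected_length n p (\<beta>, 1\<^sub>m p, \<sigma>) CI"
proof -
  have q1: "1 \<le> q" and norm\<xi>: "0 < norm2 \<xi>"
    using Xi_direction[OF \<xi>] by simp_all
  have sig: "0 < \<sigma>" using null by (auto simp: Theta_def)
  define s where "s = nat \<lceil>\<zeta> / 2 * real k\<rceil>"
  have "0 \<le> \<zeta> / 2 * real k" using cs by simp
  then have s: "\<zeta> / 2 * real k \<le> real s" "real s \<le> \<zeta> / 2 * real k + 1"
    unfolding s_def by linarith+
  have zk: "4 \<le> \<zeta> * real k"
    using q q1 by simp
  have zk': "\<zeta> * real k \<le> real k"
    using cs by (simp add: mult_left_le_one_le)
  have s1: "1 \<le> s" using s zk by linarith
  have sk: "real s \<le> real k" using s zk zk' by linarith
  have "real (k1 + q + s) \<le> real k"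
    using k1 q s zk by (simp add: algebra_simps)
  then have kle: "k1 + q + s \<le> k" by simp
  \<comment> \<open>the largest size for which \<open>s\<close> disjoint blocks fit outside the support of \<open>\<xi>\<close>\<close>
  define B where "B = (p - q) div s"
  have "real q \<le> real p" using q zk' large(1) by linarith
  then have qp: "q \<le> p" by simp
  have "s * B \<le> p - q" by (simp add: B_def)
  then have B: "q + s * B \<le> p" using qp by simp
  have "p - q < s * (B + 1)"
    using s1 dividend_less_times_div[of s "p - q"] by (simp add: B_def algebra_simps)
  then have "real (p - q) < real (s * (B + 1))" by (rule iffD2[OF of_nat_less_iff])
  then have "real p - real q < real s * real B + real s"
    using qp by (simp add: of_nat_diff algebra_simps)
  then have sB: "real p \<le> 4 * real s * real B" "real p / 2 \<le> real s * real B"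
    using large(1) sk q zk' zk s by linarith+
  have B2: "2 \<le> B"
  proof -
    have "real s * 4 \<le> real s * real B" using sB(2) large(1) sk by linarith
    then show ?thesis using s1 by simp
  qed
  define L where "L = ln (real p) / real n"
  define A where "A = sqrt (\<eta> * L)"
  have lnp: "0 \<le> ln (real p)" using p by simp
  have L: "0 \<le> L" using lnp by (simp add: L_def)
  have A: "0 \<le> A" "A\<^sup>2 = \<eta> * L"
    using L cs by (simp_all add: A_def)
  have kL: "real k * L \<le> c" using kn n by (simp add: L_def divide_le_eq)
  define \<mu> where "\<mu> = 1 - 1 / M1"
  have mu: "0 < \<mu>" "\<mu> < 1" using cs by (simp_all add: \<mu>_def)
  have "real s * A\<^sup>2 \<le> \<eta> * (real k * L)"
    using mult_right_mono[OF sk, of "\<eta> * L"] L cs by (simp add: A(2) mult_ac)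
  also have "\<dots> \<le> \<eta> * c"
    using kL cs by (intro mult_left_mono) auto
  finally have sA: "real s * A\<^sup>2 \<le> (\<mu> / 4)\<^sup>2"
    using eta(2) by (simp add: \<mu>_def)
  have sA8: "real s * A\<^sup>2 \<le> 1 / 8"
    using sA power_mono[of \<mu> 1 2] mu by (simp add: power_divide)
  have "A * sqrt (real s) = sqrt (real s * A\<^sup>2)"
    using A(1) by (simp add: real_sqrt_mult)
  also have "\<dots> \<le> sqrt ((\<mu> / 4)\<^sup>2)"
    using sA by (rule real_sqrt_le_mono)
  finally have "A * sqrt (real s) \<le> \<mu> / 4" using mu by simp
  moreover have "(\<mu> / 4)\<^sup>2 \<le> \<mu> / 4"
    using mu by (simp add: power2_eq_square divide_le_eq mult_left_le)
  ultimately have eig: "2 * (real s * A\<^sup>2) + 2 * A * sqrt (real s) \<le> 1 - 1 / M1"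
    using sA by (simp add: \<mu>_def)
  have chi: "exp (real s * exp (4 * A\<^sup>2 * real n) / real B) \<le> 1 + r\<^sup>2"
  proof -
    have "exp (4 * A\<^sup>2 * real n) = real p powr (4 * \<eta>)"
      using n p by (simp add: A(2) L_def powr_def mult_ac)
    also have "\<dots> \<le> real p powr ((1 - 2 * \<gamma>) / 2)"
      using eta(1) p by (intro powr_mono) auto
    finally have "real s * exp (4 * A\<^sup>2 * real n) \<le> real s * real p powr ((1 - 2 * \<gamma>) / 2)"
      by (intro mult_left_mono) auto
    also have "\<dots> \<le> ln (1 + r\<^sup>2) * real B"
    proof -
      define z where "z = real p powr ((1 - 2 * \<gamma>) / 2)"
      have "4 * real s * (real s * z) \<le> 4 * (real k)\<^sup>2 * z"
        using mult_right_mono[OF power_mono[OF sk, of 2], of z] by (simp add: z_def power2_eq_square mult.assoc)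
      also have "\<dots> \<le> ln (1 + r\<^sup>2) * (4 * real s * real B)"
        using large(2) mult_left_mono[OF sB(1), of "ln (1 + r\<^sup>2)"] by (simp add: z_def)
      finally have "4 * real s * (real s * z) \<le> 4 * real s * (ln (1 + r\<^sup>2) * real B)"
        by (simp add: mult_ac)
      then show ?thesis using s1 by (simp add: z_def)
    qed
    finally have "real s * exp (4 * A\<^sup>2 * real n) / real B \<le> ln (1 + r\<^sup>2)"
      using B2 by (simp add: divide_le_eq)
    then have "exp (real s * exp (4 * A\<^sup>2 * real n) / real B) \<le> exp (ln (1 + r\<^sup>2))"
      by simp
    then show ?thesis by (simp add: add_pos_nonneg)
  qed
  have "\<zeta> * \<eta> / 4 * (real k * L) = (\<zeta> / 2 * real k) * A\<^sup>2 / 2"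
    by (simp add: A(2))
  also have "\<dots> \<le> real s * A\<^sup>2 / 2"
    using s(1) by (intro divide_right_mono mult_right_mono) auto
  also have "\<dots> \<le> real s * A\<^sup>2 / (1 + real s * A\<^sup>2)"
    using sA8 by (intro divide_left_mono mult_nonneg_nonneg) (auto intro!: mult_pos_pos add_pos_nonneg)
  finally have "norm2 \<xi> * \<sigma> * (\<zeta> * \<eta> / 4 * (real k * L)) * (1 - 2 * \<alpha> - r) \<le>
      norm2 \<xi> * \<sigma> * (real s * A\<^sup>2 / (1 + real s * A\<^sup>2)) * (1 - 2 * \<alpha> - r)"
    using norm\<xi> sig \<alpha> by (intro mult_right_mono mult_left_mono) auto
  then show ?thesis
    using length_bound_spike[OF null \<xi> kle B B2 s1 A(1) sA8 cs(4) eig cs(6) chi CI]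
    by (fold L_def) (blast intro: order_trans ennreal_leI)
qed

theorem theorem3:
  fixes \<alpha> c \<gamma> \<zeta>\<^sub>0 M\<^sub>1 M\<^sub>2 cbar :: real
  assumes "0 < \<alpha>" "\<alpha> < 1 / 2"
    and "0 < c" and "0 \<le> \<gamma>" "\<gamma> < 1 / 2"
    and "0 < \<zeta>\<^sub>0" "\<zeta>\<^sub>0 < 1"
    and "1 < M\<^sub>1" and "0 < M\<^sub>2" and "1 \<le> cbar"
  shows "\<exists>c\<^sub>1>0. \<forall>(n::nat) (p::nat) (k::nat) (k\<^sub>1::nat) (q::nat).
    1 \<le> n \<longrightarrow> 1 \<le> p \<longrightarrow>
    real k \<le> c * real p powr \<gamma> \<longrightarrow> real k * ln (real p) \<le> c * real n \<longrightarrow>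
    real k\<^sub>1 \<le> (1 - \<zeta>\<^sub>0) * real k - 1 \<longrightarrow> real q \<le> \<zeta>\<^sub>0 / 4 * real k \<longrightarrow>
    (\<forall>\<beta> \<sigma> \<xi>. (\<beta>, 1\<^sub>m p, \<sigma>) \<in> Theta M\<^sub>1 M\<^sub>2 p k\<^sub>1 \<longrightarrow> \<xi> \<in> Xi p q cbar \<longrightarrow>
      (INF CI \<in> CIs n p \<alpha> (Theta M\<^sub>1 M\<^sub>2 p k) (\<lambda>b. scalar_prod \<xi> b).
          expected_length n p (\<beta>, 1\<^sub>m p, \<sigma>) CI)
        \<ge> ennreal (c\<^sub>1 * norm2 \<xi> * (real k * (ln (real p) / real n) + 1 / sqrt (real n)) * \<sigma>))"
proof -
  \<comment> \<open>half of the excess \<open>1 - 2 \<alpha>\<close> is spent on the distance of the laws, the other half remains\<close>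
  define r where "r = (1 - 2 * \<alpha>) / 2"
  have r: "0 < r" and \<alpha>r: "1 - 2 * \<alpha> - r = r"
    using assms(2) by (simp_all add: r_def field_simps)
  \<comment> \<open>with this \<open>t\<close> the parametric second moment \<open>exp (2 t\<^sup>2)\<close> is at most \<open>1 + r\<^sup>2\<close>\<close>
  define t where "t = min (1 / 2) (r / 2)"
  have t: "0 < t" "t \<le> 1 / 2" "t \<le> r / 2"
    using r by (simp_all add: t_def)
  define \<eta> where "\<eta> = min ((1 - 2 * \<gamma>) / 8) (((1 - 1 / M\<^sub>1) / 4)\<^sup>2 / c)"
  have mu: "0 < 1 - 1 / M\<^sub>1" using assms(8) by simp
  have "0 < ((1 - 1 / M\<^sub>1) / 4)\<^sup>2 / c"
    using mu assms(3) by (intro divide_pos_pos zero_less_power) auto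
  then have eta0: "0 < \<eta>" using assms(5) by (simp add: \<eta>_def)
  have "\<eta> \<le> (1 - 2 * \<gamma>) / 8" "\<eta> \<le> ((1 - 1 / M\<^sub>1) / 4)\<^sup>2 / c"
    unfolding \<eta>_def by (rule min.cobounded1) (rule min.cobounded2)
  then have eta: "4 * \<eta> \<le> (1 - 2 * \<gamma>) / 2" "\<eta> * c \<le> ((1 - 1 / M\<^sub>1) / 4)\<^sup>2"
    using assms(3) by (linarith, simp only: pos_le_divide_eq)
  have "0 < ln (1 + r\<^sup>2)" using r by (intro ln_gt_zero) simp
  from prior_parameters[OF assms(3,5) this] obtain P0 where P0: "\<And>p k. P0 \<le> p \<Longrightarrow> 1 \<le> p \<Longrightarrow>
      real k \<le> c * real p powr \<gamma> \<Longrightarrow> 8 * real k \<le> real p \<and>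
      4 * (real k)\<^sup>2 * real p powr ((1 - 2 * \<gamma>) / 2) \<le> ln (1 + r\<^sup>2) * real p"
    by blast
  define a where "a = \<zeta>\<^sub>0 * \<eta> / 4"
  have a: "0 < a" using assms(6) eta0 by (simp add: a_def)
  \<comment> \<open>for \<open>p < P0\<close>, the sum of the two rates is at most \<open>D\<close> times the parametric one\<close>
  define D where "D = c * (real P0)\<^sup>2 + 1"
  have D: "1 \<le> D" using assms(3) by (simp add: D_def)
  define c1 where "c1 = min (min a t * r / 2) (t * r / D)"
  have c1: "0 < c1" using a t r D by (simp add: c1_def)
  show ?thesis
  proof (intro exI[of _ c1] conjI c1 allI impI INF_greatest)
    fix n p k k1 q :: nat and \<beta> :: "real vec" and \<sigma> :: real and \<xi> :: "real vec" and CI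
    assume n: "1 \<le> n" and p: "1 \<le> p" and k: "real k \<le> c * real p powr \<gamma>" "real k * ln (real p) \<le> c * real n"
      and k1: "real k1 \<le> (1 - \<zeta>\<^sub>0) * real k - 1" and q: "real q \<le> \<zeta>\<^sub>0 / 4 * real k"
      and null: "(\<beta>, 1\<^sub>m p, \<sigma>) \<in> Theta M\<^sub>1 M\<^sub>2 p k1" and \<xi>: "\<xi> \<in> Xi p q cbar"
      and CI: "CI \<in> CIs n p \<alpha> (Theta M\<^sub>1 M\<^sub>2 p k) (\<lambda>b. scalar_prod \<xi> b)"
    define x y where "x = real k * (ln (real p) / real n)" and "y = 1 / sqrt (real n)"
    have N: "0 < norm2 \<xi> * \<sigma>"
      using Xi_direction(1)[OF \<xi>] null by (auto simp: Theta_def)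
    have x: "0 \<le> x" and y: "0 < y" using p n by (simp_all add: x_def y_def)
    let ?E = "expected_length n p (\<beta>, 1\<^sub>m p, \<sigma>) CI"
    have conclude: "ennreal (c1 * norm2 \<xi> * (x + y) * \<sigma>) \<le> ?E"
      if "ennreal (norm2 \<xi> * \<sigma> * v * r) \<le> ?E" and "c1 * (x + y) \<le> v * r" for v
    proof -
      have "norm2 \<xi> * \<sigma> * (c1 * (x + y)) \<le> norm2 \<xi> * \<sigma> * (v * r)"
        using that(2) N by (intro mult_left_mono) auto
      then have "c1 * norm2 \<xi> * (x + y) * \<sigma> \<le> norm2 \<xi> * \<sigma> * v * r"
        by (simp add: mult_ac)
      then show ?thesis using that(1) by (blast intro: order_trans ennreal_leI)
    qed
    have "real (k1 + q) \<le> real k"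
    proof -
      have "\<zeta>\<^sub>0 / 4 * real k \<le> \<zeta>\<^sub>0 * real k" using assms(6) by (intro mult_right_mono) auto
      then show ?thesis using k1 q by (simp add: algebra_simps)
    qed
    then have "k1 + q \<le> k" by simp
    from length_bound_parametric[OF n null \<xi> this r _ t(2,3) CI] t(1)
    have par: "ennreal (norm2 \<xi> * \<sigma> * (t * y) * r) \<le> ?E"
      by (simp add: \<alpha>r y_def)
    have "ennreal (c1 * norm2 \<xi> * (x + y) * \<sigma>) \<le> ?E"
    proof (cases "P0 \<le> p")
      case True
      from P0[OF this p k(1)]
      have large: "8 * real k \<le> real p"
        "4 * (real k)\<^sup>2 * real p powr ((1 - 2 * \<gamma>) / 2) \<le> ln (1 + r\<^sup>2) * real p" by auto
      have "0 \<le> 1 - 2 * \<alpha> - r" using \<alpha>r r by simp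
      from length_bound_high_dimension[OF assms(3,6,7,8) eta0 r eta n p k(2) k1 q large this null \<xi> CI]
      have spike: "ennreal (norm2 \<xi> * \<sigma> * (a * x) * r) \<le> ?E"
        by (simp only: \<alpha>r a_def x_def)
      have c1_le: "c1 \<le> min a t * r / 2" unfolding c1_def by (rule min.cobounded1)
      show ?thesis
      proof (cases "x \<le> y")
        case True
        have "c1 * (x + y) \<le> min a t * r / 2 * (2 * y)"
          using c1_le True x y c1 by (intro mult_mono) auto
        also have "\<dots> \<le> t * y * r"
          using y r by (simp add: mult_right_mono)
        finally show ?thesis by (rule conclude[OF par])
      next
        case False
        have "c1 * (x + y) \<le> min a t * r / 2 * (2 * x)"
          using c1_le False x y c1 by (intro mult_mono) auto
        also have "\<dots> \<le> a * x * r"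
          using x r by (simp add: mult_right_mono)
        finally show ?thesis by (rule conclude[OF spike])
      qed
    next
      case False
      have "real p powr \<gamma> \<le> real p powr 1"
        using p assms(5) by (intro powr_mono) auto
      also have "\<dots> \<le> real P0" using p False by simp
      finally have "real k \<le> c * real P0"
        using k(1) assms(3) by (meson mult_left_mono less_imp_le order_trans)
      moreover have "ln (real p) \<le> real P0"
        using p False ln_le_minus_one[of "real p"] by simp
      ultimately have "real k * ln (real p) \<le> (c * real P0) * real P0"
        using p assms(3) by (intro mult_mono) auto
      then have "x \<le> c * (real P0)\<^sup>2 * (1 / real n)"
        using n by (simp add: x_def power2_eq_square divide_right_mono mult.assoc)
      also have "\<dots> \<le> c * (real P0)\<^sup>2 * y"
      proof -
        have "sqrt (real n) \<le> real n"
          using n real_sqrt_le_mono[of "real n" "(real n)\<^sup>2"] by (simp add: power2_eq_square)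
        then have "1 / real n \<le> y" using n by (simp add: y_def frac_le)
        then show ?thesis using assms(3) by (intro mult_left_mono) auto
      qed
      finally have "x + y \<le> D * y" by (simp add: D_def algebra_simps)
      then have "c1 * (x + y) \<le> t * r / D * (D * y)"
        using x y c1 t r D by (intro mult_mono) (auto simp: c1_def)
      also have "\<dots> = t * y * r" using D by simp
      finally show ?thesis by (rule conclude[OF par])
    qed
    then show "ennreal (c1 * norm2 \<xi> * (real k * (ln (real p) / real n) + 1 / sqrt (real n)) * \<sigma>) \<le> ?E"
      by (simp only: x_def y_def)
  qed
qed

end
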